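(* Let $(E_0,E_1)$, $(F_0,F_1)$ and $(G_0,G_1)$ be Banach couples. Let $T$ be a bounded bilinear operator from $(E_0+E_1)\times(F_0+F_1)$ into $G_0+G_1$ such that, for $k=0,1$, the restriction $T|_{E_k\times F_k}$ is bounded and compact from $E_k\times F_k$ into $G_k$. Let $\rho\in\mathcal{B}^{+-}$, let $\gamma(t)=1/\overline{\rho}(t^{-1})$ for $t>0$, and let $1\le p,q,r\le\infty$ satisfy $1/r=1/p+1/q-1$. Then $T$ is compact from $(E_0,E_1)_{\gamma,p}\times(F_0,F_1)_{\rho,q}$ into $(G_0,G_1)_{\rho,r}$.
   Context: A Banach couple $(X_0,X_1)$ is a pair of Banach spaces continuously embedded in a common Hausdorff topological vector space. $X_0\cap X_1$ has norm $\max\{\|x\|_{X_0},\|x\|_{X_1}\}$ and $X_0+X_1$ has norm $\inf_{x=x_0+x_1}(\|x_0\|_{X_0}+\|x_1\|_{X_1})$. A bounded bilinear map $T:X\times Y\to Z$ between Banach spaces is compact if the image of $\{(x,y):\max\{\|x\|_X,\|y\|_Y\}\le1\}$ is totally bounded in $Z$. A function parameter is a continuous positive function $\rho$ on $(0,\infty)$. It belongs to $\mathcal{B}$ if $\rho(1)=1$ and $\overline{\rho}(s)=\sup_{t>0}\rho(st)/\rho(t)<\infty$ for all $s>0$. It belongs to $\mathcal{B}^{+-}$ if moreover $\int_0^\infty\min(1,1/t)\,\overline{\rho}(t)\,\frac{dt}{t}<\infty$. For $x\in X_0\cap X_1$ let $J(t,x)=\max\{\|x\|_{X_0},t\|x\|_{X_1}\}$.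 For $f=\rho$ or $f=\gamma$ and $0<q\le\infty$, $(X_0,X_1)_{f,q}$ is the space of $x\in X_0+X_1$ having a representation $x=\sum_{n\in\mathbb{Z}}u_n$ (convergence in $X_0+X_1$), $u_n\in X_0\cap X_1$, with $\|x\|_{f,q;J}=\inf\|(f(2^n)^{-1}J(2^n,u_n))_{n}\|_{\ell^q(\mathbb{Z})}<\infty$, the infimum being over all such representations. It coincides, with equivalent norms, with the space with norm $\|(f(2^n)^{-1}K(2^n,x))_n\|_{\ell^q(\mathbb{Z})}$, where $K(t,x)=\inf_{x=x_0+x_1}(\|x_0\|_{X_0}+t\|x_1\|_{X_1})$. *)

theory Defs
  imports "HOL-Analysis.Analysis"
begin

section \<open>Banach couples\<close>

text \<open>
  All spaces are real. A space over the complex numbers is in particular a real one, and neither the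
  interpolation spaces nor compactness depends on the complex structure.
\<close>

class hausdorff_tvs = real_vector + topological_ab_group_add + t2_space +
  assumes tendsto_scaleR_tvs:
    "((\<lambda>p. fst p *\<^sub>R snd p) \<longlongrightarrow> c *\<^sub>R x) (nhds c \<times>\<^sub>F nhds x)"

text \<open>
  A normed space is a subspace \<open>pts\<close> of an ambient vector space together with a norm \<open>nrm\<close>, whose
  values outside \<open>pts\<close> are irrelevant.
\<close>

record 'a nspace =
  pts :: "'a set"
  nrm :: "'a \<Rightarrow> real"

definition normed_space :: "('a::real_vector, 'm) nspace_scheme \<Rightarrow> bool" where
  "normed_space X \<longleftrightarrow>
     subspace (pts X) \<and>
     (\<forall>x\<in>pts X. nrm X x \<ge> 0 \<and> (nrm X x = 0 \<longleftrightarrow> x = 0)) \<and>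
     (\<forall>c. \<forall>x\<in>pts X. nrm X (c *\<^sub>R x) = \<bar>c\<bar> * nrm X x) \<and>
     (\<forall>x\<in>pts X. \<forall>y\<in>pts X. nrm X (x + y) \<le> nrm X x + nrm X y)"

text \<open>
  The value 0 outside \<open>pts X\<close> is there because the locale \<open>Metric_space\<close> requires its distance to be
  nonnegative and symmetric on the whole type.
\<close>

definition ndist :: "('a::real_vector, 'm) nspace_scheme \<Rightarrow> 'a \<Rightarrow> 'a \<Rightarrow> real" where
  "ndist X x y = (if x \<in> pts X \<and> y \<in> pts X then nrm X (x - y) else 0)"

definition banach_space :: "('a::real_vector, 'm) nspace_scheme \<Rightarrow> bool" where
  "banach_space X \<longleftrightarrow> normed_space X \<and> Metric_space.mcomplete (pts X) (ndist X)"

definition banach_couple ::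
  "('a::hausdorff_tvs, 'm) nspace_scheme \<Rightarrow> ('a, 'm) nspace_scheme \<Rightarrow> bool" where
  "banach_couple X0 X1 \<longleftrightarrow>
     banach_space X0 \<and> banach_space X1 \<and>
     continuous_map (Metric_space.mtopology (pts X0) (ndist X0)) euclidean (\<lambda>x. x) \<and>
     continuous_map (Metric_space.mtopology (pts X1) (ndist X1)) euclidean (\<lambda>x. x)"

definition sum_space :: "'a::real_vector nspace \<Rightarrow> 'a nspace \<Rightarrow> 'a nspace" where
  "sum_space X0 X1 =
     \<lparr>pts = {x0 + x1 |x0 x1. x0 \<in> pts X0 \<and> x1 \<in> pts X1},
      nrm = (\<lambda>x. Inf {nrm X0 x0 + nrm X1 x1 |x0 x1.
                      x0 \<in> pts X0 \<and> x1 \<in> pts X1 \<and> x = x0 + x1})\<rparr>"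

section \<open>Compact bilinear maps\<close>

definition bounded_bilinear_map ::
  "'a::real_vector nspace \<Rightarrow> 'b::real_vector nspace \<Rightarrow> 'c::real_vector nspace \<Rightarrow>
   ('a \<Rightarrow> 'b \<Rightarrow> 'c) \<Rightarrow> bool" where
  "bounded_bilinear_map X Y Z T \<longleftrightarrow>
     (\<forall>x\<in>pts X. \<forall>y\<in>pts Y. T x y \<in> pts Z) \<and>
     (\<forall>x\<in>pts X. \<forall>x'\<in>pts X. \<forall>y\<in>pts Y. T (x + x') y = T x y + T x' y) \<and>
     (\<forall>x\<in>pts X. \<forall>y\<in>pts Y. \<forall>y'\<in>pts Y. T x (y + y') = T x y + T x y') \<and>
     (\<forall>c. \<forall>x\<in>pts X. \<forall>y\<in>pts Y. T (c *\<^sub>R x) y = c *\<^sub>R T x y \<and> T x (c *\<^sub>R y) = c *\<^sub>R T x y) \<and>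
     (\<exists>C. \<forall>x\<in>pts X. \<forall>y\<in>pts Y. nrm Z (T x y) \<le> C * nrm X x * nrm Y y)"

definition compact_bilinear_map ::
  "'a::real_vector nspace \<Rightarrow> 'b::real_vector nspace \<Rightarrow> 'c::real_vector nspace \<Rightarrow>
   ('a \<Rightarrow> 'b \<Rightarrow> 'c) \<Rightarrow> bool" where
  "compact_bilinear_map X Y Z T \<longleftrightarrow>
     bounded_bilinear_map X Y Z T \<and>
     Metric_space.mtotally_bounded (pts Z) (ndist Z)
       {T x y |x y. x \<in> pts X \<and> y \<in> pts Y \<and> max (nrm X x) (nrm Y y) \<le> 1}"

section \<open>Function parameters\<close>

definition function_parameter :: "(real \<Rightarrow> real) \<Rightarrow> bool" where
  "function_parameter \<rho> \<longleftrightarrow> continuous_on {0<..} \<rho> \<and> (\<forall>t>0. \<rho> t > 0)"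

text \<open>The supremum is meaningful only where it is finite, which \<open>param_B\<close> demands for all \<open>s > 0\<close>.\<close>

definition dil :: "(real \<Rightarrow> real) \<Rightarrow> real \<Rightarrow> real" where
  "dil \<rho> s = (SUP t\<in>{0<..}. \<rho> (s * t) / \<rho> t)"

definition param_B :: "(real \<Rightarrow> real) set" where
  "param_B = {\<rho>. function_parameter \<rho> \<and> \<rho> 1 = 1 \<and>
                 (\<forall>s>0. bdd_above ((\<lambda>t. \<rho> (s * t) / \<rho> t) ` {0<..}))}"

definition param_Bpm :: "(real \<Rightarrow> real) set" where
  "param_Bpm = {\<rho> \<in> param_B.
     set_integrable lborel {0<..} (\<lambda>t. min 1 (1 / t) * dil \<rho> t / t)}"

section \<open>Real interpolation spaces with function parameter\<close>

definition J_fun :: "'a nspace \<Rightarrow> 'a nspace \<Rightarrow> real \<Rightarrow> 'a \<Rightarrow> real" where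
  "J_fun X0 X1 t x = max (nrm X0 x) (t * nrm X1 x)"

definition lq_norm :: "ereal \<Rightarrow> (int \<Rightarrow> real) \<Rightarrow> ennreal" where
  "lq_norm q a =
     (if q = \<infinity> then (SUP n. ennreal \<bar>a n\<bar>)
      else if (\<lambda>n. \<bar>a n\<bar> powr real_of_ereal q) summable_on UNIV
      then ennreal ((\<Sum>\<^sub>\<infinity>n. \<bar>a n\<bar> powr real_of_ereal q) powr (1 / real_of_ereal q))
      else \<infinity>)"

text \<open>
  The representations \<open>x = (\<Sum>n. u n)\<close> over the integers: the partial sums from \<open>-M\<close> to \<open>N\<close> converge
  to \<open>x\<close> in the norm of the sum space as \<open>M\<close> and \<open>N\<close> tend to infinity independently.
\<close>

definition J_reps :: "'a::real_vector nspace \<Rightarrow> 'a nspace \<Rightarrow> 'a \<Rightarrow> (int \<Rightarrow> 'a) set" where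
  "J_reps X0 X1 x =
     {u. (\<forall>n. u n \<in> pts X0 \<inter> pts X1) \<and>
         ((\<lambda>(M, N). nrm (sum_space X0 X1) (x - (\<Sum>n\<in>{- int M..int N}. u n))) \<longlongrightarrow> 0)
           (sequentially \<times>\<^sub>F sequentially)}"

text \<open>The infimum over the empty set of representations is \<open>\<infinity>\<close>.\<close>

definition J_norm ::
  "'a::real_vector nspace \<Rightarrow> 'a nspace \<Rightarrow> (real \<Rightarrow> real) \<Rightarrow> ereal \<Rightarrow> 'a \<Rightarrow> ennreal" where
  "J_norm X0 X1 f q x =
     (INF u\<in>J_reps X0 X1 x. lq_norm q (\<lambda>n. J_fun X0 X1 (2 powi n) (u n) / f (2 powi n)))"

definition interp_space ::
  "'a::real_vector nspace \<Rightarrow> 'a nspace \<Rightarrow> (real \<Rightarrow> real) \<Rightarrow> ereal \<Rightarrow> 'a nspace" where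
  "interp_space X0 X1 f q =
     \<lparr>pts = {x \<in> pts (sum_space X0 X1). J_norm X0 X1 f q x < \<infinity>},
      nrm = (\<lambda>x. enn2real (J_norm X0 X1 f q x))\<rparr>"

end

theory Submission
  imports Defs
begin

text \<open>
  If \<open>x = \<Sum>u\<^sub>n\<close> and \<open>y = \<Sum>v\<^sub>m\<close> are J-representations, then \<open>T x y = \<Sum>w\<^sub>k\<close> with
  \<open>w\<^sub>k = \<Sum>{T u\<^sub>n v\<^sub>m | n + m = k + s}\<close>, for any fixed shift \<open>s\<close>. If the norm of \<open>T u\<^sub>n v\<^sub>m\<close> relative to
  \<open>J (2\<^sup>n, u\<^sub>n) J (2\<^sup>m, v\<^sub>m)\<close> is at most \<open>a\<^sub>0\<close> in \<open>G0\<close> and at most \<open>a\<^sub>1 2\<^bsup>-(n + m)\<^esup>\<close> in \<open>G1\<close>, then Young's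
  inequality bounds the norm of \<open>T x y\<close> by \<open>max a\<^sub>0 (2\<^bsup>-s\<^esup> a\<^sub>1) dil \<rho> (2\<^sup>s)\<close>. Compactness into \<open>G0\<close> and boundedness
  on the sum spaces make \<open>a\<^sub>0\<close> small as soon as \<open>n\<close> or \<open>m\<close> is large, and likewise \<open>a\<^sub>1\<close> is small when \<open>n\<close> or
  \<open>m\<close> is very negative. Since \<open>2\<^bsup>-s\<^esup> dil \<rho> (2\<^sup>s)\<close> and \<open>dil \<rho> (2\<^bsup>-s\<^esup>)\<close> tend to 0 for \<open>s \<rightarrow> \<infinity>\<close>, a suitable shift
  makes both tails small in the interpolation space. What remains are products of bounded subsets of the
  intersections \<open>E0 \<inter> E1\<close> and \<open>F0 \<inter> F1\<close>, which are totally bounded in \<open>G0\<close> and in \<open>G1\<close>, hence in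
  \<open>G0 \<inter> G1\<close>.
\<close>

section \<open>Weighted sequence spaces and Young's inequality\<close>

text \<open>Compactness at an endpoint yields smallness as follows. If
  \<open>J (2^n, u) \<le> 1\<close>, then \<open>u\<close> has norm at most \<open>2^-n\<close> in
  \<open>E1\<close>, hence in \<open>E0 + E1\<close>. Boundedness on the sum spaces makes
  \<open>T u v\<close> small in \<open>G0 + G1\<close>, and a totally bounded subset of
  \<open>G0\<close> has no elements that are small in \<open>G0 + G1\<close> but not in
  \<open>G0\<close>. The obstacle is that this controls one endpoint at a time: for large indices
  \<open>a\<^sub>1\<close> keeps its crude value. The shift is the remedy, provided that it is fixed
  before the cut-off: a large \<open>s\<close> makes the contribution of the crude constant small,
  and the cut-off index is chosen afterwards, so large that \<open>a\<^sub>0\<close> beats the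
  factor \<open>dil \<rho> (2^s)\<close>. Very negative indices use the shift \<open>-s\<close> with
  the endpoints exchanged. As for \<gamma>, substituting in the supremum gives
  \<open>\<gamma> s = inf (\<rho> (s * t) / \<rho> t)\<close> over \<open>t > 0\<close>, so it is
  the largest function with \<open>\<gamma> s * \<rho> t \<le> \<rho> (s * t)\<close>. The weights
  of two factors thus multiply to at most the weight of the product, the normalized sequences
  convolve, and the relation between the exponents is the one of Young's inequality.\<close>

text \<open>Testing on finite sets needs no summability and is stable under pointwise limits.
  Agreement with \<open>lq_norm\<close> is claimed for \<open>0 \<le> B\<close> only, which is why
  that side condition recurs: \<open>powr\<close> gives a negative \<open>B\<close> no useful
  meaning.\<close>

definition lq_le :: "ereal \<Rightarrow> (int \<Rightarrow> real) \<Rightarrow> real \<Rightarrow> bool" where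
  "lq_le q a B \<longleftrightarrow>
     (if q = \<infinity> then \<forall>n. \<bar>a n\<bar> \<le> B
      else \<forall>F. finite F \<longrightarrow> (\<Sum>n\<in>F. \<bar>a n\<bar> powr real_of_ereal q) \<le> B powr real_of_ereal q)"

lemma ereal_ge_1_cases:
  fixes q :: ereal
  assumes "1 \<le> q"
  obtains "q = \<infinity>" | q' where "q = ereal q'" "1 \<le> q'"
  using assms by (cases q) auto

lemma lq_norm_le_iff:
  assumes "1 \<le> q" and "0 \<le> B"
  shows "lq_norm q a \<le> ennreal B \<longleftrightarrow> lq_le q a B"
  using \<open>1 \<le> q\<close>
proof (cases rule: ereal_ge_1_cases)
  case 1
  then show ?thesis using \<open>0 \<le> B\<close> by (auto simp: lq_norm_def lq_le_def SUP_le_iff)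
next
  case (2 s)
  let ?f = "\<lambda>n. \<bar>a n\<bar> powr s"
  show ?thesis
  proof
    assume le: "lq_norm q a \<le> ennreal B"
    then have sm: "?f summable_on UNIV"
      by (auto simp: lq_norm_def 2 top_unique split: if_splits)
    with le have "(\<Sum>\<^sub>\<infinity>n. ?f n) powr (1 / s) \<le> B"
      using assms by (simp add: lq_norm_def 2)
    then have "((\<Sum>\<^sub>\<infinity>n. ?f n) powr (1 / s)) powr s \<le> B powr s"
      using 2 by (intro powr_mono2) auto
    then have "(\<Sum>\<^sub>\<infinity>n. ?f n) \<le> B powr s"
      using 2 by (simp add: powr_powr infsum_nonneg)
    moreover have "sum ?f F \<le> (\<Sum>\<^sub>\<infinity>n. ?f n)" if "finite F" for F
      using that sm by (intro finite_sum_le_infsum) auto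
    ultimately show "lq_le q a B" by (force simp: lq_le_def 2)
  next
    assume "lq_le q a B"
    then have fin: "sum ?f F \<le> B powr s" if "finite F" for F
      using that by (simp add: lq_le_def 2)
    have sm: "?f summable_on UNIV"
      by (intro nonneg_bdd_above_summable_on bdd_aboveI[where M = "B powr s"]) (use fin in auto)
    then have "(\<Sum>\<^sub>\<infinity>n. ?f n) \<le> B powr s"
      by (intro infsum_le_finite_sums) (use fin in auto)
    then have "(\<Sum>\<^sub>\<infinity>n. ?f n) powr (1 / s) \<le> (B powr s) powr (1 / s)"
      using 2 by (intro powr_mono2) (auto intro: infsum_nonneg)
    then show "lq_norm q a \<le> ennreal B"
      using sm 2 assms by (simp add: lq_norm_def powr_powr)
  qed
qed

lemma lq_le_component:
  assumes "1 \<le> q" and "0 \<le> B" and "lq_le q a B"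
  shows "\<bar>a n\<bar> \<le> B"
  using \<open>1 \<le> q\<close>
proof (cases rule: ereal_ge_1_cases)
  case 1
  then show ?thesis using assms by (auto simp: lq_le_def)
next
  case (2 s)
  then have "\<forall>F. finite F \<longrightarrow> (\<Sum>n\<in>F. \<bar>a n\<bar> powr s) \<le> B powr s"
    using assms(3) by (simp add: lq_le_def)
  from this[rule_format, of "{n}"] have "\<bar>a n\<bar> powr s \<le> B powr s" by simp
  then show ?thesis
    using powr_less_mono2[of s B "\<bar>a n\<bar>"] 2 assms(2) by (cases "\<bar>a n\<bar> \<le> B") auto
qed

lemma lq_le_mono:
  assumes "1 \<le> q" and "lq_le q b B" and "\<And>n. \<bar>a n\<bar> \<le> \<bar>b n\<bar>"
  shows "lq_le q a B"
  using \<open>1 \<le> q\<close>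
proof (cases rule: ereal_ge_1_cases)
  case 1
  then show ?thesis using assms by (auto simp: lq_le_def intro: order_trans)
next
  case (2 s)
  have "(\<Sum>n\<in>F. \<bar>a n\<bar> powr s) \<le> B powr s" if "finite F" for F
  proof -
    have "(\<Sum>n\<in>F. \<bar>a n\<bar> powr s) \<le> (\<Sum>n\<in>F. \<bar>b n\<bar> powr s)"
      using assms(3) 2 by (intro sum_mono powr_mono2) auto
    also have "\<dots> \<le> B powr s" using assms(2) that 2 by (simp add: lq_le_def)
    finally show ?thesis .
  qed
  then show ?thesis by (simp add: lq_le_def 2)
qed

lemma lq_le_scale:
  assumes "1 \<le> q" and "0 \<le> B" and "lq_le q a B"
  shows "lq_le q (\<lambda>n. c * a n) (\<bar>c\<bar> * B)"
  using \<open>1 \<le> q\<close>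
proof (cases rule: ereal_ge_1_cases)
  case 1
  then show ?thesis using assms by (auto simp: lq_le_def abs_mult intro: mult_left_mono)
next
  case (2 s)
  then show ?thesis using assms
    by (auto simp: lq_le_def abs_mult powr_mult simp flip: sum_distrib_left intro!: mult_left_mono)
qed

lemma lq_le_shift:
  assumes "lq_le q a B"
  shows "lq_le q (\<lambda>n. a (n + s)) B"
proof -
  have "(\<Sum>n\<in>F. \<bar>a (n + s)\<bar> powr t) = (\<Sum>n\<in>(\<lambda>n. n + s) ` F. \<bar>a n\<bar> powr t)" for F t
    by (subst sum.reindex) auto
  then show ?thesis using assms by (simp add: lq_le_def)
qed

lemma lq_le_zero: "lq_le q (\<lambda>_. 0) 0"
  by (simp add: lq_le_def)

lemma lq_le_single:
  assumes "1 \<le> q" and "0 \<le> c"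
  shows "lq_le q (\<lambda>n. if n = k then c else 0) c"
  using \<open>1 \<le> q\<close>
proof (cases rule: ereal_ge_1_cases)
  case 1
  then show ?thesis using assms by (auto simp: lq_le_def)
next
  case (2 s)
  have "(\<Sum>n\<in>F. \<bar>if n = k then c else 0\<bar> powr s) \<le> c powr s" if "finite F" for F
  proof -
    have "(\<Sum>n\<in>F. \<bar>if n = k then c else 0\<bar> powr s) = (\<Sum>n\<in>F. if k = n then c powr s else 0)"
      using assms by (intro sum.cong) auto
    also have "\<dots> \<le> c powr s" using that by simp
    finally show ?thesis .
  qed
  then show ?thesis by (simp add: lq_le_def 2)
qed

lemma lq_le_weaken:
  assumes "1 \<le> q" and "0 \<le> A" and "A \<le> B" and "lq_le q a A"
  shows "lq_le q a B"
  using assms lq_norm_le_iff[of q A a] lq_norm_le_iff[of q B a]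
  by (meson ennreal_leI order_trans)

section \<open>Convexity of powers and Minkowski's inequality\<close>

lemma powr_convex_combination:
  fixes x y l s :: real
  assumes "1 \<le> s" "0 \<le> x" "0 \<le> y" "0 \<le> l" "l \<le> 1"
  shows "(l * x + (1 - l) * y) powr s \<le> l * x powr s + (1 - l) * y powr s"
proof -
  have le: "c powr s \<le> c" if "0 \<le> c" "c \<le> 1" for c
    using powr_mono'[of 1 s c] that assms(1) by simp
  consider "x = 0" | "y = 0" | "x > 0" "y > 0" using assms by linarith
  then show ?thesis
  proof cases
    case 1
    then show ?thesis using le[of "1 - l"] assms by (simp add: powr_mult mult_right_mono)
  next
    case 2
    then show ?thesis using le[of l] assms by (simp add: powr_mult mult_right_mono)
  next
    case 3
    from convex_onD[OF powr_convex[OF assms(1)], of "1 - l" x y] 3 assms show ?thesis by simp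
  qed
qed

text \<open>Minkowski's inequality without duality: \<open>(a + b) / (A + B)\<close> is the convex
  combination of \<open>a / A\<close> and \<open>b / B\<close> with weights
  \<open>A / (A + B)\<close> and \<open>B / (A + B)\<close>, and convexity of the power is summed
  over \<open>F\<close>. The bounds 0 are set apart because of the divisions.\<close>

lemma lq_le_add:
  assumes q: "1 \<le> q" and "0 \<le> A" and "0 \<le> B" and a: "lq_le q a A" and b: "lq_le q b B"
  shows "lq_le q (\<lambda>n. a n + b n) (A + B)"
proof (cases "A = 0 \<or> B = 0")
  case True
  then show ?thesis
  proof
    assume "A = 0"
    then have "a n = 0" for n using lq_le_component[OF q _ a, of n] by simp
    then show ?thesis using b \<open>A = 0\<close> by simp
  next
    assume "B = 0"
    then have "b n = 0" for n using lq_le_component[OF q _ b, of n] by simp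
    then show ?thesis using a \<open>B = 0\<close> by simp
  qed
next
  case False
  then have pos: "A > 0" "B > 0" using assms by auto
  show ?thesis using q
  proof (cases rule: ereal_ge_1_cases)
    case 1
    then show ?thesis using a b
      by (auto simp: lq_le_def intro: order_trans[OF abs_triangle_ineq add_mono])
  next
    case (2 s)
    define l where "l = A / (A + B)"
    have l: "0 \<le> l" "l \<le> 1" "1 - l = B / (A + B)" using pos by (auto simp: l_def field_simps)
    have pw: "\<bar>a n + b n\<bar> powr s
        \<le> (A + B) powr s * (l * (\<bar>a n\<bar> powr s / A powr s) + (1 - l) * (\<bar>b n\<bar> powr s / B powr s))" for n
    proof -
      have "\<bar>a n + b n\<bar> \<le> \<bar>a n\<bar> + \<bar>b n\<bar>" by simp
      also have "\<dots> = (A + B) * (l * (\<bar>a n\<bar> / A) + (1 - l) * (\<bar>b n\<bar> / B))"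
      proof -
        have "A + B \<noteq> 0" using pos by simp
        then have "(A + B) * (A / (A + B) * (X / A) + B / (A + B) * (Y / B)) = X + Y" for X Y
          using pos by (simp add: distrib_left)
        then show ?thesis by (simp only: l(3)) (simp only: l_def)
      qed
      finally have "\<bar>a n + b n\<bar> powr s
          \<le> ((A + B) * (l * (\<bar>a n\<bar> / A) + (1 - l) * (\<bar>b n\<bar> / B))) powr s"
        using 2 by (intro powr_mono2) auto
      also have "\<dots> = (A + B) powr s * (l * (\<bar>a n\<bar> / A) + (1 - l) * (\<bar>b n\<bar> / B)) powr s"
        using pos l by (intro powr_mult)
      also have "\<dots> \<le> (A + B) powr s * (l * (\<bar>a n\<bar> / A) powr s + (1 - l) * (\<bar>b n\<bar> / B) powr s)"
        using 2 pos l by (intro mult_left_mono powr_convex_combination) auto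
      finally show ?thesis using pos by (simp add: powr_divide)
    qed
    have "(\<Sum>n\<in>F. \<bar>a n + b n\<bar> powr s) \<le> (A + B) powr s" if F: "finite F" for F
    proof -
      have "(\<Sum>n\<in>F. \<bar>a n + b n\<bar> powr s) \<le> (\<Sum>n\<in>F. (A + B) powr s *
          (l * (\<bar>a n\<bar> powr s / A powr s) + (1 - l) * (\<bar>b n\<bar> powr s / B powr s)))"
        by (intro sum_mono pw)
      also have "\<dots> = (A + B) powr s *
          (l * ((\<Sum>n\<in>F. \<bar>a n\<bar> powr s) / A powr s) + (1 - l) * ((\<Sum>n\<in>F. \<bar>b n\<bar> powr s) / B powr s))"
        by (simp add: sum.distrib flip: sum_distrib_left sum_divide_distrib)
      also have "\<dots> \<le> (A + B) powr s * (l * 1 + (1 - l) * 1)"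
        using a b F 2 pos l by (intro mult_left_mono add_mono) (auto simp: lq_le_def)
      finally show ?thesis by simp
    qed
    then show ?thesis by (simp add: lq_le_def 2)
  qed
qed

text \<open>
  This is weighted AM-GM: the weights \<open>\<alpha>\<close>, \<open>1 / p - \<alpha>\<close>, \<open>1 / q - \<alpha>\<close> sum to 1 and the weighted geometric mean is
  \<open>x * y / S powr \<alpha>\<close>.
\<close>

lemma young_pointwise:
  fixes x y S p q \<alpha> :: real
  assumes "x \<ge> 0" "y \<ge> 0" "S > 0" "p \<ge> 1" "q \<ge> 1" "0 \<le> \<alpha>" "\<alpha> = 1 / p + 1 / q - 1"
  shows "x * y \<le> S powr \<alpha> * (\<alpha> * (x powr p * y powr q / S) + (1 / p - \<alpha>) * x powr p
                          + (1 / q - \<alpha>) * y powr q)"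
proof (cases "x = 0 \<or> y = 0")
  case True
  have "1 / p \<le> 1" "1 / q \<le> 1" using assms by simp_all
  then have "\<alpha> \<le> 1 / p" "\<alpha> \<le> 1 / q" using assms by linarith+
  with True assms show ?thesis by auto
next
  case False
  then have pos: "x > 0" "y > 0" using assms by auto
  \<comment> \<open>The logarithms of the three terms to be averaged; \<open>m\<close> is the
    logarithm of their weighted geometric mean.\<close>
  define t1 t2 t3 where "t1 = p * ln x + q * ln y - ln S" and "t2 = p * ln x" and "t3 = q * ln y"
  define m where "m = ln x + ln y - \<alpha> * ln S"
  have "1 / p \<le> 1" "1 / q \<le> 1" using assms by simp_all
  then have al: "\<alpha> \<le> 1 / p" "\<alpha> \<le> 1 / q" using assms by linarith+
  have mean: "\<alpha> * t1 + (1 / p - \<alpha>) * t2 + (1 / q - \<alpha>) * t3 = m"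
    using assms(4,5) by (simp add: t1_def t2_def t3_def m_def algebra_simps)
  \<comment> \<open>The exponential lies above its tangent at \<open>m\<close>. Since
    \<open>m\<close> is the weighted mean of \<open>t1\<close>, \<open>t2\<close>,
    \<open>t3\<close>, the linear terms cancel after averaging.\<close>
  have tan: "exp m * (1 + (t - m)) \<le> exp t" for t
    using mult_left_mono[OF exp_ge_add_one_self[of "t - m"], of "exp m"] by (simp flip: exp_add)
  have "exp m = exp m * (1 + ((\<alpha> * t1 + (1 / p - \<alpha>) * t2 + (1 / q - \<alpha>) * t3) - m))"
    by (simp add: mean)
  also have "\<dots> = \<alpha> * (exp m * (1 + (t1 - m))) + (1 / p - \<alpha>) * (exp m * (1 + (t2 - m)))
      + (1 / q - \<alpha>) * (exp m * (1 + (t3 - m)))"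
  proof -
    have "(c1 * t1 + c2 * t2 + c3 * t3 - m) = c1 * (t1 - m) + c2 * (t2 - m) + c3 * (t3 - m)"
      if "c1 + c2 + c3 = 1" for c1 c2 c3
    proof -
      have "m = (c1 + c2 + c3) * m" using that by simp
      then show ?thesis by (simp add: algebra_simps)
    qed
    moreover have s1: "\<alpha> + (1 / p - \<alpha>) + (1 / q - \<alpha>) = 1" using assms(7) by simp
    ultimately have "(\<alpha> * t1 + (1 / p - \<alpha>) * t2 + (1 / q - \<alpha>) * t3 - m) =
       \<alpha> * (t1 - m) + (1 / p - \<alpha>) * (t2 - m) + (1 / q - \<alpha>) * (t3 - m)" by blast
    moreover have "E * (1 + (c1 * d1 + c2 * d2 + c3 * d3)) =
      c1 * (E * (1 + d1)) + c2 * (E * (1 + d2)) + c3 * (E * (1 + d3))"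
      if "c1 + c2 + c3 = 1" for c1 c2 c3 d1 d2 d3 E :: real
    proof -
      have "c1 * (E * (1 + d1)) + c2 * (E * (1 + d2)) + c3 * (E * (1 + d3))
         = E * ((c1 + c2 + c3) + (c1 * d1 + c2 * d2 + c3 * d3))" by (simp add: algebra_simps)
      then show ?thesis using that by simp
    qed
    ultimately show ?thesis using s1 by metis
  qed
  also have "\<dots> \<le> \<alpha> * exp t1 + (1 / p - \<alpha>) * exp t2 + (1 / q - \<alpha>) * exp t3"
    using al assms by (intro add_mono mult_left_mono tan) auto
  finally have "S powr \<alpha> * exp m \<le> S powr \<alpha> * (\<alpha> * exp t1 + (1 / p - \<alpha>) * exp t2 + (1 / q - \<alpha>) * exp t3)"
    by (intro mult_left_mono) auto
  moreover have "S powr \<alpha> * exp m = x * y"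
  proof -
    have "S powr \<alpha> * exp m = exp (\<alpha> * ln S + m)" using assms by (simp add: powr_def exp_add)
    also have "\<alpha> * ln S + m = ln x + ln y" by (simp add: m_def)
    finally show ?thesis using pos by (simp add: exp_add)
  qed
  moreover have "exp t1 = x powr p * y powr q / S" "exp t2 = x powr p" "exp t3 = y powr q"
    using pos assms by (auto simp: t1_def t2_def t3_def powr_def exp_add exp_diff)
  ultimately show ?thesis by simp
qed

text \<open>One common \<open>S\<close> is used for all \<open>n\<close>: summing the pointwise
  bound makes the three terms at most \<alpha>, \<open>1 / p - \<alpha>\<close> and
  \<open>1 / q - \<alpha>\<close>, whose sum is 1. With \<open>\<alpha> = 1 / r\<close> the
  \<open>r\<close>-th power of the left side is then at most \<open>S\<close>, itself a convolution
  of two sequences with sums at most 1, so that summing over \<open>k\<close> becomes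
  trivial.\<close>

lemma young_convolution_pointwise:
  fixes a b :: "int \<Rightarrow> real" and p q \<alpha> :: real and k :: int
  assumes "\<And>n. a n \<ge> 0" "\<And>n. b n \<ge> 0" "p \<ge> 1" "q \<ge> 1" "0 \<le> \<alpha>" "\<alpha> = 1 / p + 1 / q - 1"
    and a: "\<And>F. finite F \<Longrightarrow> (\<Sum>n\<in>F. a n powr p) \<le> 1"
    and b: "\<And>F. finite F \<Longrightarrow> (\<Sum>n\<in>F. b n powr q) \<le> 1"
    and N: "finite N"
  defines "S \<equiv> \<Sum>n\<in>N. a n powr p * b (k - n) powr q"
  shows "(\<Sum>n\<in>N. a n * b (k - n)) \<le> S powr \<alpha>"
proof (cases "S = 0")
  case True
  then have "\<forall>n\<in>N. a n powr p * b (k - n) powr q = 0"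
    unfolding S_def by (subst (asm) sum_nonneg_eq_0_iff) (use N in auto)
  then have "(\<Sum>n\<in>N. a n * b (k - n)) = 0" by (intro sum.neutral) auto
  then show ?thesis by simp
next
  case False
  moreover have "S \<ge> 0" unfolding S_def by (intro sum_nonneg) auto
  ultimately have Sp: "S > 0" by simp
  have "1 / p \<le> 1" "1 / q \<le> 1" using assms by simp_all
  then have al: "\<alpha> \<le> 1 / p" "\<alpha> \<le> 1 / q" using assms by linarith+
  have b': "(\<Sum>n\<in>N. b (k - n) powr q) \<le> 1"
  proof -
    have "(\<Sum>n\<in>N. b (k - n) powr q) = (\<Sum>n\<in>(\<lambda>n. k - n) ` N. b n powr q)"
      by (subst sum.reindex) (auto simp: inj_on_def)
    then show ?thesis using b N by auto
  qed
  have "(\<Sum>n\<in>N. a n * b (k - n)) \<le> (\<Sum>n\<in>N. S powr \<alpha> * (\<alpha> * (a n powr p * b (k - n) powr q / S)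
      + (1 / p - \<alpha>) * a n powr p + (1 / q - \<alpha>) * b (k - n) powr q))"
    using assms(1-6) Sp by (intro sum_mono young_pointwise) auto
  also have "\<dots> = S powr \<alpha> * (\<alpha> * (S / S) + (1 / p - \<alpha>) * (\<Sum>n\<in>N. a n powr p)
      + (1 / q - \<alpha>) * (\<Sum>n\<in>N. b (k - n) powr q))"
    by (simp add: S_def sum.distrib flip: sum_distrib_left sum_divide_distrib)
  also have "\<dots> \<le> S powr \<alpha> * (\<alpha> * 1 + (1 / p - \<alpha>) * 1 + (1 / q - \<alpha>) * 1)"
    using Sp al assms(5) a[OF N] b' by (intro mult_left_mono add_mono) auto
  also have "\<dots> = S powr \<alpha>" using assms(6) by simp
  finally show ?thesis .
qed

text \<open>The left side is nonnegative and the right side nonpositive, so both vanish. This is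
  what Young's relation says when the remaining exponent is infinite, and it reduces that case to
  pairing a summable with a bounded sequence.\<close>

lemma young_exponents_infinite:
  fixes q r :: ereal
  assumes "1 \<le> q" "1 \<le> r" "1 / r = 1 / q - 1"
  shows "q = 1 \<and> r = \<infinity>"
  using assms(1)
proof (cases rule: ereal_ge_1_cases)
  case 1
  then show ?thesis using assms by (cases r) (auto simp: one_ereal_def zero_ereal_def field_simps)
next
  case (2 x)
  note x = this
  show ?thesis using assms(2)
  proof (cases rule: ereal_ge_1_cases)
    case 1
    then show ?thesis using assms x by (auto simp: one_ereal_def zero_ereal_def)
  next
    case (2 y)
    then have "1 / y = 1 / x - 1" using assms x by (auto simp: one_ereal_def zero_ereal_def)
    moreover have "1 / y > 0" "1 / x \<le> 1" using x 2 by auto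
    ultimately show ?thesis by linarith
  qed
qed

text \<open>The inner sum runs over a finite \<open>N\<close>, so that no summability of the
  convolution is presupposed; the full series is recovered by a limit. Infinite \<open>p\<close> or
  \<open>q\<close> pairs a summable with a bounded sequence, infinite \<open>r\<close> is the case
  \<open>\<alpha> = 0\<close>, and for finite exponents the double sum of \<open>?S\<close>
  factorizes after swapping.\<close>

lemma lq_le_convolution_finite_normalized:
  assumes "1 \<le> p" "1 \<le> q" "1 \<le> r" and pqr: "1 / r = 1 / p + 1 / q - 1"
    and a0: "\<And>n. a n \<ge> 0" and b0: "\<And>n. b n \<ge> 0"
    and a: "lq_le p a 1" and b: "lq_le q b 1" and N: "finite N"
  shows "lq_le r (\<lambda>k. \<Sum>n\<in>N. a n * b (k - n)) 1"
proof -
  have c0: "(\<Sum>n\<in>N. a n * b (k - n)) \<ge> 0" for k using a0 b0 by (auto intro: sum_nonneg)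
  have trivial_case: "(\<Sum>n\<in>M. x n * y n) \<le> 1"
    if "finite M" "\<And>n. y n \<le> 1" "\<And>n. (x n::real) \<ge> 0" "\<And>M. finite M \<Longrightarrow> sum x M \<le> 1" for x y and M :: "int set"
  proof -
    have "(\<Sum>n\<in>M. x n * y n) \<le> (\<Sum>n\<in>M. x n)"
      using that mult_left_le by (intro sum_mono) blast
    then show ?thesis using that(4)[OF that(1)] by linarith
  qed
  show ?thesis using \<open>1 \<le> p\<close>
  proof (cases rule: ereal_ge_1_cases)
    case 1
    have "q = 1 \<and> r = \<infinity>" using pqr assms(2,3) 1
      by (intro young_exponents_infinite) auto
    moreover have "(\<Sum>n\<in>N. a n * b (k - n)) \<le> 1" for k
    proof -
      have "(\<Sum>n\<in>N. b (k - n) * a n) \<le> 1"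
      proof (rule trivial_case[OF N])
        show "a n \<le> 1" for n using a a0 1 by (auto simp: lq_le_def)
        show "b (k - n) \<ge> 0" for n by (rule b0)
        show "(\<Sum>n\<in>M. b (k - n)) \<le> 1" if "finite M" for M
        proof -
          have "(\<Sum>n\<in>M. b (k - n)) = (\<Sum>n\<in>(\<lambda>n. k - n) ` M. b n)"
            by (subst sum.reindex) (auto simp: inj_on_def)
          also have "\<dots> \<le> 1" using b that b0 \<open>q = 1 \<and> r = \<infinity>\<close> by (auto simp: lq_le_def)
          finally show ?thesis .
        qed
      qed
      then show ?thesis by (simp add: mult.commute)
    qed
    ultimately show ?thesis using c0 by (simp add: lq_le_def)
  next
    case (2 p')
    note p = this
    show ?thesis using \<open>1 \<le> q\<close>
    proof (cases rule: ereal_ge_1_cases)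
      case 1
      have "p = 1 \<and> r = \<infinity>" using pqr assms(1,3) 1
        by (intro young_exponents_infinite) auto
      moreover have "(\<Sum>n\<in>N. a n * b (k - n)) \<le> 1" for k
      proof (rule trivial_case[OF N])
        show "b (k - n) \<le> 1" for n using b b0 1 by (auto simp: lq_le_def)
        show "sum a M \<le> 1" if "finite M" for M
          using a that a0 \<open>p = 1 \<and> r = \<infinity>\<close> by (auto simp: lq_le_def)
      qed (rule a0)
      ultimately show ?thesis using c0 by (simp add: lq_le_def)
    next
      case (2 q')
      have a': "(\<Sum>n\<in>F. a n powr p') \<le> 1" if "finite F" for F
        using a that a0 p by (auto simp: lq_le_def)
      have b': "(\<Sum>n\<in>F. b n powr q') \<le> 1" if "finite F" for F
        using b that b0 2 by (auto simp: lq_le_def)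
      note conv = young_convolution_pointwise[OF a0 b0 p(2) 2(2) _ _ a' b' N]
      show ?thesis using \<open>1 \<le> r\<close>
      proof (cases rule: ereal_ge_1_cases)
        case 1
        then have "0 = 1 / p' + 1 / q' - 1" using pqr p 2
          by (auto simp: one_ereal_def zero_ereal_def)
        then have "(\<Sum>n\<in>N. a n * b (k - n)) \<le> (\<Sum>n\<in>N. a n powr p' * b (k - n) powr q') powr 0" for k
          by (intro conv) auto
        \<comment> \<open>The value of \<open>powr 0\<close> is 1, except at base 0, where it is 0;
          both are at most 1.\<close>
        then have "(\<Sum>n\<in>N. a n * b (k - n)) \<le> 1" for k
          by (rule order_trans) (simp add: powr_def)
        then show ?thesis using 1 c0 by (simp add: lq_le_def)
      next
        case (2 r')
        have q: "q = ereal q'" "1 \<le> q'" by fact+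
        have r: "1 / r' = 1 / p' + 1 / q' - 1" using pqr p q 2
          by (auto simp: one_ereal_def zero_ereal_def)
        moreover have "0 \<le> 1 / r'" using 2 by simp
        ultimately have r0: "0 \<le> 1 / p' + 1 / q' - 1" by simp
        let ?S = "\<lambda>k. \<Sum>n\<in>N. a n powr p' * b (k - n) powr q'"
        have "(\<Sum>n\<in>N. a n * b (k - n)) powr r' \<le> ?S k" for k
        proof -
          have "(\<Sum>n\<in>N. a n * b (k - n)) powr r' \<le> (?S k powr (1 / r')) powr r'"
            using 2 c0 r0 unfolding r by (intro powr_mono2 conv) auto
          also have "\<dots> = ?S k" using 2 by (simp add: powr_powr sum_nonneg)
          finally show ?thesis .
        qed
        then have "(\<Sum>k\<in>K. (\<Sum>n\<in>N. a n * b (k - n)) powr r') \<le> (\<Sum>k\<in>K. ?S k)" for K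
          by (intro sum_mono)
        also have "(\<Sum>k\<in>K. ?S k) \<le> 1" if "finite K" for K
        proof -
          have "(\<Sum>k\<in>K. ?S k) = (\<Sum>n\<in>N. a n powr p' * (\<Sum>k\<in>K. b (k - n) powr q'))"
            by (subst sum.swap) (simp add: sum_distrib_left)
          also have "\<dots> \<le> (\<Sum>n\<in>N. a n powr p' * 1)"
          proof (intro sum_mono mult_left_mono)
            fix n
            have "(\<Sum>k\<in>K. b (k - n) powr q') = (\<Sum>m\<in>(\<lambda>k. k - n) ` K. b m powr q')"
              by (subst sum.reindex) (auto simp: inj_on_def)
            also have "\<dots> \<le> 1" using b' that by auto
            finally show "(\<Sum>k\<in>K. b (k - n) powr q') \<le> 1" .
          qed auto
          also have "\<dots> \<le> 1" using a' N by simp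
          finally show ?thesis .
        qed
        finally show ?thesis using 2 c0 by (simp add: lq_le_def)
      qed
    qed
  qed
qed

lemma lq_le_convolution_finite:
  assumes "1 \<le> p" "1 \<le> q" "1 \<le> r" and pqr: "1 / r = 1 / p + 1 / q - 1"
    and a0: "\<And>n. a n \<ge> 0" and b0: "\<And>n. b n \<ge> 0" and "0 \<le> A" and "0 \<le> B"
    and a: "lq_le p a A" and b: "lq_le q b B" and N: "finite N"
  shows "lq_le r (\<lambda>k. \<Sum>n\<in>N. a n * b (k - n)) (A * B)"
proof (cases "A = 0 \<or> B = 0")
  case True
  then have "(\<forall>n. a n = 0) \<or> (\<forall>n. b n = 0)"
    using lq_le_component[OF \<open>1 \<le> p\<close> _ a] lq_le_component[OF \<open>1 \<le> q\<close> _ b] by auto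
  then have "(\<lambda>k. \<Sum>n\<in>N. a n * b (k - n)) = (\<lambda>_. 0)" by auto
  moreover have "A * B = 0" using True by auto
  ultimately show ?thesis by (metis lq_le_zero)
next
  case False
  then have pos: "A > 0" "B > 0" using assms by auto
  have "lq_le p (\<lambda>n. (1 / A) * a n) 1" "lq_le q (\<lambda>n. (1 / B) * b n) 1"
    using lq_le_scale[OF \<open>1 \<le> p\<close> _ a, of "1 / A"] lq_le_scale[OF \<open>1 \<le> q\<close> _ b, of "1 / B"] pos
    by auto
  then have "lq_le r (\<lambda>k. \<Sum>n\<in>N. (1 / A * a n) * (1 / B * b (k - n))) 1"
    using lq_le_convolution_finite_normalized[OF assms(1-4), of "\<lambda>n. 1 / A * a n" "\<lambda>n. 1 / B * b n"]
      a0 b0 pos N by simp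
  from lq_le_scale[OF \<open>1 \<le> r\<close> _ this, of "A * B"] pos show ?thesis
    by (simp add: sum_distrib_left)
qed

text \<open>A Fatou property: each test involves finitely many entries, so it passes to the
  limit.\<close>

lemma lq_le_limit:
  assumes "1 \<le> q" and "0 \<le> B" and "F \<noteq> bot" and "\<And>i. lq_le q (a i) B"
    and "\<And>n. ((\<lambda>i. a i n) \<longlongrightarrow> c n) F"
  shows "lq_le q c B"
  using \<open>1 \<le> q\<close>
proof (cases rule: ereal_ge_1_cases)
  case 1
  have "\<bar>c n\<bar> \<le> B" for n
    using assms 1 by (intro tendsto_upperbound[OF tendsto_rabs[OF assms(5)]]) (auto simp: lq_le_def)
  then show ?thesis by (simp add: lq_le_def 1)
next
  case (2 s)
  have "(\<Sum>n\<in>M. \<bar>c n\<bar> powr s) \<le> B powr s" if "finite M" for M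
  proof (rule tendsto_upperbound)
    show "((\<lambda>i. \<Sum>n\<in>M. \<bar>a i n\<bar> powr s) \<longlongrightarrow> (\<Sum>n\<in>M. \<bar>c n\<bar> powr s)) F"
      using 2 by (intro tendsto_sum tendsto_powr2 tendsto_rabs assms(5) tendsto_const) auto
  qed (use assms 2 that in \<open>auto simp: lq_le_def\<close>)
  then show ?thesis by (simp add: lq_le_def 2)
qed

lemma lq_le_convolution:
  assumes "1 \<le> p" "1 \<le> q" "1 \<le> r" and pqr: "1 / r = 1 / p + 1 / q - 1"
    and a0: "\<And>n. a n \<ge> 0" and b0: "\<And>n. b n \<ge> 0" and "0 \<le> A" and "0 \<le> B"
    and a: "lq_le p a A" and b: "lq_le q b B"
  shows "(\<lambda>n. a n * b (k - n)) summable_on UNIV"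
    and "lq_le r (\<lambda>k. \<Sum>\<^sub>\<infinity>n. a n * b (k - n)) (A * B)"
proof -
  have AB: "0 \<le> A * B" using assms by simp
  have fin: "lq_le r (\<lambda>k. \<Sum>n\<in>N. a n * b (k - n)) (A * B)" if "finite N" for N
    using assms that by (intro lq_le_convolution_finite)
  have sm: "(\<lambda>n. a n * b (k - n)) summable_on UNIV" for k
    using lq_le_component[OF \<open>1 \<le> r\<close> AB fin] a0 b0
    by (intro nonneg_bdd_above_summable_on bdd_aboveI[where M = "A * B"])
      (auto intro: order_trans[OF abs_ge_self])
  then show "(\<lambda>n. a n * b (k - n)) summable_on UNIV" .
  \<comment> \<open>The value on infinite \<open>N\<close> is irrelevant to the limit; the default
    \<open>{}\<close> makes the bound hold for every index, as \<open>lq_le_limit\<close>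
    demands.\<close>
  let ?c = "\<lambda>N k. \<Sum>n\<in>(if finite N then N else {}). a n * b (k - n)"
  show "lq_le r (\<lambda>k. \<Sum>\<^sub>\<infinity>n. a n * b (k - n)) (A * B)"
  proof (rule lq_le_limit[where a = ?c and F = "finite_subsets_at_top UNIV"])
    show "((\<lambda>N. ?c N k) \<longlongrightarrow> (\<Sum>\<^sub>\<infinity>n. a n * b (k - n))) (finite_subsets_at_top UNIV)" for k
    proof (rule Lim_transform_eventually)
      show "(sum (\<lambda>n. a n * b (k - n)) \<longlongrightarrow> (\<Sum>\<^sub>\<infinity>n. a n * b (k - n))) (finite_subsets_at_top UNIV)"
        using has_sum_infsum[OF sm[of k]] by (simp add: has_sum_def)
      show "\<forall>\<^sub>F N in finite_subsets_at_top UNIV. sum (\<lambda>n. a n * b (k - n)) N = ?c N k"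
        by (rule eventually_finite_subsets_at_top_weakI) simp
    qed
  qed (use \<open>1 \<le> r\<close> AB fin in auto)
qed

section \<open>Normed spaces and total boundedness\<close>

lemma normed_spaceD:
  assumes "normed_space X"
  shows normed_space_subspace: "subspace (pts X)"
    and normed_space_nonneg: "x \<in> pts X \<Longrightarrow> 0 \<le> nrm X x"
    and normed_space_eq_0: "x \<in> pts X \<Longrightarrow> nrm X x = 0 \<longleftrightarrow> x = 0"
    and normed_space_scale: "x \<in> pts X \<Longrightarrow> nrm X (c *\<^sub>R x) = \<bar>c\<bar> * nrm X x"
    and normed_space_triangle: "x \<in> pts X \<Longrightarrow> y \<in> pts X \<Longrightarrow> nrm X (x + y) \<le> nrm X x + nrm X y"
  using assms by (auto simp: normed_space_def)

lemma normed_space_mem: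
  assumes "normed_space X"
  shows "0 \<in> pts X"
    and "x \<in> pts X \<Longrightarrow> y \<in> pts X \<Longrightarrow> x + y \<in> pts X"
    and "x \<in> pts X \<Longrightarrow> y \<in> pts X \<Longrightarrow> x - y \<in> pts X"
    and "x \<in> pts X \<Longrightarrow> - x \<in> pts X"
    and "x \<in> pts X \<Longrightarrow> c *\<^sub>R x \<in> pts X"
    and "(\<And>i. i \<in> I \<Longrightarrow> f i \<in> pts X) \<Longrightarrow> sum f I \<in> pts X"
  using normed_space_subspace[OF assms]
  by (auto simp: subspace_0 subspace_add subspace_diff subspace_neg subspace_scale subspace_sum)

lemma normed_space_zero: "normed_space X \<Longrightarrow> nrm X 0 = 0"
  using normed_space_eq_0 normed_space_mem(1) by blast

lemma normed_space_minus:
  assumes "normed_space X" "x \<in> pts X"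
  shows "nrm X (- x) = nrm X x"
  using normed_space_scale[OF assms, of "-1"] by simp

lemma normed_space_minus_commute:
  assumes "normed_space X" "x \<in> pts X" "y \<in> pts X"
  shows "nrm X (x - y) = nrm X (y - x)"
  using normed_space_minus[OF assms(1), of "x - y"] normed_space_mem(3)[OF assms] by simp

lemma normed_space_triangle_minus:
  assumes "normed_space X" "x \<in> pts X" "y \<in> pts X"
  shows "nrm X (x - y) \<le> nrm X x + nrm X y"
  using normed_space_triangle[OF assms(1,2), of "- y"] normed_space_mem(4) normed_space_minus assms
  by fastforce

lemma normed_space_sum:
  assumes X: "normed_space X" and "\<And>i. i \<in> I \<Longrightarrow> f i \<in> pts X"
  shows "nrm X (sum f I) \<le> (\<Sum>i\<in>I. nrm X (f i))"
  using assms(2)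
proof (induction I rule: infinite_finite_induct)
  case (insert i I)
  have "nrm X (f i + sum f I) \<le> nrm X (f i) + nrm X (sum f I)"
    using insert by (intro normed_space_triangle[OF X] normed_space_mem(6)[OF X]) auto
  with insert show ?case by force
qed (use normed_space_zero[OF X] in auto)

lemma Metric_space_ndist:
  assumes X: "normed_space X"
  shows "Metric_space (pts X) (ndist X)"
proof
  show "0 \<le> ndist X x y" for x y
    using normed_space_nonneg[OF X] normed_space_mem(3)[OF X] by (auto simp: ndist_def)
  show "ndist X x y = ndist X y x" for x y
    using normed_space_minus_commute[OF X] by (auto simp: ndist_def)
  show "ndist X x y = 0 \<longleftrightarrow> x = y" if "x \<in> pts X" "y \<in> pts X" for x y
    using that normed_space_eq_0[OF X] normed_space_mem(3)[OF X] by (simp add: ndist_def)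
  show "ndist X x z \<le> ndist X x y + ndist X y z" if "x \<in> pts X" "y \<in> pts X" "z \<in> pts X" for x y z
    using that normed_space_triangle[OF X, of "x - y" "y - z"] normed_space_mem(3)[OF X]
    by (simp add: ndist_def)
qed

lemma limitin_ndist:
  assumes X: "normed_space X" and \<sigma>: "\<And>n. \<sigma> n \<in> pts X"
  shows "limitin (Metric_space.mtopology (pts X) (ndist X)) \<sigma> l sequentially \<longleftrightarrow>
         l \<in> pts X \<and> (\<lambda>n. nrm X (\<sigma> n - l)) \<longlonglongrightarrow> 0"
proof -
  interpret Metric_space "pts X" "ndist X" by (rule Metric_space_ndist[OF X])
  have "ndist X (\<sigma> n) l = nrm X (\<sigma> n - l) \<and> 0 \<le> nrm X (\<sigma> n - l)" if "l \<in> pts X" for n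
    using \<sigma> that normed_space_nonneg[OF X] normed_space_mem(3)[OF X] by (simp add: ndist_def)
  then show ?thesis
    using \<sigma> by (auto simp: limit_metric_sequentially LIMSEQ_iff)
qed

lemma banach_space_normed: "banach_space X \<Longrightarrow> normed_space X"
  by (simp add: banach_space_def)

lemma banach_space_Cauchy:
  assumes X: "banach_space X" and \<sigma>: "\<And>n. \<sigma> n \<in> pts X"
    and C: "\<And>e. e > 0 \<Longrightarrow> \<exists>N. \<forall>m\<ge>N. \<forall>n\<ge>N. nrm X (\<sigma> m - \<sigma> n) < e"
  obtains l where "l \<in> pts X" "(\<lambda>n. nrm X (\<sigma> n - l)) \<longlonglongrightarrow> 0"
proof -
  note nX = banach_space_normed[OF X]
  interpret Metric_space "pts X" "ndist X" by (rule Metric_space_ndist[OF nX])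
  have "MCauchy \<sigma>" using \<sigma> C unfolding MCauchy_def by (auto simp: ndist_def)
  then obtain l where "limitin mtopology \<sigma> l sequentially"
    using X by (auto simp: banach_space_def mcomplete_def)
  then show ?thesis using that limitin_ndist[OF nX \<sigma>] by auto
qed

text \<open>\<open>D\<close> stands for the partial sums of a convergent majorant: it increases
  because norms are nonnegative, is bounded by \<open>B\<close>, hence is Cauchy, and its increments
  dominate those of \<sigma>.\<close>

lemma banach_space_dominated:
  fixes D :: "nat \<Rightarrow> real"
  assumes X: "banach_space X" and \<sigma>: "\<And>n. \<sigma> n \<in> pts X"
    and D: "\<And>m n. m \<le> n \<Longrightarrow> nrm X (\<sigma> n - \<sigma> m) \<le> D n - D m"
    and B: "\<And>n. D n \<le> B"
  obtains l where "l \<in> pts X" "(\<lambda>n. nrm X (\<sigma> n - l)) \<longlonglongrightarrow> 0"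
proof (rule banach_space_Cauchy[OF X \<sigma>])
  note nX = banach_space_normed[OF X]
  have "incseq D"
    using D normed_space_nonneg[OF nX normed_space_mem(3)[OF nX \<sigma> \<sigma>]]
    by (intro monoI) (metis diff_ge_0_iff_ge order_trans)
  then have "Cauchy D" using B by (metis incseq_convergent LIMSEQ_imp_Cauchy)
  fix e :: real assume "e > 0"
  with \<open>Cauchy D\<close> obtain N where N: "\<And>m n. m \<ge> N \<Longrightarrow> n \<ge> N \<Longrightarrow> \<bar>D m - D n\<bar> < e"
    unfolding Cauchy_def dist_real_def by metis
  have "nrm X (\<sigma> m - \<sigma> n) < e" if "m \<ge> N" "n \<ge> N" for m n
  proof -
    have "nrm X (\<sigma> m - \<sigma> n) \<le> \<bar>D m - D n\<bar>"
      using D[of m n] D[of n m] normed_space_minus_commute[OF nX \<sigma> \<sigma>, of m n]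
      by (cases "m \<le> n") auto
    with N that show ?thesis by force
  qed
  then show "\<exists>N. \<forall>m\<ge>N. \<forall>n\<ge>N. nrm X (\<sigma> m - \<sigma> n) < e" by blast
qed (use that in blast)

section \<open>The sum space of a couple\<close>

lemma sum_space_mem:
  assumes "x0 \<in> pts X0" "x1 \<in> pts X1"
  shows "x0 + x1 \<in> pts (sum_space X0 X1)"
  using assms by (auto simp: sum_space_def)

lemma sum_space_nrm_le:
  assumes X: "normed_space X0" "normed_space X1" and "x0 \<in> pts X0" "x1 \<in> pts X1"
  shows "nrm (sum_space X0 X1) (x0 + x1) \<le> nrm X0 x0 + nrm X1 x1"
proof -
  have "bdd_below {nrm X0 y0 + nrm X1 y1 |y0 y1. y0 \<in> pts X0 \<and> y1 \<in> pts X1 \<and> x0 + x1 = y0 + y1}"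
    using normed_space_nonneg[OF X(1)] normed_space_nonneg[OF X(2)]
    by (intro bdd_belowI[where m = 0]) (auto intro: add_nonneg_nonneg)
  then show ?thesis using assms unfolding sum_space_def by (auto intro!: cInf_lower)
qed

lemma sum_space_approx:
  assumes X: "normed_space X0" "normed_space X1" and x: "x \<in> pts (sum_space X0 X1)" and e: "e > 0"
  obtains x0 x1 where "x0 \<in> pts X0" "x1 \<in> pts X1" "x = x0 + x1"
    "nrm X0 x0 + nrm X1 x1 < nrm (sum_space X0 X1) x + e"
proof -
  let ?A = "{nrm X0 y0 + nrm X1 y1 |y0 y1. y0 \<in> pts X0 \<and> y1 \<in> pts X1 \<and> x = y0 + y1}"
  have "?A \<noteq> {}" using x by (auto simp: sum_space_def)
  moreover have "Inf ?A < nrm (sum_space X0 X1) x + e" using e by (simp add: sum_space_def)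
  ultimately obtain a where "a \<in> ?A" "a < nrm (sum_space X0 X1) x + e"
    by (rule cInf_lessD[THEN bexE])
  then show ?thesis using that by blast
qed

lemma sum_space_commute:
  fixes X0 :: "'a::real_vector nspace"
  shows "sum_space X1 X0 = sum_space X0 X1"
proof -
  have "{x1 + x0 |x1 x0. x1 \<in> pts X1 \<and> x0 \<in> pts X0} = {x0 + x1 |x0 x1. x0 \<in> pts X0 \<and> x1 \<in> pts X1}"
    by (auto; metis add.commute)
  moreover have "{nrm X1 x1 + nrm X0 x0 |x1 x0. x1 \<in> pts X1 \<and> x0 \<in> pts X0 \<and> x = x1 + x0}
      = {nrm X0 x0 + nrm X1 x1 |x0 x1. x0 \<in> pts X0 \<and> x1 \<in> pts X1 \<and> x = x0 + x1}" for x
    by (auto; metis add.commute)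
  ultimately show ?thesis by (simp add: sum_space_def)
qed

lemma sum_space_left:
  assumes X: "normed_space X0" "normed_space X1" and "x \<in> pts X0"
  shows "x \<in> pts (sum_space X0 X1)" and "nrm (sum_space X0 X1) x \<le> nrm X0 x"
  using sum_space_mem[of x X0 0 X1] sum_space_nrm_le[OF X, of x 0] assms
    normed_space_mem(1)[OF X(2)] normed_space_zero[OF X(2)] by auto

lemma sum_space_right:
  assumes X: "normed_space X0" "normed_space X1" and "x \<in> pts X1"
  shows "x \<in> pts (sum_space X0 X1)" and "nrm (sum_space X0 X1) x \<le> nrm X1 x"
  using sum_space_left[OF X(2,1) assms(3)] by (simp_all add: sum_space_commute)

lemma sum_space_nonneg:
  assumes X: "normed_space X0" "normed_space X1" and "x \<in> pts (sum_space X0 X1)"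
  shows "0 \<le> nrm (sum_space X0 X1) x"
proof (rule field_le_epsilon)
  fix e :: real assume "e > 0"
  then obtain x0 x1 where "x0 \<in> pts X0" "x1 \<in> pts X1"
    "nrm X0 x0 + nrm X1 x1 < nrm (sum_space X0 X1) x + e"
    using sum_space_approx[OF assms] by metis
  then show "0 \<le> nrm (sum_space X0 X1) x + e"
    using normed_space_nonneg[OF X(1), of x0] normed_space_nonneg[OF X(2), of x1] by linarith
qed

lemma banach_couple_normed:
  assumes "banach_couple X0 X1"
  shows "normed_space X0" "normed_space X1" "banach_space X0" "banach_space X1"
  using assms by (auto simp: banach_couple_def banach_space_def)

lemma embedding_tendsto:
  fixes X :: "('a::hausdorff_tvs, 'm) nspace_scheme"
  assumes X: "normed_space X"
    and c: "continuous_map (Metric_space.mtopology (pts X) (ndist X)) euclidean (\<lambda>x. x)"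
    and \<sigma>: "\<And>n. \<sigma> n \<in> pts X" and l: "(\<lambda>n. nrm X (\<sigma> n)) \<longlonglongrightarrow> 0"
  shows "\<sigma> \<longlonglongrightarrow> 0"
proof -
  have "limitin (Metric_space.mtopology (pts X) (ndist X)) \<sigma> 0 sequentially"
    using limitin_ndist[OF X \<sigma>] l normed_space_mem(1)[OF X] by simp
  from continuous_map_limit[OF c this] show ?thesis by (simp add: o_def)
qed

text \<open>Definiteness is where the common Hausdorff space enters. If the norm of \<open>x\<close>
  is 0, then \<open>x\<close> splits into \<open>y n\<close> and \<open>x - y n\<close> with norms
  tending to 0 in \<open>X0\<close> and \<open>X1\<close>. Both parts tend to 0 in the ambient
  space, so the constant sequence \<open>x\<close> does, and limits there are unique.\<close>

lemma normed_space_sum_space: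
  assumes c: "banach_couple X0 X1"
  shows "normed_space (sum_space X0 X1)"
proof -
  let ?S = "sum_space X0 X1"
  note X = banach_couple_normed(1,2)[OF c]
  have ptsS: "pts ?S = {x + y |x y. x \<in> pts X0 \<and> y \<in> pts X1}" by (simp add: sum_space_def)
  have sub: "subspace (pts ?S)"
    unfolding ptsS by (intro subspace_sums normed_space_subspace X)
  have zero: "nrm ?S 0 = 0"
    using sum_space_left(2)[OF X, of 0] normed_space_zero[OF X(1)] normed_space_mem(1)[OF X(1)]
      sum_space_nonneg[OF X subspace_0[OF sub]] by simp
  have eq0: "x = 0" if x: "x \<in> pts ?S" and n: "nrm ?S x = 0" for x
  proof -
    have "\<exists>y. y \<in> pts X0 \<and> x - y \<in> pts X1 \<and> nrm X0 y + nrm X1 (x - y) < 1 / real (Suc n)" for n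
    proof -
      obtain x0 x1 where "x0 \<in> pts X0" "x1 \<in> pts X1" "x = x0 + x1"
        "nrm X0 x0 + nrm X1 x1 < nrm ?S x + 1 / real (Suc n)"
        using sum_space_approx[OF X x, of "1 / real (Suc n)"] by auto
      then show ?thesis using n by (intro exI[of _ x0]) simp
    qed
    then obtain y where y: "\<And>n. y n \<in> pts X0" "\<And>n. x - y n \<in> pts X1"
      "\<And>n. nrm X0 (y n) + nrm X1 (x - y n) < 1 / real (Suc n)" by metis
    have "(\<lambda>n. nrm X0 (y n)) \<longlonglongrightarrow> 0" "(\<lambda>n. nrm X1 (x - y n)) \<longlonglongrightarrow> 0"
    proof -
      have b: "0 \<le> nrm X0 (y n)" "0 \<le> nrm X1 (x - y n)" for n
        using y normed_space_nonneg[OF X(1)] normed_space_nonneg[OF X(2)] by auto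
      have squeeze: "f \<longlonglongrightarrow> 0" if "\<And>n. 0 \<le> f n" "\<And>n. f n \<le> 1 / real (Suc n)" for f
        using that by (intro tendsto_sandwich[OF _ _ tendsto_const LIMSEQ_Suc[OF lim_1_over_n]]
            always_eventually) auto
      show "(\<lambda>n. nrm X0 (y n)) \<longlonglongrightarrow> 0" "(\<lambda>n. nrm X1 (x - y n)) \<longlonglongrightarrow> 0"
        using b y(3) less_imp_le[OF y(3)] by (intro squeeze; smt (verit))+
    qed
    then have "y \<longlonglongrightarrow> 0" "(\<lambda>n. x - y n) \<longlonglongrightarrow> 0"
      using c y X by (auto simp: banach_couple_def intro: embedding_tendsto)
    from tendsto_add[OF this] have "(\<lambda>n. x) \<longlonglongrightarrow> 0" by simp
    then show "x = 0" by (metis LIMSEQ_unique tendsto_const)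
  qed
  have scale_le: "nrm ?S (a *\<^sub>R x) \<le> \<bar>a\<bar> * nrm ?S x" if x: "x \<in> pts ?S" for a x
  proof (cases "a = 0")
    case True
    then show ?thesis by (simp add: zero)
  next
    case False
    show ?thesis
    proof (rule field_le_epsilon)
      fix e :: real assume "e > 0"
      then obtain x0 x1 where *: "x0 \<in> pts X0" "x1 \<in> pts X1" "x = x0 + x1"
        "nrm X0 x0 + nrm X1 x1 < nrm ?S x + e / \<bar>a\<bar>"
        using sum_space_approx[OF X x, of "e / \<bar>a\<bar>"] False by auto
      then have "nrm ?S (a *\<^sub>R x) \<le> nrm X0 (a *\<^sub>R x0) + nrm X1 (a *\<^sub>R x1)"
        using sum_space_nrm_le[OF X, of "a *\<^sub>R x0" "a *\<^sub>R x1"] normed_space_mem(5)[OF X(1)]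
          normed_space_mem(5)[OF X(2)] by (simp add: scaleR_add_right)
      also have "\<dots> = \<bar>a\<bar> * (nrm X0 x0 + nrm X1 x1)"
        using * normed_space_scale[OF X(1)] normed_space_scale[OF X(2)] by (simp add: distrib_left)
      also have "\<dots> \<le> \<bar>a\<bar> * (nrm ?S x + e / \<bar>a\<bar>)" using * by (intro mult_left_mono) auto
      also have "\<dots> = \<bar>a\<bar> * nrm ?S x + e" using False by (simp add: distrib_left)
      finally show "nrm ?S (a *\<^sub>R x) \<le> \<bar>a\<bar> * nrm ?S x + e" .
    qed
  qed
  have scale: "nrm ?S (a *\<^sub>R x) = \<bar>a\<bar> * nrm ?S x" if x: "x \<in> pts ?S" for a x
  proof (cases "a = 0")
    case True
    then show ?thesis by (simp add: zero)
  next
    case False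
    have "nrm ?S x \<le> \<bar>inverse a\<bar> * nrm ?S (a *\<^sub>R x)"
      using scale_le[of "a *\<^sub>R x" "inverse a"] False x sub by (simp add: subspace_scale)
    then have "\<bar>a\<bar> * nrm ?S x \<le> \<bar>a\<bar> * (\<bar>inverse a\<bar> * nrm ?S (a *\<^sub>R x))"
      by (rule mult_left_mono) simp
    also have "\<dots> = nrm ?S (a *\<^sub>R x)" using False by (simp add: abs_inverse)
    finally show ?thesis using scale_le[OF x, of a] by linarith
  qed
  have tri: "nrm ?S (x + y) \<le> nrm ?S x + nrm ?S y" if x: "x \<in> pts ?S" and y: "y \<in> pts ?S" for x y
  proof (rule field_le_epsilon)
    fix e :: real assume "e > 0"
    then have e: "e / 2 > 0" by simp
    obtain x0 x1 where x': "x0 \<in> pts X0" "x1 \<in> pts X1" "x = x0 + x1"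
        "nrm X0 x0 + nrm X1 x1 < nrm ?S x + e / 2"
      using sum_space_approx[OF X x e] by metis
    obtain y0 y1 where y': "y0 \<in> pts X0" "y1 \<in> pts X1" "y = y0 + y1"
        "nrm X0 y0 + nrm X1 y1 < nrm ?S y + e / 2"
      using sum_space_approx[OF X y e] by metis
    have "nrm ?S ((x0 + y0) + (x1 + y1)) \<le> nrm X0 (x0 + y0) + nrm X1 (x1 + y1)"
      using x' y' by (intro sum_space_nrm_le X normed_space_mem(2))
    also have "\<dots> \<le> (nrm X0 x0 + nrm X0 y0) + (nrm X1 x1 + nrm X1 y1)"
      using x' y' by (intro add_mono normed_space_triangle X)
    finally show "nrm ?S (x + y) \<le> nrm ?S x + nrm ?S y + e"
      using x' y' by (simp add: algebra_simps)
  qed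
  show ?thesis
    unfolding normed_space_def using sub sum_space_nonneg[OF X] zero eq0 scale tri by blast
qed

text \<open>Each point is colored by the center of a ball of radius \<open>\<epsilon> / 2\<close>
  that contains it. Finite colorings are preferred to nets because they pull back along maps and
  combine by pairing, which is how total boundedness in \<open>G0\<close> and in \<open>G1\<close>
  is carried to the interpolation space.\<close>

lemma (in Metric_space) mtotally_bounded_imp_coloring:
  assumes "mtotally_bounded S" "\<epsilon> > 0"
  obtains f :: "'a \<Rightarrow> 'a" where "finite (f ` S)" "\<And>x y. x \<in> S \<Longrightarrow> y \<in> S \<Longrightarrow> f x = f y \<Longrightarrow> d x y < \<epsilon>"
proof -
  from assms(1)[unfolded mtotally_bounded_def, rule_format, OF half_gt_zero[OF assms(2)]]
  obtain K where K: "finite K" "S \<subseteq> (\<Union>x\<in>K. mball x (\<epsilon> / 2))" by blast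
  define f where "f = (\<lambda>x. SOME k. k \<in> K \<and> x \<in> mball k (\<epsilon> / 2))"
  have f: "f x \<in> K \<and> x \<in> mball (f x) (\<epsilon> / 2)" if "x \<in> S" for x
  proof -
    have "\<exists>k. k \<in> K \<and> x \<in> mball k (\<epsilon> / 2)" using K(2) that by blast
    then show ?thesis unfolding f_def by (rule someI_ex)
  qed
  show ?thesis
  proof
    show "finite (f ` S)" using f K by (meson finite_subset image_subsetI)
    fix x y assume xy: "x \<in> S" "y \<in> S" "f x = f y"
    with f[of x] f[of y] have "x \<in> M" "y \<in> M" "f x \<in> M" "d (f x) x < \<epsilon> / 2" "d (f x) y < \<epsilon> / 2" by auto
    then show "d x y < \<epsilon>" using triangle[of x "f x" y] commute[of x "f x"] by simp
  qed
qed

text \<open>One representative of each color forms the net. The type of colors is left free so that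
  pairs are admissible colors.\<close>

lemma (in Metric_space) coloring_imp_mtotally_bounded:
  assumes "S \<subseteq> M"
    and "\<And>\<epsilon>. \<epsilon> > 0 \<Longrightarrow> \<exists>f :: 'a \<Rightarrow> 'b. finite (f ` S) \<and> (\<forall>x\<in>S. \<forall>y\<in>S. f x = f y \<longrightarrow> d x y < \<epsilon>)"
  shows "mtotally_bounded S"
  unfolding mtotally_bounded_def
proof (intro allI impI)
  fix \<epsilon> :: real assume "\<epsilon> > 0"
  then obtain f :: "'a \<Rightarrow> 'b" where f: "finite (f ` S)" "\<And>x y. x \<in> S \<Longrightarrow> y \<in> S \<Longrightarrow> f x = f y \<Longrightarrow> d x y < \<epsilon>"
    using assms(2) by metis
  let ?K = "inv_into S f ` f ` S"
  have "S \<subseteq> (\<Union>x\<in>?K. mball x \<epsilon>)"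
  proof
    fix x assume x: "x \<in> S"
    then have "inv_into S f (f x) \<in> S" "f (inv_into S f (f x)) = f x"
      by (auto intro: inv_into_into f_inv_into_f)
    then show "x \<in> (\<Union>x\<in>?K. mball x \<epsilon>)" using x f(2) assms(1) by (auto simp: subset_iff)
  qed
  moreover have "?K \<subseteq> S" by (auto intro: inv_into_into)
  ultimately show "\<exists>K. finite K \<and> K \<subseteq> S \<and> S \<subseteq> (\<Union>x\<in>K. mball x \<epsilon>)" using f(1) by blast
qed

text \<open>Otherwise some sequence in \<open>A\<close> tends to 0 in the weaker norm of
  \<open>S\<close> while its norms in \<open>Z\<close> stay at least \<delta>. Total boundedness and
  completeness give a subsequence converging in \<open>Z\<close>; its limit has norm 0 in
  \<open>S\<close>, hence is 0, so the norms in \<open>Z\<close> would tend to 0.\<close>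

lemma totally_bounded_small:
  assumes Z: "banach_space Z" and S: "normed_space S" and sub: "pts Z \<subseteq> pts S"
    and le: "\<And>z. z \<in> pts Z \<Longrightarrow> nrm S z \<le> nrm Z z"
    and A: "Metric_space.mtotally_bounded (pts Z) (ndist Z) A" and "\<delta> > 0"
  obtains \<eta> where "\<eta> > 0" "\<And>z. z \<in> A \<Longrightarrow> nrm S z < \<eta> \<Longrightarrow> nrm Z z < \<delta>"
proof (rule ccontr)
  assume contra: "\<not> thesis"
  note nZ = banach_space_normed[OF Z]
  interpret Metric_space "pts Z" "ndist Z" by (rule Metric_space_ndist[OF nZ])
  have AZ: "A \<subseteq> pts Z" using A mtotally_bounded_imp_subset by blast
  have "\<exists>z\<in>A. nrm S z < 1 / real (Suc n) \<and> \<not> nrm Z z < \<delta>" for n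
    using contra that[of "1 / real (Suc n)"] by fastforce
  then obtain \<sigma> where \<sigma>: "\<And>n. \<sigma> n \<in> A" "\<And>n. nrm S (\<sigma> n) < 1 / real (Suc n)" "\<And>n. \<not> nrm Z (\<sigma> n) < \<delta>"
    by metis
  have "\<forall>\<sigma>::nat \<Rightarrow> 'a. range \<sigma> \<subseteq> A \<longrightarrow> (\<exists>r. strict_mono r \<and> MCauchy (\<sigma> \<circ> r))"
    using A by (simp add: mtotally_bounded_sequentially)
  moreover have "range \<sigma> \<subseteq> A" using \<sigma>(1) by auto
  ultimately obtain r where r: "strict_mono r" "MCauchy (\<sigma> \<circ> r)" by blast
  then obtain l where "limitin mtopology (\<sigma> \<circ> r) l sequentially"
    using Z by (auto simp: banach_space_def mcomplete_def)
  then have l: "l \<in> pts Z" "(\<lambda>n. nrm Z (\<sigma> (r n) - l)) \<longlonglongrightarrow> 0"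
    using limitin_ndist[OF nZ, of "\<sigma> \<circ> r" l] \<sigma>(1) AZ by auto
  have \<sigma>Z: "\<sigma> n \<in> pts Z" for n using \<sigma> AZ by auto
  have lim: "(\<lambda>n. nrm Z (\<sigma> (r n) - l) + 1 / real (Suc (r n))) \<longlonglongrightarrow> 0 + 0"
    using LIMSEQ_subseq_LIMSEQ[OF LIMSEQ_Suc[OF lim_1_over_n] r(1)]
    by (intro tendsto_add l(2)) (simp add: o_def)
  have "nrm S l \<le> nrm Z (\<sigma> (r n) - l) + 1 / real (Suc (r n))" for n
  proof -
    have "nrm S l = nrm S (\<sigma> (r n) - (\<sigma> (r n) - l))" by simp
    also have "\<dots> \<le> nrm S (\<sigma> (r n)) + nrm S (\<sigma> (r n) - l)"
      using \<sigma>Z l sub normed_space_mem(3)[OF nZ] by (intro normed_space_triangle_minus[OF S]) auto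
    also have "nrm S (\<sigma> (r n) - l) \<le> nrm Z (\<sigma> (r n) - l)"
      using \<sigma>Z l normed_space_mem(3)[OF nZ] by (intro le) auto
    finally show ?thesis using \<sigma>(2)[of "r n"] by linarith
  qed
  then have "nrm S l \<le> 0"
    using tendsto_lowerbound[OF lim, of "nrm S l"] by simp
  then have "l = 0"
    using normed_space_eq_0[OF S, of l] normed_space_nonneg[OF S, of l] l sub by auto
  with l have "(\<lambda>n. nrm Z (\<sigma> (r n))) \<longlonglongrightarrow> 0" by simp
  then have "eventually (\<lambda>n. nrm Z (\<sigma> (r n)) < \<delta>) sequentially"
    using \<open>\<delta> > 0\<close> by (rule order_tendstoD(2))
  then show False using \<sigma>(3) by (auto simp: eventually_sequentially)
qed

section \<open>Summability of the dilation function\<close>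

lemma param_B_pos: "\<rho> \<in> param_B \<Longrightarrow> t > 0 \<Longrightarrow> \<rho> t > 0"
  by (simp add: param_B_def function_parameter_def)

lemma param_B_dil:
  assumes "\<rho> \<in> param_B" "s > 0" "t > 0"
  shows "\<rho> (s * t) \<le> dil \<rho> s * \<rho> t"
proof -
  have "\<rho> (s * t) / \<rho> t \<le> dil \<rho> s"
    unfolding dil_def using assms by (intro cSUP_upper) (auto simp: param_B_def)
  then show ?thesis using param_B_pos[OF assms(1,3)] by (simp add: divide_le_eq)
qed

lemma param_B_le_dil:
  assumes "\<rho> \<in> param_B" "s > 0"
  shows "\<rho> s \<le> dil \<rho> s"
  using param_B_dil[OF assms, of 1] assms by (simp add: param_B_def)

lemma dil_pos:
  assumes "\<rho> \<in> param_B" "s > 0"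
  shows "dil \<rho> s > 0"
  using param_B_le_dil[OF assms] param_B_pos[OF assms] by linarith

lemma dil_mult:
  assumes \<rho>: "\<rho> \<in> param_B" and "s > 0" "t > 0"
  shows "dil \<rho> (s * t) \<le> dil \<rho> s * dil \<rho> t"
proof -
  have "\<rho> (s * t * u) / \<rho> u \<le> dil \<rho> s * dil \<rho> t" if "u > 0" for u
  proof -
    have "\<rho> (s * t * u) \<le> dil \<rho> s * \<rho> (t * u)"
      using param_B_dil[OF \<rho>, of s "t * u"] assms that by (simp add: mult.assoc)
    also have "\<dots> \<le> dil \<rho> s * (dil \<rho> t * \<rho> u)"
      using assms that dil_pos[OF \<rho>, of s] by (intro mult_left_mono param_B_dil) auto
    finally show ?thesis using param_B_pos[OF \<rho> that] by (simp add: divide_le_eq mult.assoc)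
  qed
  then show ?thesis unfolding dil_def[of \<rho> "s * t"] by (intro cSUP_least) auto
qed

text \<open>
  Tonelli over the dyadic intervals: for almost every \<open>\<tau>\<close> in \<open>(1, 2]\<close> the integral condition gives a
  convergent series over the points \<open>2\<^sup>n \<tau>\<close>, and submultiplicativity moves these points to \<open>2\<^sup>n\<close>.
\<close>

lemma dil_summable:
  assumes \<rho>: "\<rho> \<in> param_Bpm"
  shows "(\<lambda>n::int. min 1 (2 powi (- n)) * dil \<rho> (2 powi n)) summable_on UNIV"
proof -
  have \<rho>B: "\<rho> \<in> param_B" using \<rho> by (simp add: param_Bpm_def)
  define H where "H = (\<lambda>t. indicator {0<..} t * (min 1 (1 / t) * dil \<rho> t / t))"
  have int: "integrable lborel H"
    using \<rho> by (simp add: param_Bpm_def set_integrable_def H_def)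
  have H0: "H t \<ge> 0" for t
    using dil_pos[OF \<rho>B, of t] by (auto simp: H_def indicator_def intro!: divide_nonneg_pos mult_nonneg_nonneg)
  have meas [measurable]: "H \<in> borel_measurable borel"
    using borel_measurable_integrable[OF int] by simp
  \<comment> \<open>The integers are enumerated by \<open>int_decode\<close>, so that series and
    disjoint families indexed by \<open>nat\<close> apply. The intervals \<open>A i\<close> are the
    dyadic ones.\<close>
  define c where "c = (\<lambda>i. (2::real) powi (int_decode i))"
  have c: "c i > 0" for i by (simp add: c_def)
  define A where "A = (\<lambda>i. {c i <.. 2 * c i})"
  have disj: "disjoint_family A"
  proof -
    have "A i \<inter> A j = {}" if "int_decode i < int_decode j" for i j
    proof -
      have "2 * c i = 2 powi (int_decode i + 1)" by (simp add: c_def power_int_add)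
      also have "\<dots> \<le> c j" unfolding c_def using that by (intro power_int_increasing) auto
      finally show ?thesis by (auto simp: A_def)
    qed
    moreover have "int_decode i < int_decode j \<or> int_decode j < int_decode i" if "i \<noteq> j" for i j
      using that inj_int_decode[of UNIV] by (metis injD linorder_neqE)
    ultimately show ?thesis unfolding disjoint_family_on_def by (metis inf_commute)
  qed
  have scaled: "(\<integral>\<^sup>+\<tau>. ennreal (c i * H (c i * \<tau>)) * indicator {1<..2} \<tau> \<partial>lborel)
      = (\<integral>\<^sup>+t. ennreal (H t) * indicator (A i) t \<partial>lborel)" for i
  proof -
    have ind: "indicator (A i) (c i * \<tau>) = (indicator {1<..2} \<tau> :: ennreal)" for \<tau>
      using c[of i] by (auto simp: A_def indicator_def)
    have "(\<integral>\<^sup>+t. ennreal (H t) * indicator (A i) t \<partial>lborel)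
      = ennreal \<bar>c i\<bar> * (\<integral>\<^sup>+\<tau>. ennreal (H (0 + c i * \<tau>)) * indicator (A i) (0 + c i * \<tau>) \<partial>lborel)"
      using c[of i] by (intro nn_integral_real_affine) (auto simp: A_def)
    also have "\<dots> = (\<integral>\<^sup>+\<tau>. ennreal \<bar>c i\<bar> * (ennreal (H (0 + c i * \<tau>)) * indicator (A i) (0 + c i * \<tau>)) \<partial>lborel)"
      by (rule nn_integral_cmult[symmetric]) (auto simp: A_def)
    also have "\<dots> = (\<integral>\<^sup>+\<tau>. ennreal (c i * H (c i * \<tau>)) * indicator {1<..2} \<tau> \<partial>lborel)"
      using c[of i] H0 by (intro nn_integral_cong) (simp add: ind ennreal_mult mult.assoc)
    finally show ?thesis ..
  qed
  define \<Phi> where "\<Phi> = (\<lambda>\<tau>. \<Sum>i. ennreal (c i * H (c i * \<tau>)) * indicator {1<..2} \<tau>)"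
  have "(\<integral>\<^sup>+\<tau>. \<Phi> \<tau> \<partial>lborel) = (\<Sum>i. \<integral>\<^sup>+\<tau>. ennreal (c i * H (c i * \<tau>)) * indicator {1<..2} \<tau> \<partial>lborel)"
    unfolding \<Phi>_def by (intro nn_integral_suminf) auto
  also have "\<dots> = (\<Sum>i. \<integral>\<^sup>+t. ennreal (H t) * indicator (A i) t \<partial>lborel)" by (simp add: scaled)
  also have "\<dots> = (\<integral>\<^sup>+t. ennreal (H t) * indicator (\<Union>i. A i) t \<partial>lborel)"
    by (intro nn_integral_disjoint_family[symmetric]) (use disj in \<open>auto simp: A_def\<close>)
  also have "\<dots> \<le> (\<integral>\<^sup>+t. ennreal (H t) \<partial>lborel)"
    by (intro nn_integral_mono) (auto simp: indicator_def)
  also have "\<dots> < \<infinity>"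
    using int H0 by (simp add: integrable_iff_bounded)
  finally have fin: "(\<integral>\<^sup>+\<tau>. \<Phi> \<tau> \<partial>lborel) \<noteq> \<infinity>" by simp
  have "AE \<tau> in lborel. \<Phi> \<tau> \<noteq> \<infinity>"
    by (intro nn_integral_PInf_AE fin) (auto simp: \<Phi>_def)
  \<comment> \<open>The exceptional null set cannot contain \<open>{1<..2}\<close>, whose measure is
    1.\<close>
  then have "\<exists>\<tau>\<in>{1<..2}. \<Phi> \<tau> \<noteq> \<infinity>"
  proof (rule contrapos_pp)
    assume "\<not> (\<exists>\<tau>\<in>{1<..2}. \<Phi> \<tau> \<noteq> \<infinity>)"
    then have all: "\<tau> \<notin> {1<..2}" if "\<Phi> \<tau> \<noteq> \<infinity>" for \<tau> using that by blast
    show "\<not> (AE \<tau> in lborel. \<Phi> \<tau> \<noteq> \<infinity>)"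
    proof
      assume "AE \<tau> in lborel. \<Phi> \<tau> \<noteq> \<infinity>"
      then have "AE \<tau> in lborel. \<tau> \<notin> {1<..2::real}" by eventually_elim (rule all)
      then have "emeasure lborel {1<..2::real} = 0"
        by (subst (asm) AE_iff_measurable[of "{1<..2}"]) auto
      then show False by simp
    qed
  qed
  then obtain \<tau> where \<tau>: "1 < \<tau>" "\<tau> \<le> 2" "\<Phi> \<tau> \<noteq> \<infinity>" by auto
  have "(\<Sum>i. ennreal (c i * H (c i * \<tau>))) \<noteq> top"
    using \<tau> by (simp add: \<Phi>_def)
  then have sm: "summable (\<lambda>i. c i * H (c i * \<tau>))"
    using c H0 by (intro summable_suminf_not_top) (auto intro: mult_nonneg_nonneg less_imp_le)
  have Heq: "c i * H (c i * \<tau>) = min 1 (1 / (c i * \<tau>)) * dil \<rho> (c i * \<tau>) / \<tau>" for i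
    using c[of i] \<tau> by (simp add: H_def)
  have "summable (\<lambda>i. min 1 (1 / c i) * dil \<rho> (c i))"
  proof (rule summable_comparison_test)
    \<comment> \<open>One factor \<tau> comes from comparing the two minima, the other cancels the
      division by \<tau> left over in \<open>Heq\<close>, and \<open>dil \<rho> (1 / \<tau>)\<close>
      is the price of moving from \<open>c i * \<tau>\<close> back to \<open>c i\<close>.\<close>
    show "summable (\<lambda>i. (\<tau> * \<tau> * dil \<rho> (1 / \<tau>)) * (c i * H (c i * \<tau>)))"
      by (intro summable_mult sm)
    have "norm (min 1 (1 / c i) * dil \<rho> (c i)) \<le> (\<tau> * \<tau> * dil \<rho> (1 / \<tau>)) * (c i * H (c i * \<tau>))" for i
    proof -
      have "dil \<rho> (c i) \<le> dil \<rho> (c i * \<tau>) * dil \<rho> (1 / \<tau>)"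
        using dil_mult[OF \<rho>B, of "c i * \<tau>" "1 / \<tau>"] c[of i] \<tau> by simp
      moreover have "min 1 (1 / c i) \<le> \<tau> * min 1 (1 / (c i * \<tau>))"
      proof -
        have "1 / c i = \<tau> * (1 / (c i * \<tau>))" using \<tau> by simp
        then show ?thesis using \<tau> by (auto simp: min_def)
      qed
      ultimately have "min 1 (1 / c i) * dil \<rho> (c i)
          \<le> (\<tau> * min 1 (1 / (c i * \<tau>))) * (dil \<rho> (c i * \<tau>) * dil \<rho> (1 / \<tau>))"
        using c[of i] \<tau> dil_pos[OF \<rho>B c, of i] by (intro mult_mono) auto
      moreover have "0 \<le> min 1 (1 / c i) * dil \<rho> (c i)"
        using c[of i] dil_pos[OF \<rho>B c, of i] by (intro mult_nonneg_nonneg) auto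
      moreover have "(\<tau> * m) * (a * b) = (\<tau> * \<tau> * b) * (m * a / \<tau>)" for m a b
        using \<tau> by simp
      ultimately show ?thesis by (simp only: Heq real_norm_def abs_of_nonneg)
    qed
    then show "\<exists>N. \<forall>n\<ge>N. norm (min 1 (1 / c n) * dil \<rho> (c n)) \<le> (\<tau> * \<tau> * dil \<rho> (1 / \<tau>)) * (c n * H (c n * \<tau>))"
      by blast
  qed
  then have "(\<lambda>i. min 1 (2 powi (- int_decode i)) * dil \<rho> (2 powi int_decode i)) summable_on (UNIV :: nat set)"
    using c dil_pos[OF \<rho>B c]
    by (subst summable_on_UNIV_nonneg_real_iff)
      (auto simp: c_def power_int_minus divide_inverse intro!: mult_nonneg_nonneg less_imp_le)
  then show ?thesis
    using summable_on_reindex_bij_betw[OF bij_int_decode,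
        of "\<lambda>n. min 1 (2 powi (- n)) * dil \<rho> (2 powi n)"] by simp
qed

lemma summable_on_finite_large:
  fixes h :: "'a \<Rightarrow> real"
  assumes h: "h summable_on UNIV" and h0: "\<And>n. h n \<ge> 0" and "e > 0"
  shows "finite {n. h n \<ge> e}"
proof (rule ccontr)
  assume inf: "infinite {n. h n \<ge> e}"
  obtain N :: nat where N: "infsum h UNIV < real N * e"
    using reals_Archimedean3[OF \<open>e > 0\<close>] by blast
  obtain K where K: "finite K" "card K = N" "K \<subseteq> {n. h n \<ge> e}"
    using infinite_arbitrarily_large[OF inf] by blast
  have "real N * e \<le> sum h K"
    using K sum_bounded_below[of K e h] by auto
  also have "\<dots> \<le> infsum h UNIV"
    using h h0 K by (intro finite_sum_le_infsum) auto
  finally show False using N by simp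
qed

text \<open>Only finitely many terms of the convergent series are at least \<open>e\<close>, so a
  positive \<open>s\<close> beyond all their indices leaves both the terms at \<open>s\<close> and
  at \<open>- s\<close> below \<open>e\<close>. The minimum is \<open>2 powi (- s)\<close> in the
  former and 1 in the latter, which gives the two claims.\<close>

lemma dil_shift_small:
  assumes \<rho>: "\<rho> \<in> param_Bpm" and e: "e > 0"
  obtains s :: int where "2 powi (- s) * dil \<rho> (2 powi s) < e" "dil \<rho> (2 powi (- s)) < e"
proof -
  have \<rho>B: "\<rho> \<in> param_B" using \<rho> by (simp add: param_Bpm_def)
  let ?h = "\<lambda>n::int. min 1 (2 powi (- n)) * dil \<rho> (2 powi n)"
  have dp: "dil \<rho> (2 powi n) > 0" for n :: int by (intro dil_pos[OF \<rho>B]) simp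
  have "finite {n. ?h n \<ge> e}"
    using dp by (intro summable_on_finite_large dil_summable \<rho> e mult_nonneg_nonneg) (auto simp: less_imp_le)
  then obtain B where B: "\<And>n. ?h n \<ge> e \<Longrightarrow> \<bar>n\<bar> \<le> B"
    using Max_ge[of "abs ` {n. ?h n \<ge> e}"] by blast
  let ?s = "\<bar>B\<bar> + 1"
  have "?h ?s < e" "?h (- ?s) < e" using B[of ?s] B[of "- ?s"] by (force simp: not_le)+
  moreover have "2 powi (- ?s) \<le> (1::real)" "(1::real) \<le> 2 powi ?s"
    using power_int_increasing[of "- ?s" 0 "2::real"] power_int_increasing[of 0 ?s "2::real"] by auto
  ultimately show ?thesis by (intro that[of ?s]) (simp_all add: min_def)
qed

section \<open>The J-method\<close>

text \<open>Absolute convergence along an exhaustion \<open>I\<close>, together with the bound on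
  the sum. The sets \<open>I\<close> are kept general because half-lines of integers and
  antidiagonals of index pairs are both summed this way.\<close>

lemma banach_space_series:
  fixes z :: "int \<Rightarrow> 'a::real_vector" and I :: "nat \<Rightarrow> int set"
  assumes Z: "banach_space Z" and z: "\<And>n. z n \<in> pts Z"
    and I: "\<And>L. finite (I L)" "\<And>L L'. L \<le> L' \<Longrightarrow> I L \<subseteq> I L'"
    and c: "\<And>n L. n \<in> I L \<Longrightarrow> nrm Z (z n) \<le> c n" and C: "\<And>L. sum c (I L) \<le> C"
  obtains l where "l \<in> pts Z" "(\<lambda>L. nrm Z (sum z (I L) - l)) \<longlonglongrightarrow> 0" "nrm Z l \<le> C"
proof -
  note nZ = banach_space_normed[OF Z]
  have mem: "sum z F \<in> pts Z" for F using z by (intro normed_space_mem(6)[OF nZ])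
  have dom: "nrm Z (sum z (I L') - sum z (I L)) \<le> sum c (I L') - sum c (I L)" if "L \<le> L'" for L L'
  proof -
    have "nrm Z (sum z (I L') - sum z (I L)) = nrm Z (sum z (I L' - I L))"
      using sum_diff[OF I(1) I(2)[OF that], of z] by simp
    also have "\<dots> \<le> (\<Sum>n\<in>I L' - I L. nrm Z (z n))" by (intro normed_space_sum[OF nZ] z)
    also have "\<dots> \<le> sum c (I L' - I L)" by (intro sum_mono c[of _ L']) auto
    also have "\<dots> = sum c (I L') - sum c (I L)" by (rule sum_diff[OF I(1) I(2)[OF that]])
    finally show ?thesis .
  qed
  obtain l where l: "l \<in> pts Z" "(\<lambda>L. nrm Z (sum z (I L) - l)) \<longlonglongrightarrow> 0"
    using banach_space_dominated[of Z "\<lambda>L. sum z (I L)" "\<lambda>L. sum c (I L)" C, OF Z mem dom C] by blast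
  have "nrm Z l \<le> C + nrm Z (sum z (I L) - l)" for L
  proof -
    have "nrm Z l = nrm Z (sum z (I L) - (sum z (I L) - l))" by simp
    also have "\<dots> \<le> nrm Z (sum z (I L)) + nrm Z (sum z (I L) - l)"
      using mem l normed_space_mem(3)[OF nZ] by (intro normed_space_triangle_minus[OF nZ]) auto
    also have "nrm Z (sum z (I L)) \<le> (\<Sum>n\<in>I L. nrm Z (z n))" by (intro normed_space_sum[OF nZ] z)
    also have "\<dots> \<le> sum c (I L)" by (intro sum_mono c)
    also have "\<dots> \<le> C" by (rule C)
    finally show ?thesis by simp
  qed
  then have "nrm Z l \<le> C + 0"
    by (intro tendsto_lowerbound[OF tendsto_add[OF tendsto_const l(2)]]) auto
  then show ?thesis using that l by simp
qed

text \<open>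
  The weights \<open>f (2\<^sup>n)\<close> being summable against \<open>min 1 2\<^sup>-\<^sup>n\<close> makes the J-representations converge absolutely
  in the sum space.
\<close>

locale J_method =
  fixes X0 X1 :: "'a::hausdorff_tvs nspace" and f :: "real \<Rightarrow> real" and q :: ereal
  assumes couple: "banach_couple X0 X1" and q: "1 \<le> q"
    and f_pos: "\<And>t. t > 0 \<Longrightarrow> f t > 0"
    and weights: "(\<lambda>n::int. min 1 (2 powi (- n)) * f (2 powi n)) summable_on UNIV"
begin

abbreviation S where "S \<equiv> sum_space X0 X1"
abbreviation J where "J n \<equiv> J_fun X0 X1 (2 powi (n::int))"
abbreviation h where "h n \<equiv> min 1 (2 powi (- n)) * f (2 powi (n::int))"
abbreviation normalized where "normalized u \<equiv> \<lambda>n. J n (u n) / f (2 powi n)"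

text \<open>Asking for an actual representation with bound \<open>B\<close>, rather than for a bound
  on the infimum, gives later arguments a sequence to cut and shift. It implies that the J-norm is
  at most \<open>B\<close>; the converse is available only when the J-norm is strictly below
  \<open>B\<close>.\<close>

definition J_le :: "'a \<Rightarrow> real \<Rightarrow> bool" where
  "J_le x B \<longleftrightarrow> (\<exists>u\<in>J_reps X0 X1 x. lq_le q (normalized u) B)"

lemmas X0 = banach_couple_normed(1)[OF couple] and X1 = banach_couple_normed(2)[OF couple]
lemmas S = normed_space_sum_space[OF couple]
lemmas S_left = sum_space_left[OF X0 X1] and S_right = sum_space_right[OF X0 X1]

lemma f_pos' [simp]: "f (2 powi n) > 0" by (rule f_pos) simp

lemma h_nonneg: "h n \<ge> 0"
  by (intro mult_nonneg_nonneg) (auto simp: less_imp_le)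

lemma J_nonneg: "x \<in> pts X0 \<Longrightarrow> 0 \<le> J n x"
  using normed_space_nonneg[OF X0] by (simp add: J_fun_def max.coboundedI1)

lemma J_zero: "J n 0 = 0"
  using normed_space_zero[OF X0] normed_space_zero[OF X1] by (simp add: J_fun_def)

lemma J_add:
  assumes "x \<in> pts X0 \<inter> pts X1" "y \<in> pts X0 \<inter> pts X1"
  shows "J n (x + y) \<le> J n x + J n y"
proof -
  have "nrm X0 (x + y) \<le> nrm X0 x + nrm X0 y" "nrm X1 (x + y) \<le> nrm X1 x + nrm X1 y"
    using assms normed_space_triangle[OF X0] normed_space_triangle[OF X1] by auto
  moreover from this(2) have "2 powi n * nrm X1 (x + y) \<le> 2 powi n * nrm X1 x + 2 powi n * nrm X1 y"
    by (simp flip: distrib_left)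
  ultimately show ?thesis unfolding J_fun_def by linarith
qed

lemma J_scale:
  assumes "x \<in> pts X0 \<inter> pts X1"
  shows "J n (c *\<^sub>R x) = \<bar>c\<bar> * J n x"
  using assms normed_space_scale[OF X0] normed_space_scale[OF X1]
  by (simp add: J_fun_def max_mult_distrib_left mult.left_commute)

lemma nrm0_le_J: "nrm X0 x \<le> J n x"
  by (simp add: J_fun_def)

lemma nrm1_le_J: "nrm X1 x \<le> 2 powi (- n) * J n x"
proof -
  have "2 powi (- n) * (2 powi n * nrm X1 x) \<le> 2 powi (- n) * J n x"
    by (intro mult_left_mono) (auto simp: J_fun_def)
  moreover have "2 powi (- n) * (2 powi n * nrm X1 x) = nrm X1 x" by (simp add: power_int_minus)
  ultimately show ?thesis by (simp only:)
qed

lemma S_le_J: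
  assumes "x \<in> pts X0 \<inter> pts X1"
  shows "nrm S x \<le> min 1 (2 powi (- n)) * J n x"
  using assms S_left(2)[of x] S_right(2)[of x] nrm0_le_J[of x n] nrm1_le_J[of x n]
  by (auto simp: min_def)

lemma J_le_normalized:
  assumes "0 \<le> B" "lq_le q (normalized u) B"
  shows "J n (u n) \<le> f (2 powi n) * B"
proof -
  have "J n (u n) / f (2 powi n) \<le> B"
    by (rule order_trans[OF abs_ge_self lq_le_component[OF q assms]])
  then show ?thesis by (simp add: divide_le_eq mult.commute)
qed

lemma S_le_h:
  assumes "0 \<le> B" "lq_le q (normalized u) B" "u n \<in> pts X0 \<inter> pts X1"
  shows "nrm S (u n) \<le> h n * B"
proof -
  have "min 1 (2 powi (- n)) * J n (u n) \<le> min 1 (2 powi (- n)) * (f (2 powi n) * B)"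
    by (intro mult_left_mono J_le_normalized assms) auto
  from order_trans[OF S_le_J[OF assms(3)] this] show ?thesis by (simp only: mult.assoc)
qed

lemma sum_h_le:
  assumes "finite F" "0 \<le> B"
  shows "(\<Sum>n\<in>F. h n * B) \<le> infsum h UNIV * B"
  using finite_sum_le_infsum[OF weights assms(1)] h_nonneg assms(2)
  by (simp add: mult_right_mono flip: sum_distrib_right)

lemma in_sum_space: "x \<in> pts X0 \<inter> pts X1 \<Longrightarrow> x \<in> pts S"
  using S_left(1) by blast

lemma partial_mem:
  assumes "\<And>n. u n \<in> pts X0 \<inter> pts X1"
  shows "sum u F \<in> pts X0 \<inter> pts X1"
  using assms by (intro IntI normed_space_mem(6)[OF X0] normed_space_mem(6)[OF X1]) auto

lemma partial_mem_S:
  assumes "\<And>n. u n \<in> pts X0 \<inter> pts X1"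
  shows "sum u F \<in> pts S"
  by (rule in_sum_space[OF partial_mem[OF assms]])

section \<open>Calculus of J-representations\<close>

lemma J_reps_iff:
  assumes x: "x \<in> pts S"
  shows "u \<in> J_reps X0 X1 x \<longleftrightarrow> (\<forall>n. u n \<in> pts X0 \<inter> pts X1) \<and>
    (\<forall>e>0. \<exists>L. \<forall>M\<ge>L. \<forall>N\<ge>L. nrm S (x - (\<Sum>n\<in>{- int M..int N}. u n)) < e)"
proof -
  have nn: "0 \<le> nrm S (x - (\<Sum>n\<in>F. u n))" if "\<forall>n. u n \<in> pts X0 \<inter> pts X1" for F
    using that x by (intro normed_space_nonneg[OF S] normed_space_mem(3)[OF S] partial_mem_S) auto
  show ?thesis
    unfolding J_reps_def mem_Collect_eq tendsto_iff eventually_prod_sequentially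
    using nn by (simp add: dist_real_def cong: conj_cong) blast
qed

lemma J_reps_mem: "u \<in> J_reps X0 X1 x \<Longrightarrow> u n \<in> pts X0 \<inter> pts X1"
  by (auto simp: J_reps_def)

lemma J_reps_approx:
  assumes "x \<in> pts S" "u \<in> J_reps X0 X1 x" "e > 0"
  obtains L where "\<And>M N. M \<ge> L \<Longrightarrow> N \<ge> L \<Longrightarrow> nrm S (x - (\<Sum>n\<in>{- int M..int N}. u n)) < e"
  using assms J_reps_iff[OF assms(1)] by metis

lemma J_reps_finite:
  assumes F: "finite F" and u: "\<And>n. u n \<in> pts X0 \<inter> pts X1"
  shows "(\<lambda>n. if n \<in> F then u n else 0) \<in> J_reps X0 X1 (sum u F)"
proof (subst J_reps_iff)
  show "sum u F \<in> pts S" by (rule partial_mem_S[OF u])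
  have 0: "0 \<in> pts X0 \<inter> pts X1" using normed_space_mem(1)[OF X0] normed_space_mem(1)[OF X1] by simp
  obtain L where L: "\<And>n. n \<in> F \<Longrightarrow> \<bar>n\<bar> \<le> int L"
  proof -
    have "\<exists>L. \<forall>n\<in>F. nat \<bar>n\<bar> \<le> L" using F by (meson finite_nat_set_iff_bounded_le finite_imageI imageI)
    then show ?thesis using that by (auto simp: nat_le_iff)
  qed
  have "(\<Sum>n\<in>{- int M..int N}. if n \<in> F then u n else 0) = sum u F" if "M \<ge> L" "N \<ge> L" for M N
  proof -
    have "F \<subseteq> {- int M..int N}" using L that by force
    then show ?thesis by (simp add: sum.If_cases Int_absorb1 flip: Int_def)
  qed
  then show "(\<forall>n. (if n \<in> F then u n else 0) \<in> pts X0 \<inter> pts X1) \<and>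
    (\<forall>e>0. \<exists>L. \<forall>M\<ge>L. \<forall>N\<ge>L.
      nrm S (sum u F - (\<Sum>n\<in>{- int M..int N}. if n \<in> F then u n else 0)) < e)"
    using u 0 normed_space_zero[OF S] by (auto intro!: exI[of _ L])
qed

lemma J_reps_add:
  assumes x: "x \<in> pts S" "u \<in> J_reps X0 X1 x" and y: "y \<in> pts S" "v \<in> J_reps X0 X1 y"
  shows "(\<lambda>n. u n + v n) \<in> J_reps X0 X1 (x + y)"
proof (subst J_reps_iff)
  show "x + y \<in> pts S" using x y by (intro normed_space_mem(2)[OF S])
  have mem: "u n \<in> pts X0 \<inter> pts X1" "v n \<in> pts X0 \<inter> pts X1" for n using x y J_reps_mem by auto
  have "\<exists>L. \<forall>M\<ge>L. \<forall>N\<ge>L. nrm S (x + y - (\<Sum>n\<in>{- int M..int N}. u n + v n)) < e" if "e > 0" for e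
  proof -
    from that have e: "e / 2 > 0" by simp
    obtain L1 where L1: "\<And>M N. M \<ge> L1 \<Longrightarrow> N \<ge> L1 \<Longrightarrow> nrm S (x - (\<Sum>n\<in>{- int M..int N}. u n)) < e / 2"
      using J_reps_approx[OF x e] by blast
    obtain L2 where L2: "\<And>M N. M \<ge> L2 \<Longrightarrow> N \<ge> L2 \<Longrightarrow> nrm S (y - (\<Sum>n\<in>{- int M..int N}. v n)) < e / 2"
      using J_reps_approx[OF y e] by blast
    have "nrm S (x + y - (\<Sum>n\<in>{- int M..int N}. u n + v n)) < e" if "M \<ge> max L1 L2" "N \<ge> max L1 L2" for M N
    proof -
      let ?U = "\<Sum>n\<in>{- int M..int N}. u n" and ?V = "\<Sum>n\<in>{- int M..int N}. v n"
      have "?U \<in> pts S" "?V \<in> pts S" using mem by (auto intro: partial_mem_S)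
      then have "nrm S ((x - ?U) + (y - ?V)) \<le> nrm S (x - ?U) + nrm S (y - ?V)"
        using x y by (intro normed_space_triangle[OF S] normed_space_mem(3)[OF S])
      then show ?thesis using L1[of M N] L2[of M N] that by (simp add: sum.distrib algebra_simps)
    qed
    then show ?thesis by blast
  qed
  then show "(\<forall>n. u n + v n \<in> pts X0 \<inter> pts X1) \<and> (\<forall>e>0. \<exists>L. \<forall>M\<ge>L. \<forall>N\<ge>L.
      nrm S (x + y - (\<Sum>n\<in>{- int M..int N}. u n + v n)) < e)"
    using mem normed_space_mem(2)[OF X0] normed_space_mem(2)[OF X1] by blast
qed

lemma J_reps_scale:
  assumes x: "x \<in> pts S" "u \<in> J_reps X0 X1 x"
  shows "(\<lambda>n. c *\<^sub>R u n) \<in> J_reps X0 X1 (c *\<^sub>R x)"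
proof (subst J_reps_iff)
  show "c *\<^sub>R x \<in> pts S" using x by (intro normed_space_mem(5)[OF S])
  have mem: "u n \<in> pts X0 \<inter> pts X1" for n using x J_reps_mem by auto
  have "\<exists>L. \<forall>M\<ge>L. \<forall>N\<ge>L. nrm S (c *\<^sub>R x - (\<Sum>n\<in>{- int M..int N}. c *\<^sub>R u n)) < e" if "e > 0" for e
  proof -
    have e: "e / (\<bar>c\<bar> + 1) > 0" using that by simp
    obtain L where L: "\<And>M N. M \<ge> L \<Longrightarrow> N \<ge> L \<Longrightarrow> nrm S (x - (\<Sum>n\<in>{- int M..int N}. u n)) < e / (\<bar>c\<bar> + 1)"
      using J_reps_approx[OF x e] by blast
    have "nrm S (c *\<^sub>R x - (\<Sum>n\<in>{- int M..int N}. c *\<^sub>R u n)) < e" if "M \<ge> L" "N \<ge> L" for M N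
    proof -
      let ?U = "\<Sum>n\<in>{- int M..int N}. u n"
      have U: "x - ?U \<in> pts S"
        using mem x by (intro normed_space_mem(3)[OF S] partial_mem_S)
      have "nrm S (c *\<^sub>R x - (\<Sum>n\<in>{- int M..int N}. c *\<^sub>R u n)) = \<bar>c\<bar> * nrm S (x - ?U)"
        using normed_space_scale[OF S U, of c] by (simp add: scaleR_diff_right scaleR_sum_right)
      also have "\<dots> \<le> (\<bar>c\<bar> + 1) * nrm S (x - ?U)"
        using normed_space_nonneg[OF S U] by (intro mult_right_mono) auto
      also have "\<dots> < e"
        using L[OF that] pos_less_divide_eq[of "\<bar>c\<bar> + 1"] by (simp add: mult.commute)
      finally show ?thesis .
    qed
    then show ?thesis by blast
  qed
  then show "(\<forall>n. c *\<^sub>R u n \<in> pts X0 \<inter> pts X1) \<and> (\<forall>e>0. \<exists>L. \<forall>M\<ge>L. \<forall>N\<ge>L.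
      nrm S (c *\<^sub>R x - (\<Sum>n\<in>{- int M..int N}. c *\<^sub>R u n)) < e)"
    using mem normed_space_mem(5)[OF X0] normed_space_mem(5)[OF X1] by blast
qed

text \<open>Negative indices are summed in \<open>X0\<close> and the others in \<open>X1\<close>:
  for \<open>n < 0\<close> the minimum in \<open>h n\<close> is 1 and \<open>J\<close> controls the
  norm of \<open>X0\<close>, for \<open>n \<ge> 0\<close> it is \<open>2 powi (- n)\<close> and
  \<open>J\<close> controls the norm of \<open>X1\<close>. So \<open>h n * B\<close> dominates each
  series in its own Banach space. The lower and the upper cut-off act on separate series and may
  tend to infinity independently.\<close>

lemma J_reps_exists:
  assumes u: "\<And>n. u n \<in> pts X0 \<inter> pts X1" and "0 \<le> B" "lq_le q (normalized u) B"
  obtains x where "x \<in> pts S" "u \<in> J_reps X0 X1 x"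
proof -
  have c0: "nrm X0 (u n) \<le> h n * B" if "n < 0" for n
  proof -
    have "(1::real) \<le> 2 powi (- n)" using that power_int_increasing[of 0 "- n" "2::real"] by simp
    then show ?thesis using order_trans[OF nrm0_le_J J_le_normalized[OF assms(2,3)]] by (simp add: min_def)
  qed
  have c1: "nrm X1 (u n) \<le> h n * B" if "n \<ge> 0" for n
  proof -
    have "(2::real) powi (- n) \<le> 1" using that power_int_increasing[of "- n" 0 "2::real"] by simp
    moreover have "nrm X1 (u n) \<le> 2 powi (- n) * (f (2 powi n) * B)"
      by (rule order_trans[OF nrm1_le_J[of _ n]]) (intro mult_left_mono J_le_normalized assms, simp)
    ultimately show ?thesis by (simp add: min_def mult.assoc)
  qed
  obtain l0 where l0: "l0 \<in> pts X0" "(\<lambda>L. nrm X0 (sum u {- int L..-1} - l0)) \<longlonglongrightarrow> 0"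
  proof (rule banach_space_series[OF banach_couple_normed(3)[OF couple], of u "\<lambda>L. {- int L..-1}"
      "\<lambda>n. h n * B" "infsum h UNIV * B"])
    show "u n \<in> pts X0" for n using u by auto
    show "nrm X0 (u n) \<le> h n * B" if "n \<in> {- int L..-1}" for n L using that by (intro c0) auto
    show "(\<Sum>n\<in>{- int L..-1}. h n * B) \<le> infsum h UNIV * B" for L by (intro sum_h_le assms) simp
  qed auto
  obtain l1 where l1: "l1 \<in> pts X1" "(\<lambda>L. nrm X1 (sum u {0..int L} - l1)) \<longlonglongrightarrow> 0"
  proof (rule banach_space_series[OF banach_couple_normed(4)[OF couple], of u "\<lambda>L. {0..int L}"
      "\<lambda>n. h n * B" "infsum h UNIV * B"])
    show "u n \<in> pts X1" for n using u by auto
    show "nrm X1 (u n) \<le> h n * B" if "n \<in> {0..int L}" for n L using that by (intro c1) auto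
    show "(\<Sum>n\<in>{0..int L}. h n * B) \<le> infsum h UNIV * B" for L by (intro sum_h_le assms) simp
  qed auto
  have xS: "l0 + l1 \<in> pts S" using l0 l1 by (intro sum_space_mem)
  have "\<exists>L. \<forall>M\<ge>L. \<forall>N\<ge>L. nrm S (l0 + l1 - sum u {- int M..int N}) < e" if "e > 0" for e
  proof -
    have e: "e / 2 > 0" using that by simp
    obtain L0 where L0: "\<And>L. L \<ge> L0 \<Longrightarrow> nrm X0 (sum u {- int L..-1} - l0) < e / 2"
      using order_tendstoD(2)[OF l0(2) e] by (auto simp: eventually_sequentially)
    obtain L1 where L1: "\<And>L. L \<ge> L1 \<Longrightarrow> nrm X1 (sum u {0..int L} - l1) < e / 2"
      using order_tendstoD(2)[OF l1(2) e] by (auto simp: eventually_sequentially)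
    have "nrm S (l0 + l1 - sum u {- int M..int N}) < e" if "M \<ge> max L0 L1" "N \<ge> max L0 L1" for M N
    proof -
      have "{- int M..int N} = {- int M..-1} \<union> {0..int N}" by auto
      then have split: "sum u {- int M..int N} = sum u {- int M..-1} + sum u {0..int N}"
        by (simp add: sum.union_disjoint)
      have m: "l0 - sum u {- int M..-1} \<in> pts X0" "l1 - sum u {0..int N} \<in> pts X1"
        using l0 l1 partial_mem[of u, OF u] by (auto intro: normed_space_mem(3)[OF X0] normed_space_mem(3)[OF X1])
      have "nrm S ((l0 - sum u {- int M..-1}) + (l1 - sum u {0..int N}))
        \<le> nrm X0 (l0 - sum u {- int M..-1}) + nrm X1 (l1 - sum u {0..int N})"
        by (intro sum_space_nrm_le X0 X1 m)
      also have "\<dots> < e / 2 + e / 2"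
        using L0[of M] L1[of N] that l0 l1 partial_mem[of u, OF u]
          normed_space_minus_commute[OF X0, of l0 "sum u {- int M..-1}"]
          normed_space_minus_commute[OF X1, of l1 "sum u {0..int N}"]
        by (intro add_strict_mono) auto
      finally show ?thesis by (simp add: split algebra_simps)
    qed
    then show ?thesis by blast
  qed
  then have "u \<in> J_reps X0 X1 (l0 + l1)" using J_reps_iff[OF xS] u by blast
  with xS that show ?thesis by blast
qed

text \<open>This is the continuity of the embedding of the interpolation space into the sum space,
  from which its norm inherits definiteness.\<close>

lemma S_le_J_le:
  assumes x: "x \<in> pts S" and "0 \<le> B" "J_le x B"
  shows "nrm S x \<le> infsum h UNIV * B"
proof (rule field_le_epsilon)
  obtain u where u: "u \<in> J_reps X0 X1 x" "lq_le q (normalized u) B" using assms by (auto simp: J_le_def)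
  have mem: "u n \<in> pts X0 \<inter> pts X1" for n using J_reps_mem[OF u(1)] .
  fix e :: real assume "e > 0"
  then obtain L where L: "nrm S (x - (\<Sum>n\<in>{- int L..int L}. u n)) < e"
    using J_reps_approx[OF x u(1)] by blast
  let ?U = "\<Sum>n\<in>{- int L..int L}. u n"
  have U: "?U \<in> pts S" by (rule partial_mem_S[OF mem])
  have "nrm S ((x - ?U) + ?U) \<le> nrm S (x - ?U) + nrm S ?U"
    using x U normed_space_mem(3)[OF S] by (intro normed_space_triangle[OF S]) auto
  also have "nrm S ?U \<le> (\<Sum>n\<in>{- int L..int L}. nrm S (u n))"
    by (intro normed_space_sum[OF S] in_sum_space mem)
  also have "\<dots> \<le> (\<Sum>n\<in>{- int L..int L}. h n * B)"
    using S_le_h[OF assms(2) u(2)] mem by (intro sum_mono) auto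
  also have "\<dots> \<le> infsum h UNIV * B" using assms by (intro sum_h_le) auto
  finally show "nrm S x \<le> infsum h UNIV * B + e" using L by simp
qed

lemma J_le_weaken: "0 \<le> A \<Longrightarrow> A \<le> B \<Longrightarrow> J_le x A \<Longrightarrow> J_le x B"
  unfolding J_le_def using lq_le_weaken[OF q] by blast

lemma J_le_zero: "J_le 0 0"
proof -
  have "(\<lambda>n. 0) \<in> J_reps X0 X1 0"
    using J_reps_finite[of "{}" "\<lambda>_. 0"] normed_space_mem(1)[OF X0] normed_space_mem(1)[OF X1] by simp
  then show ?thesis unfolding J_le_def by (rule bexI[rotated]) (simp add: J_zero lq_le_zero)
qed

lemma J_le_add:
  assumes x: "x \<in> pts S" "0 \<le> A" "J_le x A" and y: "y \<in> pts S" "0 \<le> B" "J_le y B"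
  shows "J_le (x + y) (A + B)"
proof -
  obtain u where u: "u \<in> J_reps X0 X1 x" "lq_le q (normalized u) A" using x by (auto simp: J_le_def)
  obtain v where v: "v \<in> J_reps X0 X1 y" "lq_le q (normalized v) B" using y by (auto simp: J_le_def)
  have "lq_le q (normalized (\<lambda>n. u n + v n)) (A + B)"
  proof (rule lq_le_mono[OF q lq_le_add[OF q x(2) y(2) u(2) v(2)]])
    fix n
    have m: "u n \<in> pts X0 \<inter> pts X1" "v n \<in> pts X0 \<inter> pts X1" using u v J_reps_mem by auto
    then have "0 \<le> J n (u n + v n)" using normed_space_mem(2)[OF X0] by (intro J_nonneg) auto
    moreover have "J n (u n + v n) \<le> J n (u n) + J n (v n)" using m by (rule J_add)
    ultimately show "\<bar>normalized (\<lambda>n. u n + v n) n\<bar> \<le> \<bar>normalized u n + normalized v n\<bar>"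
      by (simp flip: add_divide_distrib add: divide_right_mono less_imp_le)
  qed
  then show ?thesis using J_reps_add[OF x(1) u(1) y(1) v(1)] by (auto simp: J_le_def)
qed

lemma J_le_scale:
  assumes x: "x \<in> pts S" "0 \<le> A" "J_le x A"
  shows "J_le (c *\<^sub>R x) (\<bar>c\<bar> * A)"
proof -
  obtain u where u: "u \<in> J_reps X0 X1 x" "lq_le q (normalized u) A" using x by (auto simp: J_le_def)
  have "normalized (\<lambda>n. c *\<^sub>R u n) = (\<lambda>n. \<bar>c\<bar> * normalized u n)"
    using J_reps_mem[OF u(1)] by (simp add: J_scale)
  then have "lq_le q (normalized (\<lambda>n. c *\<^sub>R u n)) (\<bar>c\<bar> * A)"
    using lq_le_scale[OF q x(2) u(2), of "\<bar>c\<bar>"] by simp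
  then show ?thesis using J_reps_scale[OF x(1) u(1)] by (auto simp: J_le_def)
qed

section \<open>The interpolation space as a normed space\<close>

abbreviation Y where "Y \<equiv> interp_space X0 X1 f q"

lemma J_norm_le: "0 \<le> B \<Longrightarrow> J_le x B \<Longrightarrow> J_norm X0 X1 f q x \<le> ennreal B"
  unfolding J_le_def J_norm_def using lq_norm_le_iff[OF q] by (auto intro: INF_lower2)

lemma J_le_less:
  assumes "0 \<le> B" "J_norm X0 X1 f q x < ennreal B"
  shows "J_le x B"
proof -
  obtain u where "u \<in> J_reps X0 X1 x" "lq_norm q (normalized u) < ennreal B"
    using assms(2) unfolding J_norm_def INF_less_iff by blast
  then show ?thesis unfolding J_le_def lq_norm_le_iff[OF q assms(1), symmetric]
    by (auto intro: less_imp_le)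
qed

lemma interp_space_memI:
  assumes "x \<in> pts S" "0 \<le> B" "J_le x B"
  shows "x \<in> pts Y" "nrm Y x \<le> B"
  using J_norm_le[OF assms(2,3)] assms le_less_trans[OF _ ennreal_less_top, of _ B]
  by (auto simp: interp_space_def enn2real_leI)

lemma interp_space_mem: "x \<in> pts Y \<Longrightarrow> x \<in> pts S"
  by (simp add: interp_space_def)

lemma interp_space_J_le:
  assumes "x \<in> pts Y" "nrm Y x < B"
  shows "J_le x B"
proof -
  have fin: "J_norm X0 X1 f q x < top" using assms by (simp add: interp_space_def)
  have "enn2real (J_norm X0 X1 f q x) < B" using assms(2) by (simp add: interp_space_def)
  then have "J_norm X0 X1 f q x < ennreal B"
    using fin by (metis ennreal_enn2real ennreal_lessI enn2real_nonneg le_less_trans)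
  moreover have "0 \<le> B" using \<open>enn2real _ < B\<close> enn2real_nonneg order_trans less_imp_le by blast
  ultimately show ?thesis by (rule J_le_less[rotated])
qed

lemma interp_space_nonneg: "0 \<le> nrm Y x"
  by (simp add: interp_space_def)

text \<open>The infimum in the norm need not be attained, so every \<open>x\<close> is given a
  representation with bound \<open>nrm Y x + e\<close>, and the slack is removed at the end of each
  estimate. Homogeneity is the inequality \<open>scale_le\<close> applied to a scalar and to its
  inverse.\<close>

lemma interp_space_normed: "normed_space Y"
proof -
  have J: "J_le x (nrm Y x + e)" if "x \<in> pts Y" "e > 0" for x e
    using that by (intro interp_space_J_le) auto
  have pos: "0 \<le> nrm Y x + e" if "e > 0" for x and e :: real
    using interp_space_nonneg[of x] that by simp
  have zero: "0 \<in> pts Y" "nrm Y 0 = 0"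
    using interp_space_memI[OF normed_space_mem(1)[OF S] _ J_le_zero] interp_space_nonneg[of 0] by auto
  have add: "x + y \<in> pts Y \<and> nrm Y (x + y) \<le> nrm Y x + nrm Y y" if "x \<in> pts Y" "y \<in> pts Y" for x y
  proof -
    have J': "J_le (x + y) ((nrm Y x + e) + (nrm Y y + e))" if "e > 0" for e
      using that \<open>x \<in> pts Y\<close> \<open>y \<in> pts Y\<close> by (intro J_le_add interp_space_mem J pos)
    have xyS: "x + y \<in> pts S" using that interp_space_mem normed_space_mem(2)[OF S] by blast
    have p: "0 \<le> (nrm Y x + e) + (nrm Y y + e)" if "e > 0" for e
      using pos[OF that, of x] pos[OF that, of y] by simp
    have "nrm Y (x + y) \<le> nrm Y x + nrm Y y + e" if "e > 0" for e
      using interp_space_memI(2)[OF xyS p J', of "e / 2"] that by simp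
    then show ?thesis
      using interp_space_memI(1)[OF xyS p J', of 1] by (auto intro: field_le_epsilon)
  qed
  have scale_le: "c *\<^sub>R x \<in> pts Y \<and> nrm Y (c *\<^sub>R x) \<le> \<bar>c\<bar> * nrm Y x" if "x \<in> pts Y" for c x
  proof -
    have J': "J_le (c *\<^sub>R x) (\<bar>c\<bar> * (nrm Y x + e))" if "e > 0" for e
      using that \<open>x \<in> pts Y\<close> by (intro J_le_scale interp_space_mem J pos)
    have xS: "c *\<^sub>R x \<in> pts S" using that interp_space_mem normed_space_mem(5)[OF S] by blast
    have p: "0 \<le> \<bar>c\<bar> * (nrm Y x + e)" if "e > 0" for e using pos[OF that, of x] by simp
    have "nrm Y (c *\<^sub>R x) \<le> \<bar>c\<bar> * nrm Y x + e" if "e > 0" for e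
    proof -
      have "nrm Y (c *\<^sub>R x) \<le> \<bar>c\<bar> * (nrm Y x + e / (\<bar>c\<bar> + 1))"
        using that by (intro interp_space_memI(2)[OF xS p J']) auto
      also have "\<dots> \<le> \<bar>c\<bar> * nrm Y x + e" using that by (simp add: field_simps)
      finally show ?thesis .
    qed
    then show ?thesis
      using interp_space_memI(1)[OF xS p J', of 1] by (auto intro: field_le_epsilon)
  qed
  have scale: "nrm Y (c *\<^sub>R x) = \<bar>c\<bar> * nrm Y x" if "x \<in> pts Y" for c x
  proof (cases "c = 0")
    case False
    have "nrm Y x \<le> \<bar>inverse c\<bar> * nrm Y (c *\<^sub>R x)"
      using scale_le[of "c *\<^sub>R x" "inverse c"] scale_le[OF that, of c] False by simp
    then have "\<bar>c\<bar> * nrm Y x \<le> \<bar>c\<bar> * (\<bar>inverse c\<bar> * nrm Y (c *\<^sub>R x))" by (rule mult_left_mono) simp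
    also have "\<dots> = nrm Y (c *\<^sub>R x)" using False by (simp add: abs_inverse)
    finally show ?thesis using scale_le[OF that, of c] by linarith
  qed (simp add: zero)
  have eq0: "x = 0" if x: "x \<in> pts Y" and "nrm Y x = 0" for x
  proof -
    let ?H = "infsum h UNIV"
    have H: "?H \<ge> 0" by (intro infsum_nonneg h_nonneg)
    have "nrm S x \<le> 0 + e" if "e > 0" for e
    proof -
      have e: "e / (?H + 1) > 0" using that H by simp
      have "nrm S x \<le> ?H * (e / (?H + 1))"
        using J[OF x e] e \<open>nrm Y x = 0\<close> by (intro S_le_J_le interp_space_mem x) auto
      also have "\<dots> \<le> e" using that H by (simp add: field_simps)
      finally show ?thesis by simp
    qed
    then have "nrm S x \<le> 0" by (rule field_le_epsilon)
    then show ?thesis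
      using normed_space_eq_0[OF S] normed_space_nonneg[OF S] interp_space_mem[OF x] by force
  qed
  have "subspace (pts Y)" using zero add scale_le by (auto simp: subspace_def)
  then show ?thesis
    unfolding normed_space_def using zero add scale eq0 interp_space_nonneg by blast
qed

text \<open>The representation carries all of \<open>z\<close> at index 0, where the weight
  \<open>2 powi 0\<close> is 1 and \<open>J\<close> is the norm of the intersection. This is the
  embedding of \<open>X0 \<inter> X1\<close> into the interpolation space.\<close>

lemma J_le_intersection:
  assumes z: "z \<in> pts X0 \<inter> pts X1"
  shows "J_le z (max (nrm X0 z) (nrm X1 z) / f 1)"
proof -
  let ?u = "\<lambda>n::int. if n \<in> {0} then z else 0"
  let ?c = "max (nrm X0 z) (nrm X1 z) / f 1"
  have u: "?u \<in> J_reps X0 X1 z" using J_reps_finite[of "{0}" "\<lambda>_. z"] z by simp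
  have "normalized ?u = (\<lambda>n. if n = 0 then ?c else 0)"
  proof
    fix n :: int
    show "normalized ?u n = (if n = 0 then ?c else 0)"
      by (cases "n = 0") (simp_all add: J_zero, simp add: J_fun_def)
  qed
  moreover have "0 \<le> ?c"
    using normed_space_nonneg[OF X0, of z] z f_pos[of 1] by (intro divide_nonneg_pos) auto
  ultimately have "lq_le q (normalized ?u) ?c" using lq_le_single[OF q, of ?c 0] by (simp only:)
  with u show ?thesis unfolding J_le_def by (intro bexI[of _ ?u])
qed

text \<open>The difference of the two representations is the zero sequence, which represents
  \<open>x - y\<close>; the norm of the sum space is definite. It serves to recognize an element
  from a reassembled representation.\<close>

lemma J_reps_unique:
  assumes "x \<in> pts S" "u \<in> J_reps X0 X1 x" "y \<in> pts S" "u \<in> J_reps X0 X1 y"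
  shows "x = y"
proof -
  have y': "(- 1) *\<^sub>R y \<in> pts S" using assms by (intro normed_space_mem(5)[OF S])
  have "(\<lambda>n. u n + (- 1) *\<^sub>R u n) \<in> J_reps X0 X1 (x + (- 1) *\<^sub>R y)"
    by (intro J_reps_add J_reps_scale assms y')
  then have rep: "(\<lambda>n. 0) \<in> J_reps X0 X1 (x - y)" by simp
  have xy: "x - y \<in> pts S" using assms by (intro normed_space_mem(3)[OF S])
  have "nrm S (x - y) \<le> 0 + e" if "e > 0" for e
    using J_reps_approx[OF xy rep that] by (metis add_0 diff_zero less_imp_le order_refl sum.neutral_const)
  then have "nrm S (x - y) \<le> 0" by (rule field_le_epsilon)
  then show ?thesis using normed_space_eq_0[OF S xy] normed_space_nonneg[OF S xy] by simp
qed

lemma normalized_restrict: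
  assumes "lq_le q (normalized u) B"
  shows "lq_le q (normalized (\<lambda>n. if P n then u n else 0)) B"
  by (rule lq_le_mono[OF q assms]) (simp add: J_zero)

text \<open>The cut sequences keep the bound \<open>B\<close>, so \<open>J_reps_exists\<close>
  supplies sums for both tails. Adding them to the finite middle part represents \<open>x\<close>
  again, and uniqueness gives the decomposition.\<close>

lemma J_reps_split:
  assumes x: "x \<in> pts S" "u \<in> J_reps X0 X1 x" and B: "0 \<le> B" "lq_le q (normalized u) B" and "0 \<le> N"
  obtains xm xp where "xm \<in> pts S" "xp \<in> pts S" "x = xm + sum u {-N..N} + xp"
    "(\<lambda>n. if n < - N then u n else 0) \<in> J_reps X0 X1 xm"
    "(\<lambda>n. if N < n then u n else 0) \<in> J_reps X0 X1 xp"
proof -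
  have mem: "u n \<in> pts X0 \<inter> pts X1" for n by (rule J_reps_mem[OF x(2)])
  have mem': "(if P n then u n else 0) \<in> pts X0 \<inter> pts X1" for P n
    using mem normed_space_mem(1)[OF X0] normed_space_mem(1)[OF X1] by simp
  obtain xm where m: "xm \<in> pts S" "(\<lambda>n. if n < - N then u n else 0) \<in> J_reps X0 X1 xm"
    by (rule J_reps_exists[OF mem' B(1) normalized_restrict[OF B(2)]])
  obtain xp where p: "xp \<in> pts S" "(\<lambda>n. if N < n then u n else 0) \<in> J_reps X0 X1 xp"
    by (rule J_reps_exists[OF mem' B(1) normalized_restrict[OF B(2)]])
  have c: "sum u {-N..N} \<in> pts S" "(\<lambda>n. if n \<in> {-N..N} then u n else 0) \<in> J_reps X0 X1 (sum u {-N..N})"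
    by (rule partial_mem_S[OF mem], rule J_reps_finite[OF _ mem]) simp
  have mc: "xm + sum u {-N..N} \<in> pts S" using m c by (intro normed_space_mem(2)[OF S])
  have "(\<lambda>n. ((if n < - N then u n else 0) + (if n \<in> {-N..N} then u n else 0)) + (if N < n then u n else 0))
      \<in> J_reps X0 X1 (xm + sum u {-N..N} + xp)"
    by (rule J_reps_add[OF mc J_reps_add[OF m c] p])
  also have "(\<lambda>n. ((if n < - N then u n else 0) + (if n \<in> {-N..N} then u n else 0)) + (if N < n then u n else 0)) = u"
    using \<open>0 \<le> N\<close> by auto
  finally have "u \<in> J_reps X0 X1 (xm + sum u {-N..N} + xp)" .
  moreover have "xm + sum u {-N..N} + xp \<in> pts S" by (rule normed_space_mem(2)[OF S mc p(1)])
  ultimately have "x = xm + sum u {-N..N} + xp" using J_reps_unique[OF x] by blast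
  then show ?thesis using that m p by blast
qed

lemma sum_h_tail:
  assumes "e > 0"
  obtains N :: nat where "\<And>F. finite F \<Longrightarrow> F \<inter> {- int N..int N} = {} \<Longrightarrow> sum h F < e"
proof -
  have "(sum h \<longlongrightarrow> infsum h UNIV) (finite_subsets_at_top UNIV)"
    using has_sum_infsum[OF weights] by (simp add: has_sum_def)
  then have "\<forall>\<^sub>F X in finite_subsets_at_top UNIV. infsum h UNIV - e < sum h X"
    by (rule order_tendstoD(1)) (use assms in simp)
  then obtain X where X: "finite X" "infsum h UNIV - e < sum h X"
    unfolding eventually_finite_subsets_at_top by blast
  obtain N where N: "\<And>n. n \<in> X \<Longrightarrow> \<bar>n\<bar> \<le> int N"
  proof -
    have "\<exists>L. \<forall>n\<in>X. nat \<bar>n\<bar> \<le> L" using X(1) by (meson finite_nat_set_iff_bounded_le finite_imageI imageI)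
    then show ?thesis using that by (auto simp: nat_le_iff)
  qed
  have "sum h F < e" if F: "finite F" "F \<inter> {- int N..int N} = {}" for F
  proof -
    have "F \<inter> X = {}" using F(2) N by force
    then have "sum h F + sum h X = sum h (F \<union> X)" using F X by (simp add: sum.union_disjoint)
    also have "\<dots> \<le> infsum h UNIV"
      using F X h_nonneg by (intro finite_sum_le_infsum weights) auto
    finally show ?thesis using X by linarith
  qed
  then show ?thesis using that by blast
qed

end

section \<open>Bounded and compact bilinear maps\<close>

lemma bounded_bilinear_mapD:
  assumes "bounded_bilinear_map X Y Z T"
  shows "x \<in> pts X \<Longrightarrow> y \<in> pts Y \<Longrightarrow> T x y \<in> pts Z"
    and "x \<in> pts X \<Longrightarrow> x' \<in> pts X \<Longrightarrow> y \<in> pts Y \<Longrightarrow> T (x + x') y = T x y + T x' y"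
    and "x \<in> pts X \<Longrightarrow> y \<in> pts Y \<Longrightarrow> y' \<in> pts Y \<Longrightarrow> T x (y + y') = T x y + T x y'"
    and "x \<in> pts X \<Longrightarrow> y \<in> pts Y \<Longrightarrow> T (c *\<^sub>R x) y = c *\<^sub>R T x y"
    and "x \<in> pts X \<Longrightarrow> y \<in> pts Y \<Longrightarrow> T x (c *\<^sub>R y) = c *\<^sub>R T x y"
  using assms by (auto simp: bounded_bilinear_map_def)

lemma bounded_bilinear_map_bound:
  assumes T: "bounded_bilinear_map X Y Z T" and X: "normed_space X" and Y: "normed_space Y"
  obtains C where "C > 0" "\<And>x y. x \<in> pts X \<Longrightarrow> y \<in> pts Y \<Longrightarrow> nrm Z (T x y) \<le> C * (nrm X x * nrm Y y)"
proof -
  obtain C where C: "\<And>x y. x \<in> pts X \<Longrightarrow> y \<in> pts Y \<Longrightarrow> nrm Z (T x y) \<le> C * nrm X x * nrm Y y"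
    using T unfolding bounded_bilinear_map_def by blast
  have "nrm Z (T x y) \<le> (\<bar>C\<bar> + 1) * (nrm X x * nrm Y y)" if xy: "x \<in> pts X" "y \<in> pts Y" for x y
  proof -
    have "0 \<le> nrm X x * nrm Y y"
      using xy by (intro mult_nonneg_nonneg normed_space_nonneg[OF X] normed_space_nonneg[OF Y])
    then have "C * (nrm X x * nrm Y y) \<le> (\<bar>C\<bar> + 1) * (nrm X x * nrm Y y)" by (intro mult_right_mono) auto
    then show ?thesis using C[OF xy] by (simp only: mult.assoc)
  qed
  then show ?thesis using that[of "\<bar>C\<bar> + 1"] by simp
qed

lemma bounded_bilinear_map_zero:
  assumes T: "bounded_bilinear_map X Y Z T" and X: "normed_space X" and Y: "normed_space Y"
  shows "y \<in> pts Y \<Longrightarrow> T 0 y = 0" and "x \<in> pts X \<Longrightarrow> T x 0 = 0"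
  using bounded_bilinear_mapD(4)[OF T normed_space_mem(1)[OF X], of y 0]
    bounded_bilinear_mapD(5)[OF T _ normed_space_mem(1)[OF Y], of x 0] by auto

lemma bounded_bilinear_map_diff:
  assumes T: "bounded_bilinear_map X Y Z T" and X: "normed_space X" and Y: "normed_space Y"
  shows "x \<in> pts X \<Longrightarrow> x' \<in> pts X \<Longrightarrow> y \<in> pts Y \<Longrightarrow> T (x - x') y = T x y - T x' y"
    and "x \<in> pts X \<Longrightarrow> y \<in> pts Y \<Longrightarrow> y' \<in> pts Y \<Longrightarrow> T x (y - y') = T x y - T x y'"
  using bounded_bilinear_mapD(2)[OF T _ normed_space_mem(5)[OF X], of x x' y "-1"]
    bounded_bilinear_mapD(4)[OF T, of x' y "-1"]
    bounded_bilinear_mapD(3)[OF T _ _ normed_space_mem(5)[OF Y], of x y y' "-1"]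
    bounded_bilinear_mapD(5)[OF T, of x y' "-1"] by auto

lemma bounded_bilinear_map_sum:
  assumes T: "bounded_bilinear_map X Y Z T" and X: "normed_space X" and Y: "normed_space Y"
    and u: "\<And>i. u i \<in> pts X" and v: "\<And>i. v i \<in> pts Y"
  shows "T (sum u A) (sum v B) = (\<Sum>i\<in>A. \<Sum>j\<in>B. T (u i) (v j))"
proof -
  have right: "T x (sum v B) = (\<Sum>j\<in>B. T x (v j))" if x: "x \<in> pts X" for x
  proof (induction B rule: infinite_finite_induct)
    case (insert j B)
    have "sum v B \<in> pts Y" by (intro normed_space_mem(6)[OF Y] v)
    with insert show ?case using bounded_bilinear_mapD(3)[OF T x v[of j]] by simp
  qed (use bounded_bilinear_map_zero[OF T X Y] x in auto)
  have V: "sum v B \<in> pts Y" by (intro normed_space_mem(6)[OF Y] v)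
  show ?thesis
  proof (induction A rule: infinite_finite_induct)
    case (insert i A)
    have "sum u A \<in> pts X" by (intro normed_space_mem(6)[OF X] u)
    with insert show ?case using bounded_bilinear_mapD(2)[OF T u[of i] _ V] right[OF u] by simp
  qed (use bounded_bilinear_map_zero[OF T X Y] V in auto)
qed

lemma bounded_bilinear_map_tendsto:
  assumes T: "bounded_bilinear_map X Y Z T" and X: "normed_space X" and Y: "normed_space Y"
    and Z: "normed_space Z" and x: "x \<in> pts X" and y: "y \<in> pts Y"
    and u: "\<And>L. u L \<in> pts X" and v: "\<And>L. v L \<in> pts Y"
    and ux: "(\<lambda>L::nat. nrm X (x - u L)) \<longlonglongrightarrow> 0" and vy: "(\<lambda>L. nrm Y (y - v L)) \<longlonglongrightarrow> 0"
  shows "(\<lambda>L. nrm Z (T x y - T (u L) (v L))) \<longlonglongrightarrow> 0"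
proof -
  obtain C where C: "C > 0" "\<And>x y. x \<in> pts X \<Longrightarrow> y \<in> pts Y \<Longrightarrow> nrm Z (T x y) \<le> C * (nrm X x * nrm Y y)"
    using bounded_bilinear_map_bound[OF T X Y] by blast
  let ?b = "\<lambda>L. C * (nrm X (x - u L) * nrm Y y) + C * ((nrm X x + nrm X (x - u L)) * nrm Y (y - v L))"
  have lim: "?b \<longlonglongrightarrow> C * (0 * nrm Y y) + C * ((nrm X x + 0) * 0)"
    by (intro tendsto_intros ux vy)
  have xu: "x - u L \<in> pts X" and yv: "y - v L \<in> pts Y" for L
    using x y u v by (auto intro: normed_space_mem(3)[OF X] normed_space_mem(3)[OF Y])
  have mem: "T x y \<in> pts Z" "T (x - u L) y \<in> pts Z" "T (u L) (y - v L) \<in> pts Z" "T (u L) (v L) \<in> pts Z" for L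
    using x y u v xu yv by (auto intro: bounded_bilinear_mapD(1)[OF T])
  have bound: "nrm Z (T x y - T (u L) (v L)) \<le> ?b L" for L
  proof -
    have "T x y - T (u L) (v L) = T (x - u L) y + T (u L) (y - v L)"
      using x y u v by (simp add: bounded_bilinear_map_diff[OF T X Y])
    then have "nrm Z (T x y - T (u L) (v L)) \<le> nrm Z (T (x - u L) y) + nrm Z (T (u L) (y - v L))"
      using normed_space_triangle[OF Z mem(2,3)[of L]] by simp
    also have "\<dots> \<le> C * (nrm X (x - u L) * nrm Y y) + C * (nrm X (u L) * nrm Y (y - v L))"
      by (intro add_mono C xu yv u y)
    also have "nrm X (u L) \<le> nrm X x + nrm X (x - u L)"
      using normed_space_triangle_minus[OF X x xu[of L]] by simp
    then have "C * (nrm X (x - u L) * nrm Y y) + C * (nrm X (u L) * nrm Y (y - v L)) \<le> ?b L"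
      using C(1) normed_space_nonneg[OF Y yv] by (intro add_left_mono mult_left_mono mult_right_mono) auto
    finally show ?thesis .
  qed
  have "0 \<le> nrm Z (T x y - T (u L) (v L))" for L
    using mem by (intro normed_space_nonneg[OF Z] normed_space_mem(3)[OF Z])
  then show ?thesis
    by (intro tendsto_sandwich[OF _ _ tendsto_const lim[simplified]] always_eventually allI)
      (use bound in auto)
qed

text \<open>
  This is where compactness enters: a totally bounded set of products carries no mass that is small in
  the sum space but not in \<open>Z\<close>.
\<close>

lemma compact_bilinear_small:
  assumes T: "compact_bilinear_map X Y Z T" and TS: "bounded_bilinear_map SX SY SZ T"
    and X: "normed_space X" "normed_space SX" "pts X \<subseteq> pts SX"
    and Y: "normed_space Y" "normed_space SY" "pts Y \<subseteq> pts SY"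
    and Z: "banach_space Z" "normed_space SZ" "pts Z \<subseteq> pts SZ"
    and le: "\<And>z. z \<in> pts Z \<Longrightarrow> nrm SZ z \<le> nrm Z z" and "\<delta> > 0"
  obtains \<eta> where "\<eta> > 0"
    "\<And>x y a b. \<lbrakk>x \<in> pts X; y \<in> pts Y; nrm X x \<le> a; nrm Y y \<le> b; nrm SX x * nrm SY y \<le> \<eta> * (a * b)\<rbrakk>
      \<Longrightarrow> nrm Z (T x y) \<le> \<delta> * (a * b)"
proof -
  note nZ = banach_space_normed[OF Z(1)]
  have TB: "bounded_bilinear_map X Y Z T" using T by (simp add: compact_bilinear_map_def)
  let ?A = "{T x y |x y. x \<in> pts X \<and> y \<in> pts Y \<and> max (nrm X x) (nrm Y y) \<le> 1}"
  have "Metric_space.mtotally_bounded (pts Z) (ndist Z) ?A"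
    using T by (simp add: compact_bilinear_map_def)
  then obtain \<eta> where \<eta>: "\<eta> > 0" "\<And>z. z \<in> ?A \<Longrightarrow> nrm SZ z < \<eta> \<Longrightarrow> nrm Z z < \<delta>"
    using totally_bounded_small[OF Z(1,2,3) le _ \<open>\<delta> > 0\<close>] by blast
  obtain C where C: "C > 0"
    "\<And>x y. x \<in> pts SX \<Longrightarrow> y \<in> pts SY \<Longrightarrow> nrm SZ (T x y) \<le> C * (nrm SX x * nrm SY y)"
    using bounded_bilinear_map_bound[OF TS X(2) Y(2)] by blast
  show ?thesis
  \<comment> \<open>The constant \<open>C\<close> passes from the product of the norms of
    \<open>x\<close> and \<open>y\<close> in the sum spaces to the norm of \<open>T x y\<close>; the
    factor 2 produces the strict inequality that the choice of \<eta> requires.\<close>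
  proof (rule that[of "\<eta> / (2 * C)"])
    show "\<eta> / (2 * C) > 0" using \<eta> C by simp
    fix x y a b
    assume x: "x \<in> pts X" "nrm X x \<le> a" and y: "y \<in> pts Y" "nrm Y y \<le> b"
      and small: "nrm SX x * nrm SY y \<le> \<eta> / (2 * C) * (a * b)"
    have n: "0 \<le> nrm X x" "0 \<le> nrm Y y"
      using x y normed_space_nonneg[OF X(1)] normed_space_nonneg[OF Y(1)] by auto
    show "nrm Z (T x y) \<le> \<delta> * (a * b)"
    proof (cases "a = 0 \<or> b = 0")
      case True
      then have "x = 0 \<or> y = 0"
        using n x y normed_space_eq_0[OF X(1)] normed_space_eq_0[OF Y(1)] by auto
      then have "T x y = 0" using bounded_bilinear_map_zero[OF TB X(1) Y(1)] x y by auto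
      then show ?thesis using normed_space_zero[OF nZ] True by auto
    next
      case False
      then have pos: "a > 0" "b > 0" using n x y by linarith+
      define z where "z = T ((1 / a) *\<^sub>R x) ((1 / b) *\<^sub>R y)"
      have xy': "(1 / a) *\<^sub>R x \<in> pts X" "(1 / b) *\<^sub>R y \<in> pts Y"
        using x y by (auto intro: normed_space_mem(5)[OF X(1)] normed_space_mem(5)[OF Y(1)])
      have nxy: "nrm X ((1 / a) *\<^sub>R x) \<le> 1" "nrm Y ((1 / b) *\<^sub>R y) \<le> 1"
        using x y pos by (simp_all add: normed_space_scale[OF X(1)] normed_space_scale[OF Y(1)])
      have zA: "z \<in> ?A" unfolding z_def using xy' nxy by (intro CollectI exI conjI) auto
      have z: "z = (1 / (a * b)) *\<^sub>R T x y"
        using x y xy' bounded_bilinear_mapD(4,5)[OF TB] by (simp add: z_def)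
      have Tm: "T x y \<in> pts Z" by (intro bounded_bilinear_mapD(1)[OF TB] x y)
      have "nrm SZ z = nrm SZ (T x y) / (a * b)"
        using Tm Z(3) pos by (auto simp: z normed_space_scale[OF Z(2)] abs_mult)
      also have "\<dots> \<le> C * (nrm SX x * nrm SY y) / (a * b)"
        using C(2)[of x y] x y X(3) Y(3) pos by (intro divide_right_mono) auto
      also have "\<dots> \<le> C * (\<eta> / (2 * C) * (a * b)) / (a * b)"
        using C pos by (intro divide_right_mono mult_left_mono small) auto
      also have "\<dots> = \<eta> / 2" using C pos by simp
      also have "\<dots> < \<eta>" using \<eta> by simp
      finally have "nrm Z z < \<delta>" using \<eta>(2)[OF zA] by blast
      moreover have "nrm Z z = nrm Z (T x y) / (a * b)"
        using Tm pos by (simp add: z normed_space_scale[OF nZ] abs_mult)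
      ultimately show ?thesis using pos by (simp add: divide_less_eq)
    qed
  qed
qed

section \<open>The J-norm of a product\<close>

text \<open>The parameter \<gamma> is kept abstract: besides positivity and the summability built
  into \<open>J_method\<close>, it is tied to \<rho> through \<open>\<gamma>_mult\<close>
  alone.\<close>

locale bilinear_interpolation =
  E: J_method E0 E1 \<gamma> p + F: J_method F0 F1 \<rho> q + G: J_method G0 G1 \<rho> r
  for E0 E1 :: "'a::hausdorff_tvs nspace" and F0 F1 :: "'b::hausdorff_tvs nspace"
    and G0 G1 :: "'c::hausdorff_tvs nspace" and \<gamma> \<rho> :: "real \<Rightarrow> real" and p q r :: ereal +
  fixes T :: "'a \<Rightarrow> 'b \<Rightarrow> 'c"
  assumes T_sum: "bounded_bilinear_map E.S F.S G.S T"
    and T0: "compact_bilinear_map E0 F0 G0 T"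
    and T1: "compact_bilinear_map E1 F1 G1 T"
    and \<rho>: "\<rho> \<in> param_Bpm"
    and \<gamma>_mult: "\<And>s t. s > 0 \<Longrightarrow> t > 0 \<Longrightarrow> \<gamma> s * \<rho> t \<le> \<rho> (s * t)"
    and exponents: "1 / r = 1 / p + 1 / q - 1"
begin

lemma \<rho>_B: "\<rho> \<in> param_B"
  using \<rho> by (simp add: param_Bpm_def)

lemma T0_bounded: "bounded_bilinear_map E0 F0 G0 T" and T1_bounded: "bounded_bilinear_map E1 F1 G1 T"
  using T0 T1 by (simp_all add: compact_bilinear_map_def)

lemma dil_powi_pos: "dil \<rho> (2 powi n) > 0"
  by (rule dil_pos[OF \<rho>_B]) simp

text \<open>This is where \<open>\<gamma>_mult\<close> enters: the weights at \<open>n\<close> and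
  at \<open>m\<close> are traded for the weight at \<open>n + m\<close>, so that what remains on an
  antidiagonal is a term of a convolution.\<close>

lemma J_product_le:
  assumes "0 \<le> A" "lq_le p (E.normalized u) A" "0 \<le> B" "lq_le q (F.normalized v) B"
    and "u n \<in> pts E0" "v m \<in> pts F0"
  shows "E.J n (u n) * F.J m (v m) \<le> \<rho> (2 powi (n + m)) * (E.normalized u n * F.normalized v m)"
proof -
  have "E.J n (u n) * F.J m (v m)
      = (\<gamma> (2 powi n) * \<rho> (2 powi m)) * (E.normalized u n * F.normalized v m)"
    using less_imp_neq[OF E.f_pos'[of n]] less_imp_neq[OF F.f_pos'[of m]] by simp
  also have "\<dots> \<le> \<rho> (2 powi n * 2 powi m) * (E.normalized u n * F.normalized v m)"
    using assms E.J_nonneg F.J_nonneg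
    by (intro mult_right_mono \<gamma>_mult mult_nonneg_nonneg divide_nonneg_pos) auto
  finally show ?thesis by (simp add: power_int_add)
qed

section \<open>The product of two fixed representations, summed along antidiagonals\<close>

context
  fixes x y u v A B A0 A1
  assumes x: "x \<in> pts E.S" "u \<in> J_reps E0 E1 x" "0 \<le> A" "lq_le p (E.normalized u) A"
    and y: "y \<in> pts F.S" "v \<in> J_reps F0 F1 y" "0 \<le> B" "lq_le q (F.normalized v) B"
    and A0: "0 \<le> A0" "\<And>n m. nrm G0 (T (u n) (v m)) \<le> A0 * (E.J n (u n) * F.J m (v m))"
    and A1: "0 \<le> A1" "\<And>n m. nrm G1 (T (u n) (v m)) \<le> A1 * 2 powi (- (n + m)) * (E.J n (u n) * F.J m (v m))"
begin

abbreviation conv :: "int \<Rightarrow> real" where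
  "conv k \<equiv> \<Sum>\<^sub>\<infinity>n. E.normalized u n * F.normalized v (k - n)"

text \<open>The index pairs \<open>(n, k - n)\<close> inside the square of side
  \<open>{- int L..int L}\<close>, that is, the part with \<open>n + m = k\<close> of the expanded
  product of the two symmetric partial sums.\<close>

abbreviation diagonal :: "nat \<Rightarrow> int \<Rightarrow> int set" where
  "diagonal L k \<equiv> {n \<in> {- int L..int L}. k - n \<in> {- int L..int L}}"

lemma finite_diagonal: "finite (diagonal L k)"
  by (rule finite_subset[of _ "{- int L..int L}"]) auto

lemma mem: "u n \<in> pts E0" "u n \<in> pts E1" "v n \<in> pts F0" "v n \<in> pts F1"
  using E.J_reps_mem[OF x(2)] F.J_reps_mem[OF y(2)] by auto

lemma mem_S: "u n \<in> pts E.S" "v n \<in> pts F.S"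
  using E.J_reps_mem[OF x(2)] F.J_reps_mem[OF y(2)] by (auto intro: E.in_sum_space F.in_sum_space)

lemma normalized_nonneg: "0 \<le> E.normalized u n" "0 \<le> F.normalized v n"
  using mem E.J_nonneg F.J_nonneg by (auto intro!: divide_nonneg_pos)

lemma conv_lq_le: "lq_le r conv (A * B)"
  and conv_summable: "(\<lambda>n. E.normalized u n * F.normalized v (k - n)) summable_on UNIV"
  using lq_le_convolution[OF E.q F.q G.q exponents, of "E.normalized u" "F.normalized v"]
    normalized_nonneg x y by blast+

lemma conv_nonneg: "0 \<le> conv k"
  using normalized_nonneg by (intro infsum_nonneg mult_nonneg_nonneg)

lemma sum_J_product_le:
  assumes "finite I"
  shows "(\<Sum>n\<in>I. E.J n (u n) * F.J (k - n) (v (k - n))) \<le> \<rho> (2 powi k) * conv k"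
proof -
  have "(\<Sum>n\<in>I. E.J n (u n) * F.J (k - n) (v (k - n)))
      \<le> (\<Sum>n\<in>I. \<rho> (2 powi k) * (E.normalized u n * F.normalized v (k - n)))"
  proof (rule sum_mono)
    fix n
    show "E.J n (u n) * F.J (k - n) (v (k - n)) \<le> \<rho> (2 powi k) * (E.normalized u n * F.normalized v (k - n))"
      using J_product_le[OF x(3,4) y(3,4) mem(1,3), of n "k - n"] by simp
  qed
  also have "\<dots> = \<rho> (2 powi k) * (\<Sum>n\<in>I. E.normalized u n * F.normalized v (k - n))"
    by (simp only: sum_distrib_left)
  also have "\<dots> \<le> \<rho> (2 powi k) * conv k"
    using normalized_nonneg less_imp_le[OF F.f_pos'[of k]] assms
    by (intro mult_left_mono finite_sum_le_infsum conv_summable mult_nonneg_nonneg) auto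
  finally show ?thesis .
qed

text \<open>On an antidiagonal the products of the \<open>J\<close> values sum to at most
  \<open>\<rho> (2 powi k) * conv k\<close>, so the series converges absolutely in \<open>G0\<close>
  and, with its own constant, in \<open>G1\<close>. Both limits are limits of the same partial sums
  in \<open>G.S\<close>, hence equal, and lie in the intersection.\<close>

lemma diagonal_limit:
  obtains w where "w \<in> pts G0 \<inter> pts G1"
    "(\<lambda>L. nrm G0 ((\<Sum>n\<in>diagonal L k. T (u n) (v (k - n))) - w)) \<longlonglongrightarrow> 0"
    "nrm G0 w \<le> A0 * (\<rho> (2 powi k) * conv k)"
    "nrm G1 w \<le> A1 * 2 powi (- k) * (\<rho> (2 powi k) * conv k)"
proof -
  let ?z = "\<lambda>n. T (u n) (v (k - n))"
  let ?JJ = "\<lambda>n. E.J n (u n) * F.J (k - n) (v (k - n))"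
  have z: "?z n \<in> pts G0" "?z n \<in> pts G1" for n
    using mem by (auto intro: bounded_bilinear_mapD(1)[OF T0_bounded] bounded_bilinear_mapD(1)[OF T1_bounded])
  obtain l0 where l0: "l0 \<in> pts G0" "(\<lambda>L. nrm G0 (sum ?z (diagonal L k) - l0)) \<longlonglongrightarrow> 0"
    "nrm G0 l0 \<le> A0 * (\<rho> (2 powi k) * conv k)"
  proof (rule banach_space_series[OF banach_couple_normed(3)[OF G.couple], of ?z "\<lambda>L. diagonal L k"
        "\<lambda>n. A0 * ?JJ n" "A0 * (\<rho> (2 powi k) * conv k)"])
    show "nrm G0 (?z n) \<le> A0 * ?JJ n" for n by (rule A0)
    show "(\<Sum>n\<in>diagonal L k. A0 * ?JJ n) \<le> A0 * (\<rho> (2 powi k) * conv k)" for L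
      unfolding sum_distrib_left[symmetric] by (intro mult_left_mono A0 sum_J_product_le finite_diagonal)
  qed (use z finite_diagonal in auto)
  obtain l1 where l1: "l1 \<in> pts G1" "(\<lambda>L. nrm G1 (sum ?z (diagonal L k) - l1)) \<longlonglongrightarrow> 0"
    "nrm G1 l1 \<le> A1 * 2 powi (- k) * (\<rho> (2 powi k) * conv k)"
  proof (rule banach_space_series[OF banach_couple_normed(4)[OF G.couple], of ?z "\<lambda>L. diagonal L k"
        "\<lambda>n. A1 * 2 powi (- k) * ?JJ n" "A1 * 2 powi (- k) * (\<rho> (2 powi k) * conv k)"])
    show "nrm G1 (?z n) \<le> A1 * 2 powi (- k) * ?JJ n" for n using A1(2)[of n "k - n"] by simp
    show "(\<Sum>n\<in>diagonal L k. A1 * 2 powi (- k) * ?JJ n) \<le> A1 * 2 powi (- k) * (\<rho> (2 powi k) * conv k)" for L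
      unfolding sum_distrib_left[symmetric] by (intro mult_left_mono mult_nonneg_nonneg A1 sum_J_product_le finite_diagonal) auto
  qed (use z finite_diagonal in auto)
  have l01: "l0 \<in> pts G.S" "l1 \<in> pts G.S" using l0 l1 G.S_left G.S_right by auto
  have "nrm G.S (l0 - l1) \<le> nrm G0 (sum ?z (diagonal L k) - l0) + nrm G1 (sum ?z (diagonal L k) - l1)" for L
  proof -
    let ?s = "sum ?z (diagonal L k)"
    have s: "?s - l0 \<in> pts G0" "?s - l1 \<in> pts G1"
      using z l0 l1 by (auto intro!: normed_space_mem(3)[OF G.X0] normed_space_mem(3)[OF G.X1]
          normed_space_mem(6)[OF G.X0] normed_space_mem(6)[OF G.X1])
    have "nrm G.S (l0 - l1) = nrm G.S ((?s - l1) - (?s - l0))" by simp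
    also have "\<dots> \<le> nrm G.S (?s - l1) + nrm G.S (?s - l0)"
      using s G.S_left(1) G.S_right(1) by (intro normed_space_triangle_minus[OF G.S]) auto
    finally show ?thesis using G.S_left(2)[OF s(1)] G.S_right(2)[OF s(2)] by simp
  qed
  then have "nrm G.S (l0 - l1) \<le> 0 + 0"
    by (intro tendsto_lowerbound[OF tendsto_add[OF l0(2) l1(2)]]) auto
  moreover have m: "l0 - l1 \<in> pts G.S" using l01 by (rule normed_space_mem(3)[OF G.S])
  ultimately have "l0 = l1"
    using normed_space_nonneg[OF G.S m] normed_space_eq_0[OF G.S m] by simp
  then show ?thesis using that l0 l1 by blast
qed

text \<open>The unshifted sequence, belonging to \<open>n + m = k\<close>; the shift is applied only
  in \<open>main_estimate\<close>.\<close>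

definition w where
  "w k = (SOME w. w \<in> pts G0 \<inter> pts G1 \<and>
    (\<lambda>L. nrm G0 ((\<Sum>n\<in>diagonal L k. T (u n) (v (k - n))) - w)) \<longlonglongrightarrow> 0 \<and>
    nrm G0 w \<le> A0 * (\<rho> (2 powi k) * conv k) \<and>
    nrm G1 w \<le> A1 * 2 powi (- k) * (\<rho> (2 powi k) * conv k))"

lemma w_all: "w k \<in> pts G0 \<inter> pts G1 \<and>
    (\<lambda>L. nrm G0 ((\<Sum>n\<in>diagonal L k. T (u n) (v (k - n))) - w k)) \<longlonglongrightarrow> 0 \<and>
    nrm G0 (w k) \<le> A0 * (\<rho> (2 powi k) * conv k) \<and>
    nrm G1 (w k) \<le> A1 * 2 powi (- k) * (\<rho> (2 powi k) * conv k)"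
  unfolding w_def by (rule someI_ex) (use diagonal_limit[of k] in blast)

lemmas w = w_all[THEN conjunct1] w_all[THEN conjunct2, THEN conjunct1]
  w_all[THEN conjunct2, THEN conjunct2, THEN conjunct1] w_all[THEN conjunct2, THEN conjunct2, THEN conjunct2]

text \<open>A pair whose sum lies outside \<open>{- 2 * int N..2 * int N}\<close> has one index
  outside \<open>{- int N..int N}\<close>. The omitted part of the square is therefore bounded by
  two products, each with a tail of an absolutely convergent series as a factor. The bound does not
  depend on \<open>L\<close>, which permits letting \<open>L\<close> tend to infinity for fixed
  \<open>K\<close>.\<close>

lemma off_diagonal_small:
  assumes "e > 0"
  obtains N :: nat where "\<And>K L. {- 2 * int N..2 * int N} \<subseteq> K \<Longrightarrow>
    (\<Sum>(n, m)\<in>{- int L..int L} \<times> {- int L..int L} - {(n, m). n + m \<in> K}. nrm G.S (T (u n) (v m))) \<le> e"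
proof -
  let ?a = "\<lambda>n. nrm E.S (u n)" and ?b = "\<lambda>n. nrm F.S (v n)"
  have a: "0 \<le> ?a n" "?a n \<le> E.h n * A" and b: "0 \<le> ?b n" "?b n \<le> F.h n * B" for n
    using normed_space_nonneg[OF E.S mem_S(1)] normed_space_nonneg[OF F.S mem_S(2)]
      E.S_le_h[OF x(3,4)] F.S_le_h[OF y(3,4)] mem by auto
  obtain C where C: "C > 0"
    "\<And>x y. x \<in> pts E.S \<Longrightarrow> y \<in> pts F.S \<Longrightarrow> nrm G.S (T x y) \<le> C * (nrm E.S x * nrm F.S y)"
    using bounded_bilinear_map_bound[OF T_sum E.S F.S] by blast
  define HE HF where "HE = infsum E.h UNIV" and "HF = infsum F.h UNIV"
  have H: "0 \<le> HE" "0 \<le> HF"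
    unfolding HE_def HF_def by (intro infsum_nonneg E.h_nonneg F.h_nonneg)+
  \<comment> \<open>Chosen so that the two products, \<open>C * (A * B) * (HE + HF) * e'\<close>
    together, are at most \<open>e\<close>; the added 1 keeps the denominator positive.\<close>
  define e' where "e' = e / (C * (A * B) * (HE + HF) + 1)"
  have den: "C * (A * B) * (HE + HF) + 1 > 0"
    using C x(3) y(3) H by (intro add_nonneg_pos mult_nonneg_nonneg) auto
  then have e': "e' > 0" using assms by (simp add: e'_def)
  obtain NE where NE: "\<And>I. finite I \<Longrightarrow> I \<inter> {- int NE..int NE} = {} \<Longrightarrow> sum E.h I < e'"
    using E.sum_h_tail[OF e'] by blast
  obtain NF where NF: "\<And>I. finite I \<Longrightarrow> I \<inter> {- int NF..int NF} = {} \<Longrightarrow> sum F.h I < e'"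
    using F.sum_h_tail[OF e'] by blast
  have suma: "sum ?a I \<le> sum E.h I * A" for I
    unfolding sum_distrib_right by (intro sum_mono a)
  have sumb: "sum ?b I \<le> sum F.h I * B" for I
    unfolding sum_distrib_right by (intro sum_mono b)
  define N where "N = max NE NF"
  show ?thesis
  proof (rule that[of N])
    fix K :: "int set" and L :: nat
    assume K: "{- 2 * int N..2 * int N} \<subseteq> K"
    let ?I = "{- int L..int L}" and ?D = "{- int L..int L} - {- int N..int N}"
    have "?I \<times> ?I - {(n, m). n + m \<in> K} \<subseteq> ?D \<times> ?I \<union> ?I \<times> ?D"
    proof (intro subrelI)
      fix n m assume nm: "(n, m) \<in> ?I \<times> ?I - {(n, m). n + m \<in> K}"
      then have "n + m \<notin> {- 2 * int N..2 * int N}" using K by auto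
      then have "n \<notin> {- int N..int N} \<or> m \<notin> {- int N..int N}" by auto
      then show "(n, m) \<in> ?D \<times> ?I \<union> ?I \<times> ?D" using nm by blast
    qed
    then have "(\<Sum>(n, m)\<in>?I \<times> ?I - {(n, m). n + m \<in> K}. nrm G.S (T (u n) (v m)))
        \<le> (\<Sum>(n, m)\<in>?D \<times> ?I \<union> ?I \<times> ?D. C * (?a n * ?b m))"
      using a b C mem_S
      by (intro order_trans[OF sum_mono sum_mono2]) (auto intro!: C(2) mult_nonneg_nonneg)
    also have "\<dots> \<le> (\<Sum>(n, m)\<in>?D \<times> ?I. C * (?a n * ?b m)) + (\<Sum>(n, m)\<in>?I \<times> ?D. C * (?a n * ?b m))"
    proof -
      have "0 \<le> (\<Sum>(n, m)\<in>?D \<times> ?I \<inter> ?I \<times> ?D. C * (?a n * ?b m))"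
        using a b C by (intro sum_nonneg) auto
      then show ?thesis
        using sum.union_inter[of "?D \<times> ?I" "?I \<times> ?D" "\<lambda>(n, m). C * (?a n * ?b m)"] by simp
    qed
    also have "\<dots> = C * (sum ?a ?D * sum ?b ?I) + C * (sum ?a ?I * sum ?b ?D)"
    proof -
      have "(\<Sum>(n, m)\<in>X \<times> Z. C * (?a n * ?b m)) = C * (sum ?a X * sum ?b Z)" for X Z
      proof -
        have "sum ?a X * sum ?b Z = (\<Sum>(n, m)\<in>X \<times> Z. ?a n * ?b m)"
          by (simp add: sum_product sum.cartesian_product)
        then show ?thesis by (simp add: sum_distrib_left case_prod_unfold)
      qed
      then show ?thesis by (simp only:)
    qed
    also have "\<dots> \<le> C * ((e' * A) * (HF * B)) + C * ((HE * A) * (e' * B))"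
    proof -
      have D: "sum E.h ?D \<le> e'" "sum F.h ?D \<le> e'"
        by (rule less_imp_le[OF NE], simp, force simp: N_def) (rule less_imp_le[OF NF], simp, force simp: N_def)
      have I: "sum E.h ?I \<le> HE" "sum F.h ?I \<le> HF"
        unfolding HE_def HF_def
        by (intro finite_sum_le_infsum E.weights E.h_nonneg finite_atLeastAtMost_int subset_UNIV)
          (intro finite_sum_le_infsum F.weights F.h_nonneg finite_atLeastAtMost_int subset_UNIV)
      have "sum ?a ?D \<le> e' * A" "sum ?a ?I \<le> HE * A"
        using D I by (auto intro: order_trans[OF suma mult_right_mono[OF _ x(3)]])
      moreover have "sum ?b ?D \<le> e' * B" "sum ?b ?I \<le> HF * B"
        using D I by (auto intro: order_trans[OF sumb mult_right_mono[OF _ y(3)]])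
      moreover have "0 \<le> sum ?b ?I" "0 \<le> sum ?b ?D" using b by (auto intro: sum_nonneg)
      moreover have "0 \<le> e' * A" "0 \<le> HE * A" using e' x(3) H by simp_all
      ultimately show ?thesis
        using less_imp_le[OF C(1)] by (intro add_mono mult_left_mono mult_mono)
    qed
    also have "\<dots> = e' * (C * (A * B) * (HE + HF))" by (simp add: algebra_simps)
    also have "\<dots> \<le> e' * (C * (A * B) * (HE + HF) + 1)" using e' by (intro mult_left_mono) auto
    also have "\<dots> = e" using den by (simp add: e'_def)
    finally show "(\<Sum>(n, m)\<in>?I \<times> ?I - {(n, m). n + m \<in> K}. nrm G.S (T (u n) (v m))) \<le> e" .
  qed
qed

lemma T_mem: "T x y \<in> pts G.S" "T (u n) (v m) \<in> pts G.S"
  using x y mem_S by (auto intro: bounded_bilinear_mapD(1)[OF T_sum])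

lemma square_split:
  assumes "finite K"
  shows "T (sum u {- int L..int L}) (sum v {- int L..int L})
    = (\<Sum>k\<in>K. \<Sum>n\<in>diagonal L k. T (u n) (v (k - n)))
      + (\<Sum>(n, m)\<in>{- int L..int L} \<times> {- int L..int L} - {(n, m). n + m \<in> K}. T (u n) (v m))"
proof -
  let ?I = "{- int L..int L}"
  let ?P = "{(n, m). n + m \<in> K}"
  have "T (sum u ?I) (sum v ?I) = (\<Sum>(n, m)\<in>?I \<times> ?I. T (u n) (v m))"
    using bounded_bilinear_map_sum[OF T_sum E.S F.S mem_S] by (simp add: sum.cartesian_product)
  also have "\<dots> = (\<Sum>(n, m)\<in>(?I \<times> ?I) \<inter> ?P. T (u n) (v m)) + (\<Sum>(n, m)\<in>?I \<times> ?I - ?P. T (u n) (v m))"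
    by (rule sum.Int_Diff) simp
  also have "(\<Sum>(n, m)\<in>(?I \<times> ?I) \<inter> ?P. T (u n) (v m))
      = (\<Sum>(k, n)\<in>(SIGMA k:K. diagonal L k). T (u n) (v (k - n)))"
    by (rule sum.reindex_bij_witness[where i = "\<lambda>(k, n). (n, k - n)" and j = "\<lambda>(n, m). (n + m, n)"]) auto
  also have "\<dots> = (\<Sum>k\<in>K. \<Sum>n\<in>diagonal L k. T (u n) (v (k - n)))"
    using assms finite_diagonal by (intro sum.Sigma[symmetric]) blast+
  finally show ?thesis .
qed

text \<open>With \<open>K\<close> fixed, \<open>L\<close> tends to infinity: the product of the
  partial sums tends to \<open>T x y\<close> by boundedness on the sum spaces, the finitely many
  antidiagonals in \<open>K\<close> tend to their \<open>w k\<close>, and the rest of the square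
  stays below \<open>e\<close> uniformly in \<open>L\<close>.\<close>

lemma w_sums:
  assumes "e > 0"
  obtains N :: nat where "\<And>K. finite K \<Longrightarrow> {- 2 * int N..2 * int N} \<subseteq> K \<Longrightarrow> nrm G.S (T x y - sum w K) \<le> e"
proof -
  obtain N where N: "\<And>K L. {- 2 * int N..2 * int N} \<subseteq> K \<Longrightarrow>
    (\<Sum>(n, m)\<in>{- int L..int L} \<times> {- int L..int L} - {(n, m). n + m \<in> K}. nrm G.S (T (u n) (v m))) \<le> e"
    using off_diagonal_small[OF assms] by blast
  show ?thesis
  proof (rule that[of N])
    fix K :: "int set" assume K: "finite K" "{- 2 * int N..2 * int N} \<subseteq> K"
    define U V where "U = (\<lambda>L. sum u {- int L..int L})" and "V = (\<lambda>L. sum v {- int L..int L})"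
    define g where "g = (\<lambda>L k. \<Sum>n\<in>diagonal L k. T (u n) (v (k - n)))"
    define R where "R = (\<lambda>L. \<Sum>(n, m)\<in>{- int L..int L} \<times> {- int L..int L} - {(n, m). n + m \<in> K}. T (u n) (v m))"
    have UV: "U L \<in> pts E.S" "V L \<in> pts F.S" for L
      unfolding U_def V_def by (intro normed_space_mem(6)[OF E.S] normed_space_mem(6)[OF F.S] mem_S)+
    have "(\<lambda>L. nrm E.S (x - U L)) \<longlonglongrightarrow> 0"
    proof (rule LIMSEQ_I)
      fix e :: real assume "e > 0"
      then obtain L where "\<And>M N. M \<ge> L \<Longrightarrow> N \<ge> L \<Longrightarrow> nrm E.S (x - (\<Sum>n\<in>{- int M..int N}. u n)) < e"
        using E.J_reps_approx[OF x(1,2)] by blast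
      then show "\<exists>L. \<forall>M\<ge>L. norm (nrm E.S (x - U M) - 0) < e"
        using normed_space_nonneg[OF E.S normed_space_mem(3)[OF E.S x(1) UV(1)]] by (auto simp: U_def)
    qed
    moreover have "(\<lambda>L. nrm F.S (y - V L)) \<longlonglongrightarrow> 0"
    proof (rule LIMSEQ_I)
      fix e :: real assume "e > 0"
      then obtain L where "\<And>M N. M \<ge> L \<Longrightarrow> N \<ge> L \<Longrightarrow> nrm F.S (y - (\<Sum>n\<in>{- int M..int N}. v n)) < e"
        using F.J_reps_approx[OF y(1,2)] by blast
      then show "\<exists>L. \<forall>M\<ge>L. norm (nrm F.S (y - V M) - 0) < e"
        using normed_space_nonneg[OF F.S normed_space_mem(3)[OF F.S y(1) UV(2)]] by (auto simp: V_def)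
    qed
    ultimately have lim: "(\<lambda>L. nrm G.S (T x y - T (U L) (V L))) \<longlonglongrightarrow> 0"
      by (intro bounded_bilinear_map_tendsto[OF T_sum E.S F.S G.S x(1) y(1) UV])
    have zG0: "T (u n) (v m) \<in> pts G0" for n m using mem by (intro bounded_bilinear_mapD(1)[OF T0_bounded])
    have gw: "g L k - w k \<in> pts G0" for L k
      unfolding g_def using w(1) zG0 by (intro normed_space_mem(3)[OF G.X0] normed_space_mem(6)[OF G.X0]) auto
    have sgw: "(\<Sum>k\<in>K. g L k - w k) \<in> pts G.S" for L
      by (intro normed_space_mem(6)[OF G.S] G.S_left(1) gw)
    have RS: "R L \<in> pts G.S" for L
      unfolding R_def using T_mem by (intro normed_space_mem(6)[OF G.S]) auto
    have TUV: "T (U L) (V L) \<in> pts G.S" for L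
      by (intro bounded_bilinear_mapD(1)[OF T_sum] UV)
    have bound: "nrm G.S (T x y - sum w K)
        \<le> nrm G.S (T x y - T (U L) (V L)) + (\<Sum>k\<in>K. nrm G0 (g L k - w k)) + e" for L
    proof -
      have "T (U L) (V L) = sum (g L) K + R L"
        unfolding U_def V_def g_def R_def by (rule square_split[OF K(1)])
      then have "T x y - sum w K = ((T x y - T (U L) (V L)) + (\<Sum>k\<in>K. g L k - w k)) + R L"
        by (simp add: sum_subtractf algebra_simps)
      also have "nrm G.S \<dots> \<le> nrm G.S ((T x y - T (U L) (V L)) + (\<Sum>k\<in>K. g L k - w k)) + nrm G.S (R L)"
        by (intro normed_space_triangle[OF G.S] normed_space_mem(2)[OF G.S _ sgw] normed_space_mem(3)[OF G.S]
            T_mem TUV RS)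
      also have "nrm G.S ((T x y - T (U L) (V L)) + (\<Sum>k\<in>K. g L k - w k))
          \<le> nrm G.S (T x y - T (U L) (V L)) + nrm G.S (\<Sum>k\<in>K. g L k - w k)"
        by (intro normed_space_triangle[OF G.S _ sgw] normed_space_mem(3)[OF G.S] T_mem TUV)
      also have "nrm G.S (\<Sum>k\<in>K. g L k - w k) \<le> (\<Sum>k\<in>K. nrm G.S (g L k - w k))"
        by (intro normed_space_sum[OF G.S] G.S_left(1) gw)
      also have "\<dots> \<le> (\<Sum>k\<in>K. nrm G0 (g L k - w k))"
        by (intro sum_mono G.S_left gw)
      also have "nrm G.S (R L) \<le> (\<Sum>(n, m)\<in>{- int L..int L} \<times> {- int L..int L} - {(n, m). n + m \<in> K}. nrm G.S (T (u n) (v m)))"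
        unfolding R_def case_prod_unfold by (intro normed_space_sum[OF G.S] T_mem)
      also have "\<dots> \<le> e" by (rule N[OF K(2)])
      finally show ?thesis by simp
    qed
    have "(\<lambda>L. nrm G.S (T x y - T (U L) (V L)) + (\<Sum>k\<in>K. nrm G0 (g L k - w k)) + e)
        \<longlonglongrightarrow> 0 + (\<Sum>k\<in>K. 0) + e"
      unfolding g_def by (intro tendsto_add tendsto_sum tendsto_const lim w(2))
    then show "nrm G.S (T x y - sum w K) \<le> e"
      using tendsto_lowerbound[of _ "0 + (\<Sum>k\<in>K. 0) + e"] bound by fastforce
  qed
qed

text \<open>The representation is \<open>w (k + s)\<close>. In \<open>G0\<close> this costs nothing;
  in \<open>G1\<close> the factor \<open>2 powi k * 2 powi (- (k + s))\<close> leaves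
  \<open>2 powi (- s) * A1\<close>. Moving the weight from \<open>2 powi (k + s)\<close> to
  \<open>2 powi k\<close> costs \<open>dil \<rho> (2 powi s)\<close>, and the shifted convolution
  obeys Young's bound \<open>A * B\<close>. The free \<open>s\<close> allows an \<open>A1\<close>
  that is not small to be offset (\<open>s > 0\<close>), or likewise an \<open>A0\<close>
  (\<open>s < 0\<close>).\<close>

lemma main_estimate:
  "G.J_le (T x y) (max A0 (2 powi (- s) * A1) * dil \<rho> (2 powi s) * (A * B))"
proof -
  define c where "c = max A0 (2 powi (- s) * A1) * dil \<rho> (2 powi s)"
  have c0: "0 \<le> c" unfolding c_def using A0 dil_powi_pos[of s] by (intro mult_nonneg_nonneg) auto
  define w' where "w' k = w (k + s)" for k
  have w'mem: "w' k \<in> pts G0 \<inter> pts G1" for k using w(1) by (simp add: w'_def)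
  have "w' \<in> J_reps G0 G1 (T x y)"
  proof (subst G.J_reps_iff[OF T_mem(1)], intro conjI allI impI w'mem)
    fix e :: real assume "e > 0"
    then have "e / 2 > 0" by simp
    then obtain N where N: "\<And>K. finite K \<Longrightarrow> {- 2 * int N..2 * int N} \<subseteq> K \<Longrightarrow> nrm G.S (T x y - sum w K) \<le> e / 2"
      using w_sums by blast
    \<comment> \<open>This makes the window \<open>{- int M + s..int L + s}\<close> contain
      \<open>{- 2 * int N..2 * int N}\<close> for either sign of \<open>s\<close>.\<close>
    define L0 where "L0 = 2 * N + nat \<bar>s\<bar>"
    have "nrm G.S (T x y - (\<Sum>n\<in>{- int M..int L}. w' n)) < e" if "M \<ge> L0" "L \<ge> L0" for M L
    proof -
      have "(\<Sum>n\<in>{- int M..int L}. w' n) = sum w ((\<lambda>n. n + s) ` {- int M..int L})"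
        by (subst sum.reindex) (auto simp: w'_def)
      also have "(\<lambda>n. n + s) ` {- int M..int L} = {- int M + s..int L + s}" by simp
      finally have "(\<Sum>n\<in>{- int M..int L}. w' n) = sum w {- int M + s..int L + s}" .
      moreover have "{- 2 * int N..2 * int N} \<subseteq> {- int M + s..int L + s}" using that by (auto simp: L0_def)
      ultimately have "nrm G.S (T x y - (\<Sum>n\<in>{- int M..int L}. w' n)) \<le> e / 2" using N by simp
      then show ?thesis using \<open>e > 0\<close> by linarith
    qed
    then show "\<exists>L. \<forall>M\<ge>L. \<forall>N\<ge>L. nrm G.S (T x y - (\<Sum>n\<in>{- int M..int N}. w' n)) < e" by blast
  qed
  moreover have "lq_le r (G.normalized w') (c * (A * B))"
  proof (rule lq_le_mono[OF G.q])
    have AB: "0 \<le> A * B" using x y by simp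
    show "lq_le r (\<lambda>k. c * conv (k + s)) (c * (A * B))"
      using lq_le_scale[OF G.q AB lq_le_shift[OF conv_lq_le, of s], of c] c0 by simp
    fix k
    have pw: "2 powi k * 2 powi (- (k + s)) = (2::real) powi (- s)"
      by (simp flip: power_int_add)
    let ?m = "max A0 (2 powi (- s) * A1)" and ?q = "\<rho> (2 powi (k + s)) * conv (k + s)"
    have q0: "0 \<le> ?q" using conv_nonneg less_imp_le[OF F.f_pos'] by (intro mult_nonneg_nonneg)
    have "nrm G0 (w' k) \<le> ?m * ?q"
      unfolding w'_def by (rule order_trans[OF w(3) mult_right_mono[OF _ q0]]) simp
    moreover have "2 powi k * nrm G1 (w' k) \<le> ?m * ?q"
    proof -
      have "2 powi k * nrm G1 (w' k) \<le> 2 powi k * (A1 * 2 powi (- (k + s)) * ?q)"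
        unfolding w'_def by (intro mult_left_mono w(4)) auto
      also have "\<dots> = (2 powi k * 2 powi (- (k + s))) * A1 * ?q" by (simp only: ac_simps)
      also have "\<dots> \<le> ?m * ?q" unfolding pw by (intro mult_right_mono q0) simp
      finally show ?thesis .
    qed
    ultimately have "G.J k (w' k) \<le> ?m * ?q" by (simp add: J_fun_def)
    also have "\<dots> \<le> ?m * (dil \<rho> (2 powi s) * \<rho> (2 powi k) * conv (k + s))"
    proof (intro mult_left_mono mult_right_mono conv_nonneg)
      show "\<rho> (2 powi (k + s)) \<le> dil \<rho> (2 powi s) * \<rho> (2 powi k)"
        using param_B_dil[OF \<rho>_B, of "2 powi s" "2 powi k"] by (simp add: power_int_add mult.commute)
    qed (use A0 in auto)
    finally have "G.J k (w' k) \<le> \<rho> (2 powi k) * (c * conv (k + s))" by (simp add: c_def ac_simps)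
    then have "G.normalized w' k \<le> c * conv (k + s)"
      using G.f_pos'[of k] by (simp add: divide_le_eq mult.commute)
    moreover have "0 \<le> G.normalized w' k"
      using G.J_nonneg w'mem by (auto intro!: divide_nonneg_pos)
    ultimately show "\<bar>G.normalized w' k\<bar> \<le> \<bar>c * conv (k + s)\<bar>" by linarith
  qed
  ultimately show ?thesis unfolding G.J_le_def c_def by blast
qed

end

end

section \<open>Interpolation of compactness\<close>

lemma powi_minus_add: "(2::real) powi (- (n + m)) = 2 powi (- n) * 2 powi (- m)"
  by (subst power_int_add[symmetric]) auto

context bilinear_interpolation
begin

section \<open>Boundedness on the interpolation spaces and smallness of the tails\<close>

lemma T_bound_J:
  obtains C where "C > 0"
    "\<And>n m x y. \<lbrakk>x \<in> pts E0 \<inter> pts E1; y \<in> pts F0 \<inter> pts F1\<rbrakk> \<Longrightarrow> nrm G0 (T x y) \<le> C * (E.J n x * F.J m y)"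
    "\<And>n m x y. \<lbrakk>x \<in> pts E0 \<inter> pts E1; y \<in> pts F0 \<inter> pts F1\<rbrakk> \<Longrightarrow>
      nrm G1 (T x y) \<le> C * 2 powi (- (n + m)) * (E.J n x * F.J m y)"
proof -
  obtain C0 where C0: "C0 > 0"
    "\<And>x y. x \<in> pts E0 \<Longrightarrow> y \<in> pts F0 \<Longrightarrow> nrm G0 (T x y) \<le> C0 * (nrm E0 x * nrm F0 y)"
    using bounded_bilinear_map_bound[OF T0_bounded E.X0 F.X0] by blast
  obtain C1 where C1: "C1 > 0"
    "\<And>x y. x \<in> pts E1 \<Longrightarrow> y \<in> pts F1 \<Longrightarrow> nrm G1 (T x y) \<le> C1 * (nrm E1 x * nrm F1 y)"
    using bounded_bilinear_map_bound[OF T1_bounded E.X1 F.X1] by blast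
  show ?thesis
  proof (rule that[of "max C0 C1"])
    show "max C0 C1 > 0" using C0 by simp
    fix n m x y assume x: "x \<in> pts E0 \<inter> pts E1" and y: "y \<in> pts F0 \<inter> pts F1"
    have nn: "0 \<le> nrm F0 y" "0 \<le> nrm F1 y" "0 \<le> E.J n x" "0 \<le> F.J m y"
      using x y normed_space_nonneg[OF F.X0] normed_space_nonneg[OF F.X1] E.J_nonneg F.J_nonneg by auto
    have "nrm G0 (T x y) \<le> C0 * (nrm E0 x * nrm F0 y)" using x y by (intro C0) auto
    also have "\<dots> \<le> max C0 C1 * (E.J n x * F.J m y)"
      using nn C0(1) normed_space_nonneg[OF E.X0, of x] x
      by (intro mult_mono E.nrm0_le_J F.nrm0_le_J mult_nonneg_nonneg) auto
    finally show "nrm G0 (T x y) \<le> max C0 C1 * (E.J n x * F.J m y)" .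
    have "nrm G1 (T x y) \<le> C1 * (nrm E1 x * nrm F1 y)" using x y by (intro C1) auto
    also have "\<dots> \<le> max C0 C1 * ((2 powi (- n) * E.J n x) * (2 powi (- m) * F.J m y))"
      using nn C1(1) normed_space_nonneg[OF E.X1, of x] x
      by (intro mult_mono E.nrm1_le_J F.nrm1_le_J mult_nonneg_nonneg) auto
    also have "\<dots> = max C0 C1 * 2 powi (- (n + m)) * (E.J n x * F.J m y)"
      by (simp only: powi_minus_add ac_simps)
    finally show "nrm G1 (T x y) \<le> max C0 C1 * 2 powi (- (n + m)) * (E.J n x * F.J m y)" .
  qed
qed

text \<open>The shift 0 suffices, since the crude constant is used at both endpoints.\<close>

lemma T_interp_bound:
  obtains C where "C > 0"
    "\<And>x y A B. \<lbrakk>x \<in> pts E.S; 0 \<le> A; E.J_le x A; y \<in> pts F.S; 0 \<le> B; F.J_le y B\<rbrakk> \<Longrightarrow> G.J_le (T x y) (C * (A * B))"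
proof -
  obtain C where C: "C > 0"
    "\<And>n m x y. \<lbrakk>x \<in> pts E0 \<inter> pts E1; y \<in> pts F0 \<inter> pts F1\<rbrakk> \<Longrightarrow> nrm G0 (T x y) \<le> C * (E.J n x * F.J m y)"
    "\<And>n m x y. \<lbrakk>x \<in> pts E0 \<inter> pts E1; y \<in> pts F0 \<inter> pts F1\<rbrakk> \<Longrightarrow>
      nrm G1 (T x y) \<le> C * 2 powi (- (n + m)) * (E.J n x * F.J m y)"
    using T_bound_J by blast
  show ?thesis
  proof (rule that[of "max C (2 powi (- 0) * C) * dil \<rho> (2 powi 0)"])
    show "max C (2 powi (- 0) * C) * dil \<rho> (2 powi 0) > 0" using C(1) dil_powi_pos[of 0] by simp
    fix x y A B
    assume *: "x \<in> pts E.S" "0 \<le> A" "E.J_le x A" "y \<in> pts F.S" "0 \<le> B" "F.J_le y B"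
    obtain u where u: "u \<in> J_reps E0 E1 x" "lq_le p (E.normalized u) A" using * by (auto simp: E.J_le_def)
    obtain v where v: "v \<in> J_reps F0 F1 y" "lq_le q (F.normalized v) B" using * by (auto simp: F.J_le_def)
    show "G.J_le (T x y) (max C (2 powi (- 0) * C) * dil \<rho> (2 powi 0) * (A * B))"
      using C(1) by (intro main_estimate[of x u A y v B C C 0] * u v C E.J_reps_mem[OF u(1)] F.J_reps_mem[OF v(1)]) auto
  qed
qed

lemma T_interp_bounded: "bounded_bilinear_map E.Y F.Y G.Y T"
proof -
  obtain C where C: "C > 0"
    "\<And>x y A B. \<lbrakk>x \<in> pts E.S; 0 \<le> A; E.J_le x A; y \<in> pts F.S; 0 \<le> B; F.J_le y B\<rbrakk> \<Longrightarrow> G.J_le (T x y) (C * (A * B))"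
    using T_interp_bound by blast
  have J: "T x y \<in> pts G.Y \<and> nrm G.Y (T x y) \<le> C * ((nrm E.Y x + e) * (nrm F.Y y + e))"
    if x: "x \<in> pts E.Y" and y: "y \<in> pts F.Y" and "e > 0" for x y e
  proof -
    have p: "0 \<le> nrm E.Y x + e" "0 \<le> nrm F.Y y + e"
      using E.interp_space_nonneg[of x] F.interp_space_nonneg[of y] \<open>e > 0\<close> by linarith+
    have "G.J_le (T x y) (C * ((nrm E.Y x + e) * (nrm F.Y y + e)))"
      using \<open>e > 0\<close> by (intro C p E.interp_space_mem F.interp_space_mem E.interp_space_J_le
          F.interp_space_J_le x y) auto
    moreover have "0 \<le> C * ((nrm E.Y x + e) * (nrm F.Y y + e))" using C p by simp
    moreover have "T x y \<in> pts G.S"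
      by (intro bounded_bilinear_mapD(1)[OF T_sum] E.interp_space_mem F.interp_space_mem x y)
    ultimately show ?thesis using G.interp_space_memI by blast
  qed
  have "nrm G.Y (T x y) \<le> C * nrm E.Y x * nrm F.Y y" if xy: "x \<in> pts E.Y" "y \<in> pts F.Y" for x y
  proof -
    \<comment> \<open>The norms are infima, so representations are available only with a slack
      \<open>e\<close>, which is now sent to 0.\<close>
    have "((\<lambda>e. C * ((nrm E.Y x + e) * (nrm F.Y y + e))) \<longlongrightarrow> C * ((nrm E.Y x + 0) * (nrm F.Y y + 0))) (at_right 0)"
      by (intro tendsto_intros)
    then have "nrm G.Y (T x y) \<le> C * ((nrm E.Y x + 0) * (nrm F.Y y + 0))"
    proof (rule tendsto_lowerbound)
      show "\<forall>\<^sub>F e in at_right 0. nrm G.Y (T x y) \<le> C * ((nrm E.Y x + e) * (nrm F.Y y + e))"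
        using J[OF xy] by (auto simp: eventually_at_right_less intro: eventually_at_rightI[of 0 1])
    qed simp
    then show ?thesis by (simp add: mult.assoc)
  qed
  moreover have "T x y \<in> pts G.Y" if "x \<in> pts E.Y" "y \<in> pts F.Y" for x y
    using J[OF that, of 1] by simp
  moreover note bounded_bilinear_mapD(2-5)[OF T_sum]
  ultimately show ?thesis
    unfolding bounded_bilinear_map_def using E.interp_space_mem F.interp_space_mem by meson
qed

text \<open>Relative to \<open>E.J n x\<close> the norm of \<open>x\<close> in \<open>E.S\<close> is
  at most \<open>2 powi (- n)\<close>, and likewise for \<open>y\<close>. One large index makes the
  product of the two small, so \<open>compact_bilinear_small\<close> applies with the
  \<open>J\<close> values as \<open>a\<close> and \<open>b\<close>.\<close>

lemma T_small_high:
  assumes "\<delta> > 0"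
  obtains N :: nat where
    "\<And>n m x y. \<lbrakk>x \<in> pts E0 \<inter> pts E1; y \<in> pts F0 \<inter> pts F1; int N < n \<or> int N < m\<rbrakk>
      \<Longrightarrow> nrm G0 (T x y) \<le> \<delta> * (E.J n x * F.J m y)"
proof -
  obtain \<eta> where \<eta>: "\<eta> > 0"
    "\<And>x y a b. \<lbrakk>x \<in> pts E0; y \<in> pts F0; nrm E0 x \<le> a; nrm F0 y \<le> b; nrm E.S x * nrm F.S y \<le> \<eta> * (a * b)\<rbrakk>
      \<Longrightarrow> nrm G0 (T x y) \<le> \<delta> * (a * b)"
    by (rule compact_bilinear_small[OF T0 T_sum E.X0 E.S subsetI[OF E.S_left(1)] F.X0 F.S
          subsetI[OF F.S_left(1)] banach_couple_normed(3)[OF G.couple] G.S subsetI[OF G.S_left(1)]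
          G.S_left(2) \<open>\<delta> > 0\<close>]) blast+
  obtain N :: nat where N: "(1 / 2) ^ N < \<eta>"
    using real_arch_pow_inv[OF \<eta>(1), of "1 / 2"] by auto
  have pw: "2 powi (- n) \<le> \<eta>" if "int N < n" for n
  proof -
    have "2 powi (- n) \<le> (2::real) powi (- int N)" using that by (intro power_int_increasing) auto
    also have "\<dots> = (1 / 2) ^ N" by (simp add: power_int_minus power_divide inverse_eq_divide)
    finally show ?thesis using N by simp
  qed
  show ?thesis
  proof (rule that[of N])
    fix n m x y
    assume x: "x \<in> pts E0 \<inter> pts E1" and y: "y \<in> pts F0 \<inter> pts F1" and nm: "int N < n \<or> int N < m"
    have nn: "0 \<le> E.J n x" "0 \<le> F.J m y" "0 \<le> nrm F.S y" "0 \<le> nrm E.S x"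
      using x y E.J_nonneg F.J_nonneg normed_space_nonneg[OF F.S F.in_sum_space]
        normed_space_nonneg[OF E.S E.in_sum_space] by auto
    have le: "nrm E.S x \<le> min 1 (2 powi (- n)) * E.J n x" "nrm F.S y \<le> min 1 (2 powi (- m)) * F.J m y"
      by (intro E.S_le_J F.S_le_J x y)+
    have "nrm E.S x * nrm F.S y \<le> (min 1 (2 powi (- n)) * E.J n x) * (min 1 (2 powi (- m)) * F.J m y)"
      using nn by (intro mult_mono le mult_nonneg_nonneg) auto
    also have "\<dots> = (min 1 (2 powi (- n)) * min 1 (2 powi (- m))) * (E.J n x * F.J m y)" by simp
    also have "\<dots> \<le> \<eta> * (E.J n x * F.J m y)"
    proof (intro mult_right_mono mult_nonneg_nonneg nn)
      have "min 1 (2 powi (- n)) * min 1 (2 powi (- m)) \<le> min 1 (2 powi (- n)) * (1::real)"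
        "min 1 (2 powi (- n)) * min 1 (2 powi (- m)) \<le> 1 * min 1 (2 powi (- m) :: real)"
        by (intro mult_left_mono mult_right_mono; simp)+
      then show "min 1 (2 powi (- n)) * min 1 (2 powi (- m)) \<le> \<eta>"
        using nm pw[of n] pw[of m] by linarith
    qed
    finally show "nrm G0 (T x y) \<le> \<delta> * (E.J n x * F.J m y)"
      using x y by (intro \<eta>(2) E.nrm0_le_J F.nrm0_le_J) auto
  qed
qed

text \<open>The counterpart at the endpoint 1, where \<open>2 powi (- n) * E.J n x\<close> is the
  bound on the norm of \<open>x\<close>. Relative to this bound the norm in \<open>E.S\<close> is at
  most \<open>min 1 (2 powi n)\<close>, which is small for very negative \<open>n\<close>;
  \<open>resc\<close> performs the change of scale.\<close>

lemma T_small_low: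
  assumes "\<delta> > 0"
  obtains N :: nat where
    "\<And>n m x y. \<lbrakk>x \<in> pts E0 \<inter> pts E1; y \<in> pts F0 \<inter> pts F1; n < - int N \<or> m < - int N\<rbrakk>
      \<Longrightarrow> nrm G1 (T x y) \<le> \<delta> * 2 powi (- (n + m)) * (E.J n x * F.J m y)"
proof -
  obtain \<eta> where \<eta>: "\<eta> > 0"
    "\<And>x y a b. \<lbrakk>x \<in> pts E1; y \<in> pts F1; nrm E1 x \<le> a; nrm F1 y \<le> b; nrm E.S x * nrm F.S y \<le> \<eta> * (a * b)\<rbrakk>
      \<Longrightarrow> nrm G1 (T x y) \<le> \<delta> * (a * b)"
    by (rule compact_bilinear_small[OF T1 T_sum E.X1 E.S subsetI[OF E.S_right(1)] F.X1 F.S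
          subsetI[OF F.S_right(1)] banach_couple_normed(4)[OF G.couple] G.S subsetI[OF G.S_right(1)]
          G.S_right(2) \<open>\<delta> > 0\<close>]) blast+
  obtain N :: nat where N: "(1 / 2) ^ N < \<eta>"
    using real_arch_pow_inv[OF \<eta>(1), of "1 / 2"] by auto
  have pw: "2 powi n \<le> \<eta>" if "n < - int N" for n
  proof -
    have "2 powi n \<le> (2::real) powi (- int N)" using that by (intro power_int_increasing) auto
    also have "\<dots> = (1 / 2) ^ N" by (simp add: power_int_minus power_divide inverse_eq_divide)
    finally show ?thesis using N by simp
  qed
  show ?thesis
  proof (rule that[of N])
    fix n m x y
    assume x: "x \<in> pts E0 \<inter> pts E1" and y: "y \<in> pts F0 \<inter> pts F1" and nm: "n < - int N \<or> m < - int N"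
    let ?a = "2 powi (- n) * E.J n x" and ?b = "2 powi (- m) * F.J m y"
    have nn: "0 \<le> E.J n x" "0 \<le> F.J m y" "0 \<le> nrm F.S y" "0 \<le> nrm E.S x"
      using x y E.J_nonneg F.J_nonneg normed_space_nonneg[OF F.S F.in_sum_space]
        normed_space_nonneg[OF E.S E.in_sum_space] by auto
    have resc: "min 1 (2 powi (- k)) * t = min 1 (2 powi k) * (2 powi (- k) * t)" for k :: int and t :: real
    proof -
      have "min 1 (2 powi k) * 2 powi (- k) = min (2 powi (- k)) (2 powi k * 2 powi (- k) :: real)"
        by (simp add: min_mult_distrib_right)
      also have "2 powi k * 2 powi (- k) = (1::real)" by (simp add: power_int_minus)
      finally show ?thesis by (simp only: mult.assoc[symmetric] min.commute)
    qed
    have le: "nrm E.S x \<le> min 1 (2 powi n) * ?a" "nrm F.S y \<le> min 1 (2 powi m) * ?b"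
      using E.S_le_J[OF x, of n] F.S_le_J[OF y, of m] unfolding resc[of n] resc[of m] .
    have "nrm E.S x * nrm F.S y \<le> (min 1 (2 powi n) * ?a) * (min 1 (2 powi m) * ?b)"
      using nn by (intro mult_mono le mult_nonneg_nonneg) auto
    also have "\<dots> = (min 1 (2 powi n) * min 1 (2 powi m)) * (?a * ?b)" by simp
    also have "\<dots> \<le> \<eta> * (?a * ?b)"
    proof (intro mult_right_mono mult_nonneg_nonneg nn)
      have "min 1 (2 powi n) * min 1 (2 powi m) \<le> min 1 (2 powi n) * (1::real)"
        "min 1 (2 powi n) * min 1 (2 powi m) \<le> 1 * min 1 (2 powi m :: real)"
        by (intro mult_left_mono mult_right_mono; simp)+
      then show "min 1 (2 powi n) * min 1 (2 powi m) \<le> \<eta>"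
        using nm pw[of n] pw[of m] by linarith
    qed simp_all
    finally have "nrm G1 (T x y) \<le> \<delta> * (?a * ?b)"
      using x y by (intro \<eta>(2) E.nrm1_le_J F.nrm1_le_J) auto
    also have "\<dots> = \<delta> * 2 powi (- (n + m)) * (E.J n x * F.J m y)"
      by (simp only: powi_minus_add ac_simps)
    finally show "nrm G1 (T x y) \<le> \<delta> * 2 powi (- (n + m)) * (E.J n x * F.J m y)" .
  qed
qed

text \<open>The shift \<open>s\<close> depends only on \<epsilon> and the crude constant
  \<open>C\<close>; the cut-offs come after it, since the smallness they must provide involves
  \<open>dil \<rho>\<close> at the shift. Large indices use \<open>s\<close>: the constants are
  \<open>\<epsilon> / d1\<close> in \<open>G0\<close> and \<open>C\<close> in \<open>G1\<close>, and
  \<open>2 powi (- s) * C * d1 < \<epsilon>\<close>. Very negative ones use \<open>- s\<close>: the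
  constants are \<open>C\<close> in \<open>G0\<close>, with \<open>C * d2 < \<epsilon>\<close>, and
  \<open>\<epsilon> / (2 powi s * d2)\<close> in \<open>G1\<close>, where the shift cancels
  \<open>2 powi s\<close>.\<close>

lemma T_tail:
  assumes "\<epsilon> > 0"
  obtains N :: nat where
    "\<And>x u A y v B. \<lbrakk>x \<in> pts E.S; u \<in> J_reps E0 E1 x; 0 \<le> A; lq_le p (E.normalized u) A;
      y \<in> pts F.S; v \<in> J_reps F0 F1 y; 0 \<le> B; lq_le q (F.normalized v) B;
      (\<forall>n\<le>int N. u n = 0) \<or> (\<forall>n\<le>int N. v n = 0) \<or> (\<forall>n\<ge>- int N. u n = 0) \<or> (\<forall>n\<ge>- int N. v n = 0)\<rbrakk>
      \<Longrightarrow> G.J_le (T x y) (\<epsilon> * (A * B))"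
proof -
  obtain C where C: "C > 0"
    "\<And>n m x y. \<lbrakk>x \<in> pts E0 \<inter> pts E1; y \<in> pts F0 \<inter> pts F1\<rbrakk> \<Longrightarrow> nrm G0 (T x y) \<le> C * (E.J n x * F.J m y)"
    "\<And>n m x y. \<lbrakk>x \<in> pts E0 \<inter> pts E1; y \<in> pts F0 \<inter> pts F1\<rbrakk> \<Longrightarrow>
      nrm G1 (T x y) \<le> C * 2 powi (- (n + m)) * (E.J n x * F.J m y)"
    using T_bound_J by blast
  obtain s :: int where s: "2 powi (- s) * dil \<rho> (2 powi s) < \<epsilon> / C" "dil \<rho> (2 powi (- s)) < \<epsilon> / C"
    using dil_shift_small[OF \<rho>, of "\<epsilon> / C"] assms C(1) by auto
  define d1 d2 where "d1 = dil \<rho> (2 powi s)" and "d2 = dil \<rho> (2 powi (- s))"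
  have d: "d1 > 0" "d2 > 0" unfolding d1_def d2_def by (rule dil_powi_pos)+
  obtain N0 :: nat where N0: "\<And>n m x y. \<lbrakk>x \<in> pts E0 \<inter> pts E1; y \<in> pts F0 \<inter> pts F1; int N0 < n \<or> int N0 < m\<rbrakk>
      \<Longrightarrow> nrm G0 (T x y) \<le> \<epsilon> / d1 * (E.J n x * F.J m y)"
    using T_small_high[of "\<epsilon> / d1"] assms d by auto
  obtain N1 :: nat where N1: "\<And>n m x y. \<lbrakk>x \<in> pts E0 \<inter> pts E1; y \<in> pts F0 \<inter> pts F1; n < - int N1 \<or> m < - int N1\<rbrakk>
      \<Longrightarrow> nrm G1 (T x y) \<le> \<epsilon> / (2 powi s * d2) * 2 powi (- (n + m)) * (E.J n x * F.J m y)"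
    using T_small_low[of "\<epsilon> / (2 powi s * d2)"] assms d by auto
  show ?thesis
  proof (rule that[of "max N0 N1"])
    fix x u A y v B
    assume x: "x \<in> pts E.S" "u \<in> J_reps E0 E1 x" "0 \<le> A" "lq_le p (E.normalized u) A"
      and y: "y \<in> pts F.S" "v \<in> J_reps F0 F1 y" "0 \<le> B" "lq_le q (F.normalized v) B"
      and supp: "(\<forall>n\<le>int (max N0 N1). u n = 0) \<or> (\<forall>n\<le>int (max N0 N1). v n = 0)
        \<or> (\<forall>n\<ge>- int (max N0 N1). u n = 0) \<or> (\<forall>n\<ge>- int (max N0 N1). v n = 0)"
    have u: "u n \<in> pts E0 \<inter> pts E1" and v: "v n \<in> pts F0 \<inter> pts F1" for n
      using E.J_reps_mem[OF x(2)] F.J_reps_mem[OF y(2)] by blast+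
    have JJ: "0 \<le> E.J n (u n) * F.J m (v m)" for n m
      using u v by (intro mult_nonneg_nonneg E.J_nonneg F.J_nonneg) auto
    have zero: "nrm G0 (T (u n) (v m)) = 0 \<and> nrm G1 (T (u n) (v m)) = 0" if "u n = 0 \<or> v m = 0" for n m
      using that u[of n] v[of m] bounded_bilinear_map_zero[OF T0_bounded E.X0 F.X0]
        normed_space_zero[OF G.X0] normed_space_zero[OF G.X1] by auto
    have AB: "0 \<le> A * B" using x y by simp
    have scaled_J_le: "G.J_le (T x y) (\<epsilon> * (A * B))"
      if "G.J_le (T x y) (K * (A * B))" "K \<le> \<epsilon>" "0 \<le> K" for K
      using G.J_le_weaken[OF mult_nonneg_nonneg[OF that(3) AB] mult_right_mono[OF that(2) AB] that(1)] .
    have mx: "max a b * d \<le> e" if "a * d \<le> e" "b * d \<le> e" for a b d e :: real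
      using that by (simp add: max_def)
    \<comment> \<open>It is enough that one of the two sequences is a tail: a pair
      \<open>(n, m)\<close> outside the region of smallness then has a vanishing factor, so its
      product is 0 and satisfies any bound.\<close>
    from supp consider (high) "\<And>n m. int N0 < n \<or> int N0 < m \<or> u n = 0 \<or> v m = 0"
      | (low) "\<And>n m. n < - int N1 \<or> m < - int N1 \<or> u n = 0 \<or> v m = 0"
    proof (elim disjE)
      assume "\<forall>n\<le>int (max N0 N1). u n = 0"
      then have "int N0 < n \<or> u n = 0" for n by (cases "n \<le> int (max N0 N1)") auto
      then show thesis using high by blast
    next
      assume "\<forall>n\<le>int (max N0 N1). v n = 0"
      then have "int N0 < n \<or> v n = 0" for n by (cases "n \<le> int (max N0 N1)") auto
      then show thesis using high by blast
    next
      assume "\<forall>n\<ge>- int (max N0 N1). u n = 0"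
      then have "n < - int N1 \<or> u n = 0" for n by (cases "n \<ge> - int (max N0 N1)") auto
      then show thesis using low by blast
    next
      assume "\<forall>n\<ge>- int (max N0 N1). v n = 0"
      then have "n < - int N1 \<or> v n = 0" for n by (cases "n \<ge> - int (max N0 N1)") auto
      then show thesis using low by blast
    qed
    then show "G.J_le (T x y) (\<epsilon> * (A * B))"
    proof cases
      case high
      have "G.J_le (T x y) (max (\<epsilon> / d1) (2 powi (- s) * C) * dil \<rho> (2 powi s) * (A * B))"
      proof (rule main_estimate[OF x y])
        show "0 \<le> \<epsilon> / d1" "0 \<le> C" using assms d C by simp_all
        show "nrm G0 (T (u n) (v m)) \<le> \<epsilon> / d1 * (E.J n (u n) * F.J m (v m))" for n m
        proof (cases "u n = 0 \<or> v m = 0")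
          case True
          then show ?thesis using zero[OF True] JJ[of n m] assms d by (simp del: times_divide_eq_left)
        next
          case False
          then show ?thesis using high[of n m] by (intro N0 u v) blast
        qed
        show "nrm G1 (T (u n) (v m)) \<le> C * 2 powi (- (n + m)) * (E.J n (u n) * F.J m (v m))" for n m
          by (intro C u v)
      qed
      moreover have "max (\<epsilon> / d1) (2 powi (- s) * C) * d1 \<le> \<epsilon>"
      proof -
        have "\<epsilon> / d1 * d1 \<le> \<epsilon>" using d by simp
        moreover have "2 powi (- s) * C * d1 \<le> \<epsilon>"
          using s(1) C(1) by (simp add: d1_def less_divide_eq ac_simps)
        ultimately show ?thesis by (rule mx)
      qed
      moreover have "0 \<le> max (\<epsilon> / d1) (2 powi (- s) * C) * d1"
        using assms C(1) d by (intro mult_nonneg_nonneg) (simp_all add: le_max_iff_disj)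
      ultimately show ?thesis
        unfolding d1_def by (rule scaled_J_le)
    next
      case low
      have "G.J_le (T x y) (max C (2 powi (- (- s)) * (\<epsilon> / (2 powi s * d2))) * dil \<rho> (2 powi (- s)) * (A * B))"
      proof (rule main_estimate[OF x y])
        show "0 \<le> \<epsilon> / (2 powi s * d2)" "0 \<le> C" using assms d C by simp_all
        show "nrm G1 (T (u n) (v m)) \<le> \<epsilon> / (2 powi s * d2) * 2 powi (- (n + m)) * (E.J n (u n) * F.J m (v m))" for n m
        proof (cases "u n = 0 \<or> v m = 0")
          case True
          then show ?thesis using zero[OF True] JJ[of n m] assms d by (simp del: times_divide_eq_left)
        next
          case False
          then show ?thesis using low[of n m] by (intro N1 u v) blast
        qed
        show "nrm G0 (T (u n) (v m)) \<le> C * (E.J n (u n) * F.J m (v m))" for n m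
          by (intro C u v)
      qed
      moreover have "max C (2 powi (- (- s)) * (\<epsilon> / (2 powi s * d2))) * d2 \<le> \<epsilon>"
      proof -
        have "C * d2 \<le> \<epsilon>" using s(2) C(1) by (simp add: d2_def less_divide_eq ac_simps)
        moreover have "2 powi (- (- s)) * (\<epsilon> / (2 powi s * d2)) * d2 \<le> \<epsilon>" using d by simp
        ultimately show ?thesis by (rule mx)
      qed
      moreover have "0 \<le> max C (2 powi (- (- s)) * (\<epsilon> / (2 powi s * d2))) * d2"
        using assms C(1) d by (intro mult_nonneg_nonneg) (simp_all add: le_max_iff_disj)
      ultimately show ?thesis
        unfolding d2_def by (rule scaled_J_le)
    qed
  qed
qed

end

text \<open>The right side depends on \<open>u\<close> only through \<open>B\<close>, so all middle
  parts taken from a unit ball lie in one bounded set. The factor \<open>1 + 2 powi (- n)\<close>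
  covers both endpoint norms at once.\<close>

lemma (in J_method) partial_bound:
  assumes u: "\<And>n. u n \<in> pts X0 \<inter> pts X1" and B: "0 \<le> B" "lq_le q (normalized u) B"
  shows "nrm X0 (sum u I) \<le> (\<Sum>n\<in>I. (1 + 2 powi (- n)) * (f (2 powi n) * B))"
    and "nrm X1 (sum u I) \<le> (\<Sum>n\<in>I. (1 + 2 powi (- n)) * (f (2 powi n) * B))"
proof -
  have nn: "0 \<le> f (2 powi n) * B" for n
    using B less_imp_le[OF f_pos'] by (intro mult_nonneg_nonneg)
  have "nrm X0 (u n) \<le> (1 + 2 powi (- n)) * (f (2 powi n) * B)" for n
  proof -
    have "nrm X0 (u n) \<le> 1 * (f (2 powi n) * B)"
      using order_trans[OF nrm0_le_J J_le_normalized[OF B]] by simp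
    also have "\<dots> \<le> (1 + 2 powi (- n)) * (f (2 powi n) * B)"
      by (intro mult_right_mono nn) simp
    finally show ?thesis .
  qed
  then show "nrm X0 (sum u I) \<le> (\<Sum>n\<in>I. (1 + 2 powi (- n)) * (f (2 powi n) * B))"
    using u by (intro order_trans[OF normed_space_sum[OF X0] sum_mono]) auto
  have "nrm X1 (u n) \<le> (1 + 2 powi (- n)) * (f (2 powi n) * B)" for n
  proof -
    have "nrm X1 (u n) \<le> 2 powi (- n) * J n (u n)" by (rule nrm1_le_J)
    also have "\<dots> \<le> 2 powi (- n) * (f (2 powi n) * B)"
      by (intro mult_left_mono J_le_normalized B) simp
    also have "\<dots> \<le> (1 + 2 powi (- n)) * (f (2 powi n) * B)"
      by (intro mult_right_mono nn) simp
    finally show ?thesis .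
  qed
  then show "nrm X1 (sum u I) \<le> (\<Sum>n\<in>I. (1 + 2 powi (- n)) * (f (2 powi n) * B))"
    using u by (intro order_trans[OF normed_space_sum[OF X1] sum_mono]) auto
qed

section \<open>Reduction to bounded sets in the intersections, and compactness\<close>

context bilinear_interpolation
begin

text \<open>The middle parts \<open>x0\<close>, \<open>y0\<close> of representations of
  \<open>x\<close>, \<open>y\<close> are taken. The difference \<open>T x y - T x0 y0\<close> is a
  sum of four products, two with a tail of \<open>x\<close> and two pairing \<open>x0\<close> with a
  tail of \<open>y\<close>. With bounds 2 on both sequences each is at most
  \<open>\<epsilon> / 16 * (2 * 2)\<close>, hence the constant 16.\<close>

lemma unit_ball_approx:
  assumes "\<epsilon> > 0"
  obtains M where "M > 0" "\<And>x y. \<lbrakk>x \<in> pts E.Y; y \<in> pts F.Y; nrm E.Y x \<le> 1; nrm F.Y y \<le> 1\<rbrakk> \<Longrightarrow>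
    \<exists>x0 y0. x0 \<in> pts E0 \<inter> pts E1 \<and> y0 \<in> pts F0 \<inter> pts F1 \<and> nrm E0 x0 \<le> M \<and> nrm E1 x0 \<le> M \<and>
      nrm F0 y0 \<le> M \<and> nrm F1 y0 \<le> M \<and> G.J_le (T x y - T x0 y0) \<epsilon>"
proof -
  obtain N :: nat where N: "\<And>x u A y v B. \<lbrakk>x \<in> pts E.S; u \<in> J_reps E0 E1 x; 0 \<le> A; lq_le p (E.normalized u) A;
      y \<in> pts F.S; v \<in> J_reps F0 F1 y; 0 \<le> B; lq_le q (F.normalized v) B;
      (\<forall>n\<le>int N. u n = 0) \<or> (\<forall>n\<le>int N. v n = 0) \<or> (\<forall>n\<ge>- int N. u n = 0) \<or> (\<forall>n\<ge>- int N. v n = 0)\<rbrakk>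
      \<Longrightarrow> G.J_le (T x y) (\<epsilon> / 16 * (A * B))"
    using T_tail[of "\<epsilon> / 16"] assms by auto
  let ?I = "{- int N..int N}"
  define ME MF where "ME = (\<Sum>n\<in>?I. (1 + 2 powi (- n)) * (\<gamma> (2 powi n) * 2))"
    and "MF = (\<Sum>n\<in>?I. (1 + 2 powi (- n)) * (\<rho> (2 powi n) * 2))"
  have M0: "0 \<le> ME" "0 \<le> MF"
    unfolding ME_def MF_def using less_imp_le[OF E.f_pos'] less_imp_le[OF F.f_pos']
    by (auto intro!: sum_nonneg)
  show ?thesis
  proof (rule that[of "ME + MF + 1"])
    show "ME + MF + 1 > 0" using M0 by simp
    fix x y assume xy: "x \<in> pts E.Y" "y \<in> pts F.Y" "nrm E.Y x \<le> 1" "nrm F.Y y \<le> 1"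
    then have xS: "x \<in> pts E.S" and yS: "y \<in> pts F.S"
      using E.interp_space_mem F.interp_space_mem by auto
    \<comment> \<open>Any bound above 1 would do; a representation attaining the norm need not
      exist.\<close>
    have "E.J_le x 2" "F.J_le y 2"
      using xy by (auto intro!: E.interp_space_J_le F.interp_space_J_le)
    then obtain u v where u: "u \<in> J_reps E0 E1 x" "lq_le p (E.normalized u) 2"
      and v: "v \<in> J_reps F0 F1 y" "lq_le q (F.normalized v) 2"
      by (auto simp: E.J_le_def F.J_le_def)
    have two: "(0::real) \<le> 2" and N0: "0 \<le> int N" by simp_all
    have mu: "u n \<in> pts E0 \<inter> pts E1" and mv: "v n \<in> pts F0 \<inter> pts F1" for n
      by (rule E.J_reps_mem[OF u(1)], rule F.J_reps_mem[OF v(1)])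
    define x0 y0 where "x0 = sum u ?I" and "y0 = sum v ?I"
    have x0: "x0 \<in> pts E0 \<inter> pts E1" "x0 \<in> pts E.S" and y0: "y0 \<in> pts F0 \<inter> pts F1" "y0 \<in> pts F.S"
      unfolding x0_def y0_def
      by (rule E.partial_mem[OF mu], rule E.partial_mem_S[OF mu], rule F.partial_mem[OF mv],
          rule F.partial_mem_S[OF mv])
    have nx0: "nrm E0 x0 \<le> ME" "nrm E1 x0 \<le> ME" and ny0: "nrm F0 y0 \<le> MF" "nrm F1 y0 \<le> MF"
      unfolding x0_def y0_def ME_def MF_def
      by (rule E.partial_bound[OF mu two u(2)] F.partial_bound[OF mv two v(2)])+
    obtain xm xp where xm: "xm \<in> pts E.S" "(\<lambda>n. if n < - int N then u n else 0) \<in> J_reps E0 E1 xm"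
      and xp: "xp \<in> pts E.S" "(\<lambda>n. if int N < n then u n else 0) \<in> J_reps E0 E1 xp"
      and x: "x = xm + x0 + xp"
      using E.J_reps_split[OF xS u(1) two u(2) N0] unfolding x0_def by blast
    obtain ym yp where ym: "ym \<in> pts F.S" "(\<lambda>n. if n < - int N then v n else 0) \<in> J_reps F0 F1 ym"
      and yp: "yp \<in> pts F.S" "(\<lambda>n. if int N < n then v n else 0) \<in> J_reps F0 F1 yp"
      and y: "y = ym + y0 + yp"
      using F.J_reps_split[OF yS v(1) two v(2) N0] unfolding y0_def by blast
    have rx0: "(\<lambda>n. if n \<in> ?I then u n else 0) \<in> J_reps E0 E1 x0"
      unfolding x0_def by (rule E.J_reps_finite[OF _ mu]) simp
    note ru = E.normalized_restrict[OF u(2)] and rv = F.normalized_restrict[OF v(2)]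
    have pieces: "G.J_le (T xm y) (\<epsilon> / 16 * (2 * 2))" "G.J_le (T xp y) (\<epsilon> / 16 * (2 * 2))"
      "G.J_le (T x0 ym) (\<epsilon> / 16 * (2 * 2))" "G.J_le (T x0 yp) (\<epsilon> / 16 * (2 * 2))"
      by (rule N[OF xm two ru yS v(1) two v(2)], simp,
          rule N[OF xp two ru yS v(1) two v(2)], simp,
          rule N[OF x0(2) rx0 two ru ym two rv], simp,
          rule N[OF x0(2) rx0 two ru yp two rv], simp)
    have TG: "T a b \<in> pts G.S" if "a \<in> pts E.S" "b \<in> pts F.S" for a b
      using that by (rule bounded_bilinear_mapD(1)[OF T_sum])
    have "T x y = T xm y + T x0 y + T xp y"
    proof -
      have "xm + x0 \<in> pts E.S" using xm x0 by (intro normed_space_mem(2)[OF E.S])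
      then show ?thesis unfolding x
        using bounded_bilinear_mapD(2)[OF T_sum] xm x0 xp yS by metis
    qed
    moreover have "T x0 y = T x0 ym + T x0 y0 + T x0 yp"
    proof -
      have "ym + y0 \<in> pts F.S" using ym y0 by (intro normed_space_mem(2)[OF F.S])
      then show ?thesis unfolding y
        using bounded_bilinear_mapD(3)[OF T_sum] ym y0 yp x0 by metis
    qed
    ultimately have diff: "T x y - T x0 y0 = (T xm y + T xp y) + (T x0 ym + T x0 yp)"
      by (simp add: algebra_simps)
    have e: "0 \<le> \<epsilon> / 16 * (2 * 2)" using assms by simp
    have mem4: "T xm y \<in> pts G.S" "T xp y \<in> pts G.S" "T x0 ym \<in> pts G.S" "T x0 yp \<in> pts G.S"
      by (intro TG xm xp x0 ym yp yS)+
    have "G.J_le ((T xm y + T xp y) + (T x0 ym + T x0 yp))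
        ((\<epsilon> / 16 * (2 * 2) + \<epsilon> / 16 * (2 * 2)) + (\<epsilon> / 16 * (2 * 2) + \<epsilon> / 16 * (2 * 2)))"
      by (intro G.J_le_add normed_space_mem(2)[OF G.S] add_nonneg_nonneg mem4 e pieces)
    then have "G.J_le (T x y - T x0 y0) \<epsilon>" unfolding diff by simp
    then show "\<exists>x0 y0. x0 \<in> pts E0 \<inter> pts E1 \<and> y0 \<in> pts F0 \<inter> pts F1 \<and> nrm E0 x0 \<le> ME + MF + 1 \<and>
      nrm E1 x0 \<le> ME + MF + 1 \<and> nrm F0 y0 \<le> ME + MF + 1 \<and> nrm F1 y0 \<le> ME + MF + 1 \<and>
      G.J_le (T x y - T x0 y0) \<epsilon>"
      using x0 y0 nx0 ny0 M0 by (intro exI[of _ x0] exI[of _ y0]) auto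
  qed
qed

text \<open>An element \<open>z\<close> of the image is colored by the pair of colors that a
  rescaled approximant \<open>d z\<close> receives in the two endpoint images. For equal colors
  \<open>d z - d z'\<close> is small in \<open>G0\<close> and in \<open>G1\<close>, thus in the
  intersection, which embeds into the interpolation space.\<close>

lemma T_interp_compact: "compact_bilinear_map E.Y F.Y G.Y T"
proof -
  define A where "A = {T x y |x y. x \<in> pts E.Y \<and> y \<in> pts F.Y \<and> max (nrm E.Y x) (nrm F.Y y) \<le> 1}"
  define U where "U = {T x y |x y. x \<in> pts E0 \<and> y \<in> pts F0 \<and> max (nrm E0 x) (nrm F0 y) \<le> 1}"
  define V where "V = {T x y |x y. x \<in> pts E1 \<and> y \<in> pts F1 \<and> max (nrm E1 x) (nrm F1 y) \<le> 1}"
  note GY = Metric_space_ndist[OF G.interp_space_normed]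
  note GM0 = Metric_space_ndist[OF G.X0] and GM1 = Metric_space_ndist[OF G.X1]
  have AY: "A \<subseteq> pts G.Y" using bounded_bilinear_mapD(1)[OF T_interp_bounded] by (auto simp: A_def)
  have "Metric_space.mtotally_bounded (pts G.Y) (ndist G.Y) A"
  proof (rule Metric_space.coloring_imp_mtotally_bounded[OF GY AY])
    fix \<epsilon> :: real assume eps: "\<epsilon> > 0"
    obtain M where M: "M > 0" "\<And>x y. \<lbrakk>x \<in> pts E.Y; y \<in> pts F.Y; nrm E.Y x \<le> 1; nrm F.Y y \<le> 1\<rbrakk> \<Longrightarrow>
      \<exists>x0 y0. x0 \<in> pts E0 \<inter> pts E1 \<and> y0 \<in> pts F0 \<inter> pts F1 \<and> nrm E0 x0 \<le> M \<and> nrm E1 x0 \<le> M \<and>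
        nrm F0 y0 \<le> M \<and> nrm F1 y0 \<le> M \<and> G.J_le (T x y - T x0 y0) (\<epsilon> / 4)"
      using unit_ball_approx[of "\<epsilon> / 4"] eps by auto
    \<comment> \<open>Both factors of the approximant are bounded by \<open>M\<close> and are
      divided by it to enter the unit balls; by bilinearity their product is multiplied by
      \<open>1 / (M * M)\<close>.\<close>
    define c where "c = 1 / (M * M)"
    have c: "c > 0" using M by (simp add: c_def)
    have approx: "\<exists>d. d \<in> pts G0 \<inter> pts G1 \<and> c *\<^sub>R d \<in> U \<and> c *\<^sub>R d \<in> V \<and> G.J_le (z - d) (\<epsilon> / 4)"
      if z: "z \<in> A" for z
    proof -
      obtain x y where xy: "z = T x y" "x \<in> pts E.Y" "y \<in> pts F.Y" "nrm E.Y x \<le> 1" "nrm F.Y y \<le> 1"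
        using z by (auto simp: A_def)
      obtain x0 y0 where *: "x0 \<in> pts E0 \<inter> pts E1" "y0 \<in> pts F0 \<inter> pts F1" "nrm E0 x0 \<le> M" "nrm E1 x0 \<le> M"
        "nrm F0 y0 \<le> M" "nrm F1 y0 \<le> M" "G.J_le (T x y - T x0 y0) (\<epsilon> / 4)"
        using M(2)[OF xy(2-5)] by blast
      define x' y' where "x' = (1 / M) *\<^sub>R x0" and "y' = (1 / M) *\<^sub>R y0"
      have m: "x' \<in> pts E0" "x' \<in> pts E1" "y' \<in> pts F0" "y' \<in> pts F1"
        unfolding x'_def y'_def using *
        by (auto intro: normed_space_mem(5)[OF E.X0] normed_space_mem(5)[OF E.X1]
            normed_space_mem(5)[OF F.X0] normed_space_mem(5)[OF F.X1])
      have n: "nrm E0 x' \<le> 1" "nrm E1 x' \<le> 1" "nrm F0 y' \<le> 1" "nrm F1 y' \<le> 1"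
        unfolding x'_def y'_def using * M(1)
        by (simp_all add: normed_space_scale[OF E.X0] normed_space_scale[OF E.X1]
            normed_space_scale[OF F.X0] normed_space_scale[OF F.X1])
      have "T x' y' = c *\<^sub>R T x0 y0"
        using bounded_bilinear_mapD(4)[OF T0_bounded, of x0 y' "1 / M"]
          bounded_bilinear_mapD(5)[OF T0_bounded, of x0 y0 "1 / M"] * m
        by (simp add: x'_def y'_def c_def)
      moreover have "T x' y' \<in> U" "T x' y' \<in> V"
        using m n by (auto simp: U_def V_def intro!: exI[of _ x'] exI[of _ y'])
      moreover have "T x0 y0 \<in> pts G0 \<inter> pts G1"
        using *(1,2) bounded_bilinear_mapD(1)[OF T0_bounded, of x0 y0]
          bounded_bilinear_mapD(1)[OF T1_bounded, of x0 y0] by simp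
      ultimately show ?thesis using *(7) unfolding xy(1) by (intro exI[of _ "T x0 y0"]) (simp only:)
    qed
    then obtain d where d: "\<And>z. z \<in> A \<Longrightarrow> d z \<in> pts G0 \<inter> pts G1" "\<And>z. z \<in> A \<Longrightarrow> c *\<^sub>R d z \<in> U"
      "\<And>z. z \<in> A \<Longrightarrow> c *\<^sub>R d z \<in> V" "\<And>z. z \<in> A \<Longrightarrow> G.J_le (z - d z) (\<epsilon> / 4)" by metis
    have \<eta>: "c * (\<epsilon> / 4) > 0" using eps c by simp
    have tb: "Metric_space.mtotally_bounded (pts G0) (ndist G0) U"
      "Metric_space.mtotally_bounded (pts G1) (ndist G1) V"
      using T0 T1 by (simp_all add: compact_bilinear_map_def U_def V_def)
    obtain f0 :: "'c \<Rightarrow> 'c" where f0: "finite (f0 ` U)"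
      "\<And>x y. x \<in> U \<Longrightarrow> y \<in> U \<Longrightarrow> f0 x = f0 y \<Longrightarrow> ndist G0 x y < c * (\<epsilon> / 4)"
      using Metric_space.mtotally_bounded_imp_coloring[OF GM0 tb(1) \<eta>] by blast
    obtain f1 :: "'c \<Rightarrow> 'c" where f1: "finite (f1 ` V)"
      "\<And>x y. x \<in> V \<Longrightarrow> y \<in> V \<Longrightarrow> f1 x = f1 y \<Longrightarrow> ndist G1 x y < c * (\<epsilon> / 4)"
      using Metric_space.mtotally_bounded_imp_coloring[OF GM1 tb(2) \<eta>] by blast
    define f where "f z = (f0 (c *\<^sub>R d z), f1 (c *\<^sub>R d z))" for z
    have "f ` A \<subseteq> (f0 ` U) \<times> (f1 ` V)"
    proof (rule image_subsetI)
      fix z assume "z \<in> A"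
      then show "f z \<in> (f0 ` U) \<times> (f1 ` V)"
        unfolding f_def by (intro SigmaI imageI d)
    qed
    then have "finite (f ` A)" using f0(1) f1(1) finite_cartesian_product finite_subset by blast
    moreover have "ndist G.Y z z' < \<epsilon>" if z: "z \<in> A" "z' \<in> A" and f: "f z = f z'" for z z'
    proof -
      have dd: "d z - d z' \<in> pts G0" "d z - d z' \<in> pts G1"
        using d(1)[OF z(1)] d(1)[OF z(2)] normed_space_mem(3)[OF G.X0] normed_space_mem(3)[OF G.X1] by auto
      have cd: "c *\<^sub>R d z \<in> pts G0" "c *\<^sub>R d z' \<in> pts G0" "c *\<^sub>R d z \<in> pts G1" "c *\<^sub>R d z' \<in> pts G1"
        using d(1)[OF z(1)] d(1)[OF z(2)] normed_space_mem(5)[OF G.X0] normed_space_mem(5)[OF G.X1] by auto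
      have "ndist G0 (c *\<^sub>R d z) (c *\<^sub>R d z') < c * (\<epsilon> / 4)"
        using f by (intro f0(2) d(2) z) (simp add: f_def)
      then have "c * nrm G0 (d z - d z') < c * (\<epsilon> / 4)"
        using cd dd c by (simp add: ndist_def normed_space_scale[OF G.X0] flip: scaleR_diff_right)
      then have n0: "nrm G0 (d z - d z') < \<epsilon> / 4" using c by (simp only: mult_less_cancel_left_pos)
      have "ndist G1 (c *\<^sub>R d z) (c *\<^sub>R d z') < c * (\<epsilon> / 4)"
        using f by (intro f1(2) d(3) z) (simp add: f_def)
      then have "c * nrm G1 (d z - d z') < c * (\<epsilon> / 4)"
        using cd dd c by (simp add: ndist_def normed_space_scale[OF G.X1] flip: scaleR_diff_right)
      then have n1: "nrm G1 (d z - d z') < \<epsilon> / 4" using c by (simp only: mult_less_cancel_left_pos)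
      have \<rho>1: "\<rho> 1 = 1" using \<rho>_B by (simp add: param_B_def)
      have "G.J_le (d z - d z') (max (nrm G0 (d z - d z')) (nrm G1 (d z - d z')))"
        using G.J_le_intersection[of "d z - d z'"] dd \<rho>1 by simp
      moreover have "0 \<le> max (nrm G0 (d z - d z')) (nrm G1 (d z - d z'))"
        using normed_space_nonneg[OF G.X0 dd(1)] by (simp add: le_max_iff_disj)
      moreover have "max (nrm G0 (d z - d z')) (nrm G1 (d z - d z')) \<le> \<epsilon> / 4"
        using n0 n1 by simp
      ultimately have J2: "G.J_le (d z - d z') (\<epsilon> / 4)" by (rule G.J_le_weaken[rotated 2])
      have zS: "z \<in> pts G.S" "z' \<in> pts G.S" "d z \<in> pts G.S" "d z' \<in> pts G.S"
        using AY z d(1)[OF z(1)] d(1)[OF z(2)] by (auto intro: G.interp_space_mem G.in_sum_space)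
      then have mS: "z - d z \<in> pts G.S" "d z - d z' \<in> pts G.S" "z' - d z' \<in> pts G.S"
        by (auto intro: normed_space_mem(3)[OF G.S])
      have e4: "0 \<le> \<epsilon> / 4" using eps by simp
      \<comment> \<open>Three errors of \<open>\<epsilon> / 4\<close>: two from the approximations
        and one from the equal colors. Their sum stays strictly below \<epsilon>.\<close>
      have "G.J_le (((z - d z) + (d z - d z')) + (- 1) *\<^sub>R (z' - d z')) ((\<epsilon> / 4 + \<epsilon> / 4) + \<bar>- 1\<bar> * (\<epsilon> / 4))"
        by (intro G.J_le_add G.J_le_scale normed_space_mem(2)[OF G.S] normed_space_mem(5)[OF G.S]
            add_nonneg_nonneg mult_nonneg_nonneg abs_ge_zero mS e4 d(4) z J2)
      then have J3: "G.J_le (z - z') (3 / 4 * \<epsilon>)" by simp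
      have "z - z' \<in> pts G.S" using zS by (intro normed_space_mem(3)[OF G.S])
      from G.interp_space_memI(2)[OF this _ J3] have "nrm G.Y (z - z') \<le> 3 / 4 * \<epsilon>" using eps by simp
      then show ?thesis using eps by (auto simp: ndist_def)
    qed
    ultimately show "\<exists>f :: 'c \<Rightarrow> 'c \<times> 'c. finite (f ` A) \<and>
        (\<forall>x\<in>A. \<forall>y\<in>A. f x = f y \<longrightarrow> ndist G.Y x y < \<epsilon>)" by blast
  qed
  then show ?thesis using T_interp_bounded by (simp add: compact_bilinear_map_def A_def)
qed

end

text \<open>Since \<open>\<rho> s \<le> dil \<rho> s\<close>, the dilation series is a majorant. The
  form with a general \<open>f\<close> below \<rho> covers both parameters \<rho> and
  \<gamma>.\<close>

lemma param_Bpm_weights: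
  assumes "\<rho> \<in> param_Bpm" and "\<And>t. t > 0 \<Longrightarrow> 0 \<le> f t" and "\<And>t. t > 0 \<Longrightarrow> f t \<le> \<rho> t"
  shows "(\<lambda>n::int. min 1 (2 powi (- n)) * f (2 powi n)) summable_on UNIV"
proof (rule summable_on_comparison_test[OF dil_summable[OF assms(1)]])
  fix n :: int
  have "f (2 powi n) \<le> \<rho> (2 powi n)" by (rule assms(3)) simp
  also have "\<dots> \<le> dil \<rho> (2 powi n)"
    using assms(1) by (intro param_B_le_dil) (simp_all add: param_Bpm_def)
  finally show "min 1 (2 powi (- n)) * f (2 powi n) \<le> min 1 (2 powi (- n)) * dil \<rho> (2 powi n)"
    by (intro mult_left_mono) auto
  show "0 \<le> min 1 (2 powi (- n)) * f (2 powi n)"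
    by (intro mult_nonneg_nonneg assms(2)) auto
qed

theorem theorem5p2:
  fixes E0 E1 :: "'a::hausdorff_tvs nspace"
    and F0 F1 :: "'b::hausdorff_tvs nspace"
    and G0 G1 :: "'c::hausdorff_tvs nspace"
    and T :: "'a \<Rightarrow> 'b \<Rightarrow> 'c"
    and \<rho> \<gamma> :: "real \<Rightarrow> real"
    and p q r :: ereal
  assumes "banach_couple E0 E1" and "banach_couple F0 F1" and "banach_couple G0 G1"
    and "bounded_bilinear_map (sum_space E0 E1) (sum_space F0 F1) (sum_space G0 G1) T"
    and "compact_bilinear_map E0 F0 G0 T"
    and "compact_bilinear_map E1 F1 G1 T"
    and "\<rho> \<in> param_Bpm"
    and "\<And>t. t > 0 \<Longrightarrow> \<gamma> t = 1 / dil \<rho> (1 / t)"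
    and "1 \<le> p" and "1 \<le> q" and "1 \<le> r"
    and "1 / r = 1 / p + 1 / q - 1"
  shows "compact_bilinear_map (interp_space E0 E1 \<gamma> p) (interp_space F0 F1 \<rho> q)
           (interp_space G0 G1 \<rho> r) T"
proof -
  have \<rho>: "\<rho> \<in> param_B" using assms(7) by (simp add: param_Bpm_def)
  have \<gamma>_pos: "\<gamma> t > 0" if "t > 0" for t
    using assms(8)[OF that] dil_pos[OF \<rho>, of "1 / t"] that by simp
  have \<gamma>_mult: "\<gamma> s * \<rho> t \<le> \<rho> (s * t)" if "s > 0" "t > 0" for s t
  proof -
    \<comment> \<open>Here \<open>t\<close> is read as \<open>(1 / s) * (s * t)\<close>; dividing by
      \<open>dil \<rho> (1 / s)\<close> brings in \<gamma>.\<close>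
    have "\<rho> t \<le> dil \<rho> (1 / s) * \<rho> (s * t)"
      using param_B_dil[OF \<rho>, of "1 / s" "s * t"] that by simp
    then show ?thesis
      using assms(8)[OF that(1)] dil_pos[OF \<rho>, of "1 / s"] that by (simp add: divide_le_eq mult.commute)
  qed
  have \<gamma>_le: "\<gamma> t \<le> \<rho> t" if "t > 0" for t
    using \<gamma>_mult[OF that, of 1] \<rho> by (simp add: param_B_def)
  have weights: "(\<lambda>n::int. min 1 (2 powi (- n)) * \<gamma> (2 powi n)) summable_on UNIV"
    "(\<lambda>n::int. min 1 (2 powi (- n)) * \<rho> (2 powi n)) summable_on UNIV"
    using \<gamma>_pos \<gamma>_le param_B_pos[OF \<rho>]
    by (auto intro!: param_Bpm_weights[OF assms(7)] intro: less_imp_le)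
  interpret bilinear_interpolation E0 E1 F0 F1 G0 G1 \<gamma> \<rho> p q r T
    by unfold_locales (fact assms \<gamma>_pos param_B_pos[OF \<rho>] \<gamma>_mult weights)+
  show ?thesis by (rule T_interp_compact)
qed

end
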